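(* Let $d\ge1$, let $E$ be a complex Banach space, and consider $\boldsymbol{\alpha},\boldsymbol{\alpha}'\in(\mathbb{N}^+)^d$ and $k,k'>0$. The following statements hold: (1) If $\hat f\in E\{\boldsymbol{x}\}^{\boldsymbol{\alpha}}_{1/k}$ and $\hat T_{\boldsymbol{\alpha}}(\hat f)$ is an $s$-Gevrey series with some $s<1/k$, then $\hat f$ is convergent. In particular, if $\max_{1\le j\le d}\{\alpha_j/\alpha_j'\}<k'/k$, then $E\{\boldsymbol{x}\}^{\boldsymbol{\alpha}}_{1/k}\cap E[[\boldsymbol{x}]]^{\boldsymbol{\alpha}'}_{1/k'}=E\{\boldsymbol{x}\}$. (2) $E\{\boldsymbol{x}\}^{\boldsymbol{\alpha}}_{1/k}\cap E\{\boldsymbol{x}\}^{\boldsymbol{\alpha}'}_{1/k'}=E\{\boldsymbol{x}\}$, except in the case $k\boldsymbol{\alpha}=k'\boldsymbol{\alpha}'$, where $E\{\boldsymbol{x}\}^{\boldsymbol{\alpha}}_{1/k}=E\{\boldsymbol{x}\}^{\boldsymbol{\alpha}'}_{1/k'}$.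
   Context: Notation: $\mathbb{N}=\{0,1,2,\dots\}$, $\mathbb{N}^+=\mathbb{N}\setminus\{0\}$, $D_r\subset\mathbb{C}$ is the open disc of radius $r$ at $0$; $\boldsymbol{x}=(x_1,\dots,x_d)$, $\boldsymbol{x}^{\boldsymbol{\beta}}=x_1^{\beta_1}\cdots x_d^{\beta_d}$; $\boldsymbol{\alpha}\le\boldsymbol{\beta}$ is componentwise and $\not\le$ is its negation. $E[[\boldsymbol{x}]]$ (resp. $E\{\boldsymbol{x}\}$) is the space of formal (resp. convergent) power series with coefficients in $E$; $\mathcal{O}_b(U,E)$ denotes bounded holomorphic $E$-valued maps. $\hat{\mathcal{O}}'_d(E)=\bigcup_{r>0}\bigcap_{j=1}^d\mathcal{O}_b(D_r^{d-1},E)[[x_j]]\subset E[[\boldsymbol{x}]]$. Every $\hat f=\sum a_{\boldsymbol{\beta}}\boldsymbol{x}^{\boldsymbol{\beta}}$ is written uniquely as $\hat f=\sum_{n\ge0}\hat f_{\boldsymbol{\alpha},n}(\boldsymbol{x})\boldsymbol{x}^{n\boldsymbol{\alpha}}$, $\hat f_{\boldsymbol{\alpha},n}=\sum_{\boldsymbol{\alpha}\not\le\boldsymbol{\beta}}a_{n\boldsymbol{\alpha}+\boldsymbol{\beta}}\boldsymbol{x}^{\boldsymbol{\beta}}$; for $\hat f\in\hat{\mathcal{O}}'_d(E)$ all $\hat f_{\boldsymbol{\alpha},n}=f_{\boldsymbol{\alpha},n}$ are bounded holomorphic on a common polydisc at the origin, and $\hat T_{\boldsymbol{\alpha}}(\hat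 f)=\sum_{n\ge0}f_{\boldsymbol{\alpha},n}t^n$. For $s\ge0$, $\hat T_{\boldsymbol{\alpha}}(\hat f)$ is an $s$-Gevrey series if there are $r,B,D>0$ with $f_{\boldsymbol{\alpha},n}\in\mathcal{O}_b(D_r^d,E)$ and $\sup_{D_r^d}\|f_{\boldsymbol{\alpha},n}\|\le DB^nn!^s$ for all $n$; $E[[\boldsymbol{x}]]^{\boldsymbol{\alpha}}_s$ is the space of $\hat f\in\hat{\mathcal{O}}'_d(E)$ with this property. Monomial sectors: $S_{\boldsymbol{\alpha}}(\theta,b-a,r)=\Pi_{\boldsymbol{\alpha}}(a,b,r)=\{\boldsymbol{x}\in\mathbb{C}^d: a<\arg(\boldsymbol{x}^{\boldsymbol{\alpha}})<b,\ 0<|x_j|^{\alpha_j}<r,\ j=1,\dots,d\}$, $\theta=(a+b)/2$, with any convenient value of $\arg$ (if $b-a>2\pi$, points are pairs $(\boldsymbol{x},\vartheta)$ with $\vartheta\in(a,b)$ an argument of $\boldsymbol{x}^{\boldsymbol{\alpha}}$). For $f$ holomorphic on $\Pi_{\boldsymbol{\alpha}}(a,b,r)$ and $\hat f\in\hat{\mathcal{O}}'_d(E)$, $f\sim^{\boldsymbol{\alpha}}_s\hat f$ on $\Pi_{\boldsymbol{\alpha}}(a,b,r)$ means: there is $0<r'\le r$ such that all $f_{\boldsymbol{\alpha},n}$ are bounded holomorphic on $\{|x_j|^{\alpha_j}<r'\ \forall j\}$ and for every $\Pi'=\Pi_{\boldsymbol{\alpha}}(a',b',\rho)$ with $a<a'<b'<b$,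 $0<\rho<r'$, there are $C,A>0$ with $\|f(\boldsymbol{x})-\sum_{n=0}^{N-1}f_{\boldsymbol{\alpha},n}(\boldsymbol{x})\boldsymbol{x}^{n\boldsymbol{\alpha}}\|\le CA^NN!^s|\boldsymbol{x}^{N\boldsymbol{\alpha}}|$ on $\Pi'$ for all $N\in\mathbb{N}$. $\hat f\in\hat{\mathcal{O}}'_d(E)$ is $\boldsymbol{x}^{\boldsymbol{\alpha}}$-$k$-summable in the direction $\theta\in\mathbb{R}$ if there is a holomorphic $f$ with $f\sim^{\boldsymbol{\alpha}}_{1/k}\hat f$ on some $S_{\boldsymbol{\alpha}}(\theta,b-a,r)$ with $b-a>\pi/k$. $E\{\boldsymbol{x}\}^{\boldsymbol{\alpha}}_{1/k}$ is the space of series that are $\boldsymbol{x}^{\boldsymbol{\alpha}}$-$k$-summable in all directions except possibly finitely many mod. $2\pi$ (the singular directions). *)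

theory Defs
  imports "HOL-Analysis.Analysis"
begin

class complex_banach = banach +
  fixes scaleC :: "complex \<Rightarrow> 'a \<Rightarrow> 'a"  (infixr \<open>*\<^sub>C\<close> 75)
  assumes scaleC_add_right: "c *\<^sub>C (x + y) = c *\<^sub>C x + c *\<^sub>C y"
    and scaleC_add_left: "(c + c') *\<^sub>C x = c *\<^sub>C x + c' *\<^sub>C x"
    and scaleC_scaleC: "c *\<^sub>C (c' *\<^sub>C x) = (c * c') *\<^sub>C x"
    and scaleC_one: "1 *\<^sub>C x = x"
    and scaleC_of_real: "complex_of_real u *\<^sub>C x = u *\<^sub>R x"
    and norm_scaleC: "norm (c *\<^sub>C x) = cmod c * norm x"

instantiation complex :: complex_banach
begin

definition scaleC_complex :: "complex \<Rightarrow> complex \<Rightarrow> complex"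
  where "scaleC_complex c x = c * x"

instance
  by standard
    (simp_all add: scaleC_complex_def algebra_simps norm_mult scaleR_conv_of_real)

end

text \<open>The finite type \<^typ>\<open>'d\<close> indexes the \<open>d\<close> variables, so \<open>d = CARD('d) \<ge> 1\<close>.\<close>

definition complex_differentiable_at ::
    "(complex^'d \<Rightarrow> 'e::complex_banach) \<Rightarrow> complex^'d \<Rightarrow> bool" where
  "complex_differentiable_at f x \<longleftrightarrow>
     (\<exists>L. (f has_derivative L) (at x) \<and> (\<forall>c v. L (c *s v) = c *\<^sub>C L v))"

definition bounded_holo :: "(complex^'d) set \<Rightarrow> (complex^'d \<Rightarrow> 'e::complex_banach) set" where
  "bounded_holo U = {f. (\<forall>x\<in>U. complex_differentiable_at f x) \<and> bounded (f ` U)}"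

definition polydisc :: "real \<Rightarrow> (complex^'d) set" where
  "polydisc r = {x. \<forall>j. cmod (x $ j) < r}"

text \<open>A series \<open>\<Sum>\<^sub>\<beta> a\<^sub>\<beta> x\<^sup>\<beta>\<close> is represented by its coefficient family \<open>a\<close>. The order on
  \<^typ>\<open>nat^'d\<close> is componentwise.\<close>

type_synonym ('d, 'e) mfps = "nat^'d \<Rightarrow> 'e"

definition mpow :: "complex^'d \<Rightarrow> nat^'d \<Rightarrow> complex" where
  "mpow x \<beta> = (\<Prod>j\<in>UNIV. (x $ j) ^ (\<beta> $ j))"

definition converges_on :: "('d::finite, 'e::complex_banach) mfps \<Rightarrow> (complex^'d) set \<Rightarrow> bool" where
  "converges_on a U \<longleftrightarrow> (\<forall>x\<in>U. (\<lambda>\<beta>. mpow x \<beta> *\<^sub>C a \<beta>) summable_on UNIV)"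

definition mfps_sum :: "('d::finite, 'e::complex_banach) mfps \<Rightarrow> complex^'d \<Rightarrow> 'e" where
  "mfps_sum a x = (\<Sum>\<^sub>\<infinity>\<beta>. mpow x \<beta> *\<^sub>C a \<beta>)"

definition convergent_series :: "('d::finite, 'e::complex_banach) mfps set" where
  "convergent_series = {a. \<exists>r>0. converges_on a (polydisc r)}"

text \<open>\<open>O\<^sub>b(U, E)\<close> as a subset of \<open>E[[x]]\<close>, for a Reinhardt domain \<open>U\<close> given by upper bounds on
  the \<open>|x\<^sub>j|\<close>: a bounded holomorphic map on \<open>U\<close> is identified with its Taylor series at \<open>0\<close>,
  which converges on all of \<open>U\<close>.\<close>

definition bounded_holo_series ::
    "(complex^'d) set \<Rightarrow> ('d::finite, 'e::complex_banach) mfps set" where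
  "bounded_holo_series U = {a. converges_on a U \<and> mfps_sum a \<in> bounded_holo U}"

text \<open>The coefficient of \<open>x\<^sub>j\<^sup>m\<close> when \<open>a\<close> is viewed as a formal power series in \<open>x\<^sub>j\<close>; it is a
  series in the remaining \<open>d - 1\<close> variables.\<close>

definition slice ::
    "'d \<Rightarrow> nat \<Rightarrow> ('d::finite, 'e::complex_banach) mfps \<Rightarrow> ('d, 'e) mfps" where
  "slice j m a = (\<lambda>\<beta>. if \<beta> $ j = 0 then a (\<beta> + axis j m) else 0)"

text \<open>The space \<open>\<Union>\<^sub>r \<Inter>\<^sub>j O\<^sub>b(D\<^sub>r\<^bsup>d-1\<^esup>, E)[[x\<^sub>j]]\<close>. Functions on \<open>D\<^sub>r\<^bsup>d-1\<^esup>\<close>, in the variables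
  other than \<open>x\<^sub>j\<close>, are identified with functions on \<open>{x. \<forall>i\<noteq>j. |x\<^sub>i| < r}\<close> that do not
  depend on \<open>x\<^sub>j\<close>; sums of slices never depend on \<open>x\<^sub>j\<close>.\<close>

definition Ohat' :: "('d::finite, 'e::complex_banach) mfps set" where
  "Ohat' = {a. \<exists>r>0. \<forall>j m.
     slice j m a \<in> bounded_holo_series {x. \<forall>i. i \<noteq> j \<longrightarrow> cmod (x $ i) < r}}"

text \<open>The component \<open>f\<^bsub>\<alpha>,n\<^esub>\<close> in the decomposition \<open>f = \<Sum>\<^sub>n f\<^bsub>\<alpha>,n\<^esub>(x) x\<^bsup>n\<alpha>\<^esup>\<close>.\<close>

definition mono_coeff ::
    "nat^'d \<Rightarrow> ('d::finite, 'e::complex_banach) mfps \<Rightarrow> nat \<Rightarrow> ('d, 'e) mfps" where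
  "mono_coeff \<alpha> a n = (\<lambda>\<beta>. if \<alpha> \<le> \<beta> then 0 else a (n *s \<alpha> + \<beta>))"

text \<open>A series \<open>\<Sum>\<^sub>n g\<^sub>n t\<^sup>n\<close> in one further variable \<open>t\<close> is given by the sequence \<open>g\<close>; thus
  \<^term>\<open>mono_coeff \<alpha> a\<close> stands for the series \<open>T\<^sub>\<alpha>(a)\<close>.\<close>

definition gevrey_series ::
    "real \<Rightarrow> (nat \<Rightarrow> ('d::finite, 'e::complex_banach) mfps) \<Rightarrow> bool" where
  "gevrey_series s g \<longleftrightarrow> (\<exists>r>0. \<exists>B>0. \<exists>D>0. \<forall>n.
     g n \<in> bounded_holo_series (polydisc r) \<and>
     (\<forall>x\<in>polydisc r. norm (mfps_sum (g n) x) \<le> D * B ^ n * fact n powr s))"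

definition gevrey_space :: "nat^'d \<Rightarrow> real \<Rightarrow> ('d::finite, 'e::complex_banach) mfps set" where
  "gevrey_space \<alpha> s = {a \<in> Ohat'. gevrey_series s (mono_coeff \<alpha> a)}"

text \<open>Points of \<open>\<Pi>\<^sub>\<alpha>(a, b, r)\<close> are always pairs \<open>(x, \<phi>)\<close> with \<open>\<phi> \<in> (a, b)\<close> an argument of
  \<open>x\<^sup>\<alpha>\<close>. If \<open>b - a \<le> 2\<pi>\<close>, then \<open>\<phi>\<close> is determined by \<open>x\<close>, and this is the usual sector
  in \<open>\<complex>\<^sup>d\<close>.\<close>

definition mono_sector ::
    "nat^'d \<Rightarrow> real \<Rightarrow> real \<Rightarrow> real \<Rightarrow> ((complex^'d) \<times> real) set" where
  "mono_sector \<alpha> a b r = {(x, \<phi>). a < \<phi> \<and> \<phi> < b \<and>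
     mpow x \<alpha> = of_real (cmod (mpow x \<alpha>)) * cis \<phi> \<and>
     (\<forall>j. 0 < cmod (x $ j) ^ (\<alpha> $ j) \<and> cmod (x $ j) ^ (\<alpha> $ j) < r)}"

text \<open>Holomorphy is tested in the local charts given by the first projection: near \<open>x\<^sub>0\<close> the
  continuous section of that projection through \<open>(x\<^sub>0, \<phi>\<^sub>0)\<close> is
  \<open>x \<mapsto> (x, \<phi>\<^sub>0 + Arg (x\<^sup>\<alpha> / x\<^sub>0\<^sup>\<alpha>))\<close>.\<close>

definition holo_on_sector ::
    "nat^'d \<Rightarrow> ((complex^'d) \<times> real \<Rightarrow> 'e::complex_banach) \<Rightarrow> ((complex^'d) \<times> real) set \<Rightarrow> bool"
  where
  "holo_on_sector \<alpha> f S \<longleftrightarrow> (\<forall>(x\<^sub>0, \<phi>\<^sub>0)\<in>S.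
     complex_differentiable_at (\<lambda>x. f (x, \<phi>\<^sub>0 + Arg (mpow x \<alpha> / mpow x\<^sub>0 \<alpha>))) x\<^sub>0)"

definition mono_asymp ::
    "nat^'d \<Rightarrow> real \<Rightarrow> real \<Rightarrow> real \<Rightarrow> real \<Rightarrow>
     ((complex^'d) \<times> real \<Rightarrow> 'e::complex_banach) \<Rightarrow> ('d, 'e) mfps \<Rightarrow> bool" where
  "mono_asymp \<alpha> s a b r f h \<longleftrightarrow>
     holo_on_sector \<alpha> f (mono_sector \<alpha> a b r) \<and> h \<in> Ohat' \<and>
     (\<exists>r'. 0 < r' \<and> r' \<le> r \<and>
        (\<forall>n. mono_coeff \<alpha> h n \<in> bounded_holo_series {x. \<forall>j. cmod (x $ j) ^ (\<alpha> $ j) < r'}) \<and>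
        (\<forall>a' b' \<rho>. a < a' \<and> a' < b' \<and> b' < b \<and> 0 < \<rho> \<and> \<rho> < r' \<longrightarrow>
           (\<exists>C>0. \<exists>A>0. \<forall>(x, \<phi>)\<in>mono_sector \<alpha> a' b' \<rho>. \<forall>N.
              norm (f (x, \<phi>) - (\<Sum>n<N. mpow x (n *s \<alpha>) *\<^sub>C mfps_sum (mono_coeff \<alpha> h n) x))
                \<le> C * A ^ N * fact N powr s * cmod (mpow x (N *s \<alpha>)))))"

text \<open>\<open>x\<^sup>\<alpha>\<close>-\<open>k\<close>-summability in direction \<open>\<theta>\<close>; the sector \<open>S\<^sub>\<alpha>(\<theta>, \<delta>, r)\<close> with bisecting
  direction \<open>\<theta>\<close> and opening \<open>\<delta>\<close> is \<open>\<Pi>\<^sub>\<alpha>(\<theta> - \<delta>/2, \<theta> + \<delta>/2, r)\<close>.\<close>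

definition mono_summable_dir ::
    "nat^'d \<Rightarrow> real \<Rightarrow> ('d::finite, 'e::complex_banach) mfps \<Rightarrow> real \<Rightarrow> bool" where
  "mono_summable_dir \<alpha> k h \<theta> \<longleftrightarrow> h \<in> Ohat' \<and>
     (\<exists>\<delta> r f. \<delta> > pi / k \<and> r > 0 \<and>
        mono_asymp \<alpha> (1 / k) (\<theta> - \<delta> / 2) (\<theta> + \<delta> / 2) r f h)"

text \<open>The space \<open>E{x}\<^sup>\<alpha>\<^bsub>1/k\<^esub>\<close>; the finite set \<open>\<Theta>\<close> represents the possible singular directions
  modulo \<open>2\<pi>\<close>.\<close>

definition mono_summable :: "nat^'d \<Rightarrow> real \<Rightarrow> ('d::finite, 'e::complex_banach) mfps set" where
  "mono_summable \<alpha> k = {h \<in> Ohat'. \<exists>\<Theta>. finite \<Theta> \<and>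
     (\<forall>\<theta>. (\<forall>\<tau>\<in>\<Theta>. \<forall>m::int. \<theta> \<noteq> \<tau> + 2 * pi * of_int m) \<longrightarrow> mono_summable_dir \<alpha> k h \<theta>)}"

end

theory Submission
  imports Defs "HOL-Complex_Analysis.Conformal_Mappings"
begin

text \<open>Write \<open>\<langle>w,\<beta>\<rangle> = \<Sum>\<^sub>j w\<^sub>j \<beta>\<^sub>j\<close>. On a curve \<open>x\<^sub>j = c\<^sub>j u\<^bsup>w\<^sub>j\<^esup>\<close> with positive integer weights \<open>w\<close>
  and \<open>|c\<^sub>j| = 1\<close>, composed with a norming functional, an \<open>x\<^sup>\<alpha>\<close>-\<open>k\<close>-summable series becomes a
  series in \<open>u\<close> that is \<open>K\<close>-summable for \<open>K = k \<langle>w,\<alpha>\<rangle>\<close>, and a Gevrey condition of order \<open>s\<close> with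
  respect to \<open>\<alpha>'\<close> makes its coefficients Gevrey of order \<open>1/\<kappa>\<close> for \<open>\<kappa> = \<langle>w,\<alpha>'\<rangle>/s\<close>. Suppose
  \<open>K < \<kappa>\<close>.

  Put \<open>u = e\<^bsup>-z\<^esup>\<close> and compare a sum \<open>h\<close> on a half strip of half-width larger than \<open>\<pi>/(2K)\<close>
  with the partial sum truncated at index \<open>\<nu> e\<^bsup>\<kappa> Re z\<^esup>\<close>. The error is at first
  \<open>O(exp (- c e\<^bsup>K Re z\<^esup>))\<close>, and the maximum principle on rectangles improves \<open>K\<close> to every
  \<open>p < \<kappa>\<close> while the half-width stays larger than \<open>\<pi>/(2K)\<close>. By Watson's lemma with exponent \<open>p\<close>
  the sums on neighbouring strips agree even on overlaps of half-width only \<open>\<pi>/(2p)\<close>, so the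
  finitely many singular directions are bridged, the sums glue to a bounded holomorphic function
  of \<open>u\<close>, and Cauchy's inequality bounds the coefficients geometrically. The bounds are uniform in
  \<open>c\<close> and in the functional, so averaging over \<open>c\<close> yields the convergence of the series in
  several variables.

  Summability in almost all directions implies a Gevrey condition, because finitely many sectors
  cover all arguments of the monomial. If \<open>k \<alpha> \<noteq> k' \<alpha>'\<close>, some \<open>w\<close> separates \<open>k \<langle>w,\<alpha>\<rangle>\<close> from
  \<open>k' \<langle>w,\<alpha>'\<rangle>\<close>. If \<open>k \<alpha> = k' \<alpha>'\<close>, then \<open>\<alpha> = p \<gamma>\<close> and \<open>\<alpha>' = q \<gamma>\<close>, and an \<open>x\<^bsup>p\<gamma>\<^esup>\<close>-sector is
  the disjoint union of \<open>p\<close> sectors for \<open>x\<^sup>\<gamma>\<close>.\<close>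

section \<open>Norming functionals\<close>

text \<open>The obstacle is the Stokes phenomenon. Across a singular direction two neighbouring sums
  share only a strip of half-width below \<pi>/(2K), where functions of size exp (- c |u|^-K) need
  not vanish, so Watson's lemma with exponent K cannot identify them. The stronger Gevrey condition
  acts through partial sums of a fixed index: their truncation error is far smaller than the known
  error of the sum, and comparing at a large abscissa lets the maximum principle carry part of this
  smallness back. Each round multiplies the gap \<kappa> - p by a factor below 1 and costs an
  arbitrarily small amount of width. Two growth conditions interact: order 1/k, a consequence of
  summability, makes the restriction to curves legitimate and gives the asymptotics there, while
  order s feeds the improvement. A single weight w suffices, because averaging over the torus
  isolates each coefficient inside its part of weighted degree m. Uniformity in c and in the
  functional comes from a finite net of directions, whose radius and constants are fixed before
  either is chosen.\<close>

definition sublinear :: "('a::real_vector \<Rightarrow> real) \<Rightarrow> bool" where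
  "sublinear q \<longleftrightarrow> (\<forall>x y. q (x + y) \<le> q x + q y) \<and> (\<forall>t>0. \<forall>x. q (t *\<^sub>R x) = t * q x)"

lemma sublinear_zero: assumes "sublinear q" shows "q 0 = 0"
proof -
  have "q ((2::real) *\<^sub>R 0) = 2 * q 0" using assms unfolding sublinear_def by (metis zero_less_numeral)
  then show ?thesis by simp
qed

lemma sublinear_neg: assumes "sublinear q" shows "- q (- x) \<le> q x"
proof -
  have "q (x + - x) \<le> q x + q (- x)" using assms unfolding sublinear_def by blast
  then show ?thesis using sublinear_zero[OF assms] by simp
qed

text \<open>A minimal sublinear functional \<open>q\<close> is fixed by lowering it along \<open>y\<close>, which forces
  \<open>q (- y) = - q y\<close>; so minimal sublinear functionals are linear.\<close>

definition lower_along :: "('a::real_vector \<Rightarrow> real) \<Rightarrow> 'a \<Rightarrow> 'a \<Rightarrow> real" where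
  "lower_along q y x = Inf ((\<lambda>t. q (x + t *\<^sub>R y) - t * q y) ` {0..})"

text \<open>The infimum is finite because q (t y) <= q (x + t y) + q (- x), which bounds every
  competitor below by - q (- x).\<close>

lemma lower_along_bounds:
  assumes "sublinear q"
  shows "bdd_below ((\<lambda>t. q (x + t *\<^sub>R y) - t * q y) ` {0..})"
    and "t \<ge> 0 \<Longrightarrow> lower_along q y x \<le> q (x + t *\<^sub>R y) - t * q y"
proof -
  have scale: "q (t *\<^sub>R y) = t * q y" if "t \<ge> 0" for t
    using assms that sublinear_zero[OF assms] unfolding sublinear_def
    by (cases "t = 0") auto
  have "- q (- x) \<le> q (x + t *\<^sub>R y) - t * q y" if "t \<ge> 0" for t
  proof -
    have "q (t *\<^sub>R y) \<le> q (x + t *\<^sub>R y) + q (- x)"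
      using assms unfolding sublinear_def
      by (metis add.commute add_minus_cancel minus_minus)
    then show ?thesis using scale[OF that] by simp
  qed
  then show *: "bdd_below ((\<lambda>t. q (x + t *\<^sub>R y) - t * q y) ` {0..})"
    by (intro bdd_belowI[of _ "- q (- x)"]) auto
  show "lower_along q y x \<le> q (x + t *\<^sub>R y) - t * q y" if "t \<ge> 0"
    unfolding lower_along_def by (intro cInf_lower[OF _ *]) (use that in auto)
qed

text \<open>Subadditivity: parameters t and t' for the two summands combine to t + t' for the sum.
  Homogeneity: rescaling the parameter gives one inequality for every positive factor, and applying
  it to the inverse factor gives the other.\<close>

lemma sublinear_lower_along:
  assumes "sublinear q"
  shows "sublinear (lower_along q y)"
  unfolding sublinear_def
proof (intro conjI allI impI)
  have ge: "c \<le> lower_along q y x" if "\<And>t. t \<ge> 0 \<Longrightarrow> c \<le> q (x + t *\<^sub>R y) - t * q y" for c x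
    unfolding lower_along_def using that by (intro cInf_greatest) auto
  note le = lower_along_bounds(2)[OF assms]
  have add: "q (x + y) \<le> q x + q y" for x y using assms unfolding sublinear_def by blast
  have scale: "q (t *\<^sub>R x) = t * q x" if "t > 0" for t x
    using assms that unfolding sublinear_def by blast
  show "lower_along q y (x + x') \<le> lower_along q y x + lower_along q y x'" for x x'
  proof -
    have "lower_along q y (x + x') - (q (x' + t' *\<^sub>R y) - t' * q y) \<le> lower_along q y x" if "t' \<ge> 0" for t'
    proof (rule ge)
      fix t :: real assume "t \<ge> 0"
      have "lower_along q y (x + x') \<le> q ((x + x') + (t + t') *\<^sub>R y) - (t + t') * q y"
        using that \<open>t \<ge> 0\<close> by (intro le) auto
      also have "(x + x') + (t + t') *\<^sub>R y = (x + t *\<^sub>R y) + (x' + t' *\<^sub>R y)"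
        by (simp add: algebra_simps)
      also have "q \<dots> \<le> q (x + t *\<^sub>R y) + q (x' + t' *\<^sub>R y)" by (rule add)
      finally show "lower_along q y (x + x') - (q (x' + t' *\<^sub>R y) - t' * q y) \<le> q (x + t *\<^sub>R y) - t * q y"
        by (simp add: algebra_simps)
    qed
    then have "lower_along q y (x + x') - lower_along q y x \<le> lower_along q y x'"
      by (intro ge) (smt (verit))
    then show ?thesis by simp
  qed
  fix t :: real and x assume t: "t > 0"
  have half: "t * lower_along q y x \<le> lower_along q y (t *\<^sub>R x)" if t: "t > 0" for t x
  proof (rule ge)
    fix u :: real assume u: "u \<ge> 0"
    have "lower_along q y x \<le> q (x + (u / t) *\<^sub>R y) - (u / t) * q y"
      using u t by (intro le) auto
    then have "t * lower_along q y x \<le> t * q (x + (u / t) *\<^sub>R y) - u * q y"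
      using t by (simp add: field_simps)
    also have "t * q (x + (u / t) *\<^sub>R y) = q (t *\<^sub>R (x + (u / t) *\<^sub>R y))" using scale t by simp
    also have "t *\<^sub>R (x + (u / t) *\<^sub>R y) = t *\<^sub>R x + u *\<^sub>R y" using t by (simp add: algebra_simps)
    finally show "t * lower_along q y x \<le> q (t *\<^sub>R x + u *\<^sub>R y) - u * q y" .
  qed
  have "(1 / t) * lower_along q y (t *\<^sub>R x) \<le> lower_along q y ((1 / t) *\<^sub>R (t *\<^sub>R x))"
    by (rule half) (use t in auto)
  then have "lower_along q y (t *\<^sub>R x) \<le> t * lower_along q y x" using t by (simp add: field_simps)
  then show "lower_along q y (t *\<^sub>R x) = t * lower_along q y x" using half[OF t] by (meson antisym)
qed

text \<open>Zorn's lemma with pointwise infima as bounds of chains; these are finite since every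
  member below p is at least - p (- x) at x.\<close>

lemma minimal_sublinear:
  assumes "sublinear p"
  obtains q where "sublinear q" "\<And>x. q x \<le> p x" "\<And>q'. sublinear q' \<Longrightarrow> (\<And>x. q' x \<le> q x) \<Longrightarrow> q' = q"
proof -
  define A where "A = {q. sublinear q \<and> (\<forall>x. q x \<le> p x)}"
  \<comment> \<open>The order is reversed, so that a maximal element for Zorn's lemma is a pointwise
    minimal functional.\<close>
  define r where "r = {(q, q'). q \<in> A \<and> q' \<in> A \<and> (\<forall>x. q' x \<le> q x)}"
  have "Field r = A" by (auto simp: r_def Field_def)
  have "\<exists>m\<in>Field r. \<forall>a\<in>Field r. (m, a) \<in> r \<longrightarrow> a = m"
  proof (rule Zorns_po_lemma)
    show "Partial_order r"
      unfolding partial_order_on_def preorder_on_def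
      by (auto simp: r_def Field_def refl_on_def trans_def antisym_def intro!: ext intro: antisym order_trans)
    fix C assume C: "C \<in> Chains r"
    then have CA: "C \<subseteq> A" by (auto simp: Chains_def r_def)
    show "\<exists>u\<in>Field r. \<forall>a\<in>C. (a, u) \<in> r"
    proof (cases "C = {}")
      case True
      then show ?thesis using assms by (auto simp: \<open>Field r = A\<close> A_def)
    next
      case False
      define u where "u x = Inf ((\<lambda>q. q x) ` C)" for x
      have bdd: "bdd_below ((\<lambda>q. q x) ` C)" for x
      proof (rule bdd_belowI)
        fix v assume "v \<in> (\<lambda>q. q x) ` C"
        then obtain q where q: "q \<in> C" "v = q x" by auto
        then have "- q (- x) \<le> q x" "q (- x) \<le> p (- x)" using CA sublinear_neg by (auto simp: A_def)
        then show "- p (- x) \<le> v" using q by simp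
      qed
      have le: "u x \<le> q x" if "q \<in> C" for q x unfolding u_def using that bdd by (intro cInf_lower) auto
      have ge: "c \<le> u x" if "\<And>q. q \<in> C \<Longrightarrow> c \<le> q x" for c x
        unfolding u_def using that False by (intro cInf_greatest) auto
      have sub: "sublinear q" if "q \<in> C" for q using CA that by (auto simp: A_def)
      have add: "u (x + y) \<le> u x + u y" for x y
      proof -
        have "u (x + y) - q' y \<le> u x" if q': "q' \<in> C" for q'
        proof (rule ge)
          fix q assume q: "q \<in> C"
          \<comment> \<open>Subadditivity survives the infimum because of two members of a chain the
            smaller one serves at both points x and y.\<close>
          have "(\<forall>x. q x \<le> q' x) \<or> (\<forall>x. q' x \<le> q x)" using C q q' by (auto simp: Chains_def r_def)
          then obtain s where s: "s \<in> C" "s x \<le> q x" "s y \<le> q' y" using q q' by blast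
          have "u (x + y) \<le> s (x + y)" by (rule le[OF s(1)])
          also have "\<dots> \<le> s x + s y" using sub[OF s(1)] unfolding sublinear_def by blast
          finally show "u (x + y) - q' y \<le> q x" using s by simp
        qed
        then have "u (x + y) - u x \<le> u y" by (intro ge) (smt (verit))
        then show ?thesis by simp
      qed
      have half: "t * u x \<le> u (t *\<^sub>R x)" if "t > 0" for t x
      proof (rule ge)
        fix q assume q: "q \<in> C"
        have "q (t *\<^sub>R x) = t * q x" using sub[OF q] that unfolding sublinear_def by blast
        then show "t * u x \<le> q (t *\<^sub>R x)" using le[OF q, of x] that by simp
      qed
      have scale: "u (t *\<^sub>R x) = t * u x" if t: "t > 0" for t x
      proof -
        have "(1 / t) * u (t *\<^sub>R x) \<le> u ((1 / t) *\<^sub>R (t *\<^sub>R x))" by (rule half) (use t in auto)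
        then have "u (t *\<^sub>R x) \<le> t * u x" using t by (simp add: field_simps)
        then show ?thesis using half[OF t, of x] by simp
      qed
      have "u x \<le> p x" for x
        using False le CA unfolding A_def by (metis (mono_tags, lifting) equals0I in_mono mem_Collect_eq order_trans)
      then have "u \<in> A" using add scale by (auto simp: A_def sublinear_def)
      then show ?thesis using le CA by (intro bexI[of _ u]) (auto simp: r_def \<open>Field r = A\<close>[unfolded r_def])
    qed
  qed
  then obtain m where m: "m \<in> A" "\<And>a. (m, a) \<in> r \<Longrightarrow> a = m"
    using \<open>Field r = A\<close> by (auto simp: Field_def)
  show thesis
  proof (rule that[of m])
    show "sublinear m" "m x \<le> p x" for x using m(1) by (auto simp: A_def)
    fix q' assume "sublinear q'" "\<And>x. q' x \<le> m x"
    then have "(m, q') \<in> r" using m(1) unfolding r_def A_def by (auto intro: order_trans)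
    then show "q' = m" by (rule m(2))
  qed
qed

text \<open>Minimality is sought below \<open>lower_along p v\<close> instead of p: its value at - v
  is at most - p v, and this is what forces q to attain p at v.\<close>

lemma Hahn_Banach_sublinear:
  fixes p :: "'a::real_vector \<Rightarrow> real"
  assumes p: "sublinear p"
  obtains q where "linear q" "\<And>x. q x \<le> p x" "q v = p v"
proof -
  obtain q where q: "sublinear q" "\<And>x. q x \<le> lower_along p v x"
    and min: "\<And>q'. sublinear q' \<Longrightarrow> (\<And>x. q' x \<le> q x) \<Longrightarrow> q' = q"
    using minimal_sublinear[OF sublinear_lower_along[OF p]] by metis
  have neg: "q (- y) = - q y" for y
  proof -
    have "lower_along q y x \<le> q x" for x using lower_along_bounds(2)[OF q(1), of 0 y x] by simp
    \<comment> \<open>Minimality makes q a fixed point of lowering; the parameter 1 at the point - y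
      then gives q (- y) <= q 0 - q y.\<close>
    then have "lower_along q y = q" by (intro min sublinear_lower_along q)
    moreover have "lower_along q y (- y) \<le> q (- y + 1 *\<^sub>R y) - 1 * q y"
      by (intro lower_along_bounds q) auto
    ultimately have "q (- y) \<le> - q y" using sublinear_zero[OF q(1)] by simp
    then show ?thesis using sublinear_neg[OF q(1), of y] by simp
  qed
  have add_le: "q (x + y) \<le> q x + q y" for x y using q(1) unfolding sublinear_def by blast
  have add: "q (x + y) = q x + q y" for x y
    using add_le[of x y] add_le[of "x + y" "- y"] neg[of y] by simp
  have scale: "q (t *\<^sub>R x) = t * q x" for t x
  proof (cases t "0 :: real" rule: linorder_cases)
    case less
    have "q ((- t) *\<^sub>R x) = - t * q x" using q(1) less unfolding sublinear_def by (metis neg_0_less_iff_less)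
    then show ?thesis using neg[of "t *\<^sub>R x"] by simp
  next
    case equal
    then show ?thesis using sublinear_zero[OF q(1)] by simp
  next
    case greater
    then show ?thesis using q(1) unfolding sublinear_def by blast
  qed
  have qp: "q x \<le> p x" for x
    using q(2)[of x] lower_along_bounds(2)[OF p, of 0 v x] by simp
  have "q (- v) \<le> p (- v + 1 *\<^sub>R v) - 1 * p v"
    using q(2)[of "- v"] lower_along_bounds(2)[OF p, of 1 "v" "- v"] by simp
  then have "p v \<le> q v" using neg[of v] sublinear_zero[OF p] by simp
  then show thesis
    using that[of q] add scale qp by (simp add: linear_iff antisym)
qed

lemma scaleC_i_i: "\<i> *\<^sub>C (\<i> *\<^sub>C x) = - (x :: 'e::complex_banach)"
proof -
  have "\<i> *\<^sub>C (\<i> *\<^sub>C x) = complex_of_real (- 1) *\<^sub>C x" by (simp add: scaleC_scaleC)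
  also have "\<dots> = - x" by (simp only: scaleC_of_real) simp
  finally show ?thesis .
qed

lemma scaleC_scaleR: "c *\<^sub>C (t *\<^sub>R x) = t *\<^sub>R (c *\<^sub>C (x :: 'e::complex_banach))"
  by (metis scaleC_of_real scaleC_scaleC mult.commute)

definition clinear_contraction :: "('e::complex_banach \<Rightarrow> complex) \<Rightarrow> bool" where
  "clinear_contraction L \<longleftrightarrow> (\<forall>x y. L (x + y) = L x + L y) \<and> (\<forall>c x. L (c *\<^sub>C x) = c * L x) \<and>
     (\<forall>x. cmod (L x) \<le> norm x)"

text \<open>A real norming functional q is complexified by L x = q x - i q (i x). This reduces
  Banach-valued statements to scalar ones without loss in the norm.\<close>

lemma norming_functional:
  fixes v :: "'e::complex_banach"
  obtains L where "clinear_contraction L" "L v = of_real (norm v)"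
proof -
  have "sublinear (norm :: 'e \<Rightarrow> real)" by (auto simp: sublinear_def norm_triangle_ineq)
  then obtain q :: "'e \<Rightarrow> real" where q: "linear q" "\<And>x. q x \<le> norm x" "q v = norm v"
    by (rule Hahn_Banach_sublinear[of norm v]) blast
  define L where "L x = Complex (q x) (- q (\<i> *\<^sub>C x))" for x
  have add: "L (x + y) = L x + L y" for x y
    by (simp add: L_def linear_add[OF q(1)] scaleC_add_right complex_eq_iff)
  have real: "L (t *\<^sub>R x) = of_real t * L x" for t x
    by (simp add: L_def linear_scale[OF q(1)] scaleC_scaleR complex_eq_iff)
  have imag: "L (\<i> *\<^sub>C x) = \<i> * L x" for x
    by (simp add: L_def scaleC_i_i linear_neg[OF q(1)] complex_eq_iff)
  have scale: "L (c *\<^sub>C x) = c * L x" for c x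
  proof -
    have "c *\<^sub>C x = Re c *\<^sub>R x + Im c *\<^sub>R (\<i> *\<^sub>C x)"
    proof -
      have "c *\<^sub>C x = (complex_of_real (Re c) + complex_of_real (Im c) * \<i>) *\<^sub>C x"
        by (metis complex_eq mult.commute)
      then show ?thesis by (metis scaleC_add_left scaleC_of_real scaleC_scaleC)
    qed
    then have "L (c *\<^sub>C x) = (of_real (Re c) + \<i> * of_real (Im c)) * L x"
      by (simp only: add real imag) (simp add: algebra_simps)
    then show ?thesis using complex_eq[of c] by simp
  qed
  have bound: "cmod (L x) \<le> norm x" for x
  proof (cases "L x = 0")
    case False
    \<comment> \<open>This unimodular factor rotates \<open>L x\<close> onto its modulus, so that
      the bound for the real part q applies to c x.\<close>
    define c where "c = cnj (sgn (L x))"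
    have c: "cmod c = 1" using False by (simp add: c_def norm_sgn)
    have "c * L x = (cnj (L x) * L x) / of_real (cmod (L x))"
      by (simp add: c_def sgn_eq)
    also have "\<dots> = of_real (cmod (L x))"
      using False by (simp add: complex_norm_square[symmetric] power2_eq_square mult.commute)
    finally have c2: "c * L x = of_real (cmod (L x))" .
    then have "cmod (L x) = Re (L (c *\<^sub>C x))" by (simp add: scale c2)
    also have "\<dots> = q (c *\<^sub>C x)" by (simp add: L_def)
    also have "\<dots> \<le> norm (c *\<^sub>C x)" by (rule q)
    finally show ?thesis using c by (simp add: norm_scaleC)
  qed auto
  \<comment> \<open>A number of modulus at most norm v whose real part equals norm v has no
    imaginary part.\<close>
  have "Re (L v) = norm v" by (simp add: L_def q)
  moreover have "cmod (L v) \<le> norm v" by (rule bound)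
  ultimately have "L v = of_real (norm v)"
    by (smt (verit) Im_complex_of_real Re_complex_of_real abs_Re_le_cmod cmod_eq_Re complex_eq_iff complex_Re_le_cmod cmod_power2 power2_less_eq_zero_iff power_mono norm_ge_zero zero_eq_power2)
  then show thesis using that[of L] add scale bound by (auto simp: clinear_contraction_def)
qed

section \<open>Comparison estimates in half strips\<close>

text \<open>This is the comparison function of the maximum principle arguments: large near the
  centre line, and of modulus at most 1 (for l >= 0) where the cosine is not positive.\<close>

lemma Re_exp_real_mult:
  "cmod (exp (of_real l * exp (of_real q * (z - \<i> * of_real \<theta>)))) = exp (l * (exp (q * Re z) * cos (q * (Im z - \<theta>))))"
  by (simp add: exp_eq_polar Re_exp norm_mult)

text \<open>The maximum principle for F times the comparison function. On the horizontal edges the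
  cosine is at most 0, because q b lies between \<pi>/2 and \<pi>; on the right edge the assumed
  decay cancels the growth; the left edge costs the factor exp (l e^(q xl)).\<close>

lemma rectangle_decay:
  fixes F :: "complex \<Rightarrow> complex"
  assumes holo: "F holomorphic_on cbox (Complex xl (\<theta> - b)) (Complex X (\<theta> + b))"
    and bound: "\<And>z. z \<in> cbox (Complex xl (\<theta> - b)) (Complex X (\<theta> + b)) \<Longrightarrow> cmod (F z) \<le> D"
    and right: "\<And>z. z \<in> cbox (Complex xl (\<theta> - b)) (Complex X (\<theta> + b)) \<Longrightarrow> Re z = X \<Longrightarrow>
        cmod (F z) \<le> D * exp (- l * exp (q * X))"
    and "0 < q" "pi / 2 \<le> q * b" "q * b \<le> pi" "0 \<le> l" "0 \<le> D"
    and z: "z \<in> cbox (Complex xl (\<theta> - b)) (Complex X (\<theta> + b))"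
  shows "cmod (F z) \<le> D * exp (l * (exp (q * xl) - exp (q * Re z) * cos (q * (Im z - \<theta>))))"
proof -
  define S where "S = cbox (Complex xl (\<theta> - b)) (Complex X (\<theta> + b))"
  define E where "E z = exp (of_real l * exp (of_real q * (z - \<i> * of_real \<theta>)))" for z
  define M where "M = D * exp (l * exp (q * xl))"
  have E: "cmod (E z) = exp (l * (exp (q * Re z) * cos (q * (Im z - \<theta>))))" for z
    unfolding E_def by (rule Re_exp_real_mult)
  have inS: "z \<in> S \<longleftrightarrow> xl \<le> Re z \<and> Re z \<le> X \<and> \<theta> - b \<le> Im z \<and> Im z \<le> \<theta> + b" for z
    unfolding S_def by (auto simp: in_cbox_complex_iff)
  have intS: "z \<in> interior S \<longleftrightarrow> xl < Re z \<and> Re z < X \<and> \<theta> - b < Im z \<and> Im z < \<theta> + b" for z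
    unfolding S_def by (auto simp: interior_cbox in_box_complex_iff)
  have hol: "(\<lambda>z. F z * E z) holomorphic_on S"
    unfolding E_def S_def by (intro holomorphic_intros holo)
  have "cmod (F z * E z) \<le> M"
  proof (rule maximum_modulus_frontier[where f = "\<lambda>z. F z * E z" and S = S])
    show "(\<lambda>z. F z * E z) holomorphic_on interior S"
      using hol interior_subset by (rule holomorphic_on_subset)
    have "closed S" "bounded S" unfolding S_def by (rule closed_cbox, rule bounded_cbox)
    show "continuous_on (closure S) (\<lambda>z. F z * E z)"
      using hol \<open>closed S\<close> by (simp add: holomorphic_on_imp_continuous_on)
    show "bounded S" by fact
    show "z \<in> S" using z by (simp add: S_def)
    fix w assume "w \<in> frontier S"
    then have w: "w \<in> S" "w \<notin> interior S" using \<open>closed S\<close> by (auto simp: frontier_def)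
    have FD: "cmod (F w) \<le> D" using bound w by (simp add: S_def)
    consider "Re w = xl" | "Re w = X" | "\<bar>Im w - \<theta>\<bar> = b"
      using w unfolding inS intS by fastforce
    then show "cmod (F w * E w) \<le> M"
    proof cases
      case 1
      have "cmod (E w) \<le> exp (l * exp (q * xl))"
        unfolding E 1 using \<open>0 \<le> l\<close> by (auto intro!: mult_left_mono mult_left_le)
      then show ?thesis using FD \<open>0 \<le> D\<close> by (simp add: norm_mult M_def mult_mono)
    next
      case 2
      have "cmod (E w) \<le> exp (l * exp (q * X))"
        unfolding E 2 using \<open>0 \<le> l\<close> by (auto intro!: mult_left_mono mult_left_le)
      moreover have "cmod (F w) \<le> D * exp (- l * exp (q * X))"
        using right w 2 by (simp add: S_def)
      ultimately have "cmod (F w * E w) \<le> (D * exp (- l * exp (q * X))) * exp (l * exp (q * X))"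
        unfolding norm_mult using \<open>0 \<le> D\<close> by (intro mult_mono) auto
      also have "\<dots> = D" by (simp add: exp_minus)
      also have "\<dots> \<le> M" using \<open>0 \<le> D\<close> \<open>0 \<le> l\<close> by (simp add: M_def mult_le_cancel_left1)
      finally show ?thesis .
    next
      case 3
      have "cos (q * (Im w - \<theta>)) = cos (q * b)"
        using 3 \<open>0 < q\<close> by (metis abs_of_pos abs_mult cos_abs_real)
      also have "\<dots> \<le> cos (pi / 2)"
        using assms by (intro cos_monotone_0_pi_le) auto
      finally have "cos (q * (Im w - \<theta>)) \<le> 0" by simp
      then have "cmod (E w) \<le> 1"
        unfolding E using \<open>0 \<le> l\<close> by (simp add: mult_nonneg_nonpos)
      then have "cmod (F w * E w) \<le> D * 1"
        unfolding norm_mult using FD \<open>0 \<le> D\<close> by (intro mult_mono) auto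
      also have "\<dots> \<le> M" using \<open>0 \<le> D\<close> \<open>0 \<le> l\<close> by (simp add: M_def mult_le_cancel_left1)
      finally show ?thesis .
    qed
  qed
  then have "cmod (F z) * exp (l * (exp (q * Re z) * cos (q * (Im z - \<theta>)))) \<le> D * exp (l * exp (q * xl))"
    by (simp add: norm_mult E M_def)
  then show ?thesis by (simp add: exp_diff right_diff_distrib field_simps)
qed

definition half_strip :: "real \<Rightarrow> real \<Rightarrow> real \<Rightarrow> complex set" where
  "half_strip R \<theta> b = {z. R < Re z \<and> \<bar>Im z - \<theta>\<bar> < b}"

lemma open_half_strip: "open (half_strip R \<theta> b)"
  unfolding half_strip_def by (intro open_Collect_conj open_Collect_less continuous_intros)

lemma convex_half_strip: "convex (half_strip R \<theta> b)"
proof -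
  have "half_strip R \<theta> b = {z. R < Re z} \<inter> {z. Im z < \<theta> + b} \<inter> {z. Im z > \<theta> - b}"
    by (auto simp: half_strip_def)
  then show ?thesis
    by (simp add: convex_Int convex_halfspace_Re_gt convex_halfspace_Im_lt convex_halfspace_Im_gt)
qed

text \<open>Comparison with \<open>exp (l e\<^bsup>qz\<^esup>)\<close>, whose modulus is at most \<open>1\<close> on the horizontal edges,
  and letting \<open>l\<close> tend to infinity.\<close>

lemma watson:
  fixes F :: "complex \<Rightarrow> complex"
  assumes holo: "F holomorphic_on half_strip R \<theta> b"
    and bound: "\<And>z. z \<in> half_strip R \<theta> b \<Longrightarrow> R' < Re z \<Longrightarrow> cmod (F z) \<le> D * exp (- c * exp (p * Re z))"
    and "0 < p" "pi / (2 * p) < b" "0 < c"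
    and z: "z \<in> half_strip R \<theta> b"
  shows "F z = 0"
proof -
  \<comment> \<open>A slightly smaller exponent q than p: the decay of order p eventually beats
    every l e^(q X), while \<pi>/(2q) still fits into the half-width b.\<close>
  obtain q where q: "pi / (2 * b) < q" "q < p"
  proof -
    have "0 < b" using assms by (smt (verit) divide_pos_pos pi_gt_zero)
    then have "pi / (2 * b) < p" using assms by (simp add: field_simps)
    then show thesis using dense that by blast
  qed
  have "0 < b" using assms by (smt (verit) divide_pos_pos pi_gt_zero)
  then have "0 < q" using q(1) by (smt (verit) divide_pos_pos pi_gt_zero)
  \<comment> \<open>A half-width between \<pi>/(2q) and b, capped at \<pi>/q so that the cosine is
    not positive on the horizontal edges.\<close>
  define b1 where "b1 = min ((pi / (2 * q) + b) / 2) (pi / q)"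
  have "pi / (2 * q) < b" using q(1) \<open>0 < b\<close> \<open>0 < q\<close> by (simp add: field_simps)
  then have b1: "b1 < b" "pi / 2 \<le> q * b1" "q * b1 \<le> pi" "0 < b1"
    using \<open>0 < q\<close> \<open>0 < b\<close> by (auto simp: b1_def min_def field_simps)
  have line: "F (Complex x \<theta>) = 0" if x: "max R R' + 1 < x" for x
  proof (rule ccontr)
    assume nz: "F (Complex x \<theta>) \<noteq> 0"
    define xl where "xl = max R R' + 1"
    define \<Delta> where "\<Delta> = exp (q * x) - exp (q * xl)"
    have "0 < \<Delta>" using x \<open>0 < q\<close> by (simp add: \<Delta>_def xl_def)
    have "0 < D"
    proof -
      have "cmod (F (Complex x \<theta>)) \<le> D * exp (- c * exp (p * x))"
        using bound[of "Complex x \<theta>"] x \<open>0 < b\<close> by (auto simp: half_strip_def)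
      then have "0 < D * exp (- c * exp (p * x))" using nz by (smt (verit) zero_less_norm_iff)
      then show ?thesis by (simp add: zero_less_mult_iff)
    qed
    have main: "cmod (F (Complex x \<theta>)) \<le> D * exp (- l * \<Delta>)" if l: "0 \<le> l" for l
    proof -
      \<comment> \<open>For given l the right edge is moved so far out that the decay there is at
        least exp (- l e^(q X)); the resulting bound no longer contains X.\<close>
      have "filterlim (\<lambda>X. exp ((p - q) * X)) at_top at_top"
        using q(2) by (intro filterlim_compose[OF exp_at_top] filterlim_tendsto_pos_mult_at_top[OF tendsto_const]) (auto simp: filterlim_ident)
      then have "eventually (\<lambda>X. l / c \<le> exp ((p - q) * X)) at_top" by (simp add: filterlim_at_top)
      then obtain X where X: "X \<ge> x" "l / c \<le> exp ((p - q) * X)"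
        by (metis (no_types, lifting) eventually_at_top_linorder linorder_le_cases order_refl)
      have "l \<le> c * exp ((p - q) * X)" using X(2) \<open>0 < c\<close> by (simp add: field_simps)
      then have "l * exp (q * X) \<le> c * exp ((p - q) * X) * exp (q * X)" by simp
      also have "\<dots> = c * exp (p * X)" by (simp add: exp_add[symmetric] algebra_simps)
      finally have lX: "l * exp (q * X) \<le> c * exp (p * X)" .
      have sub: "cbox (Complex xl (\<theta> - b1)) (Complex X (\<theta> + b1)) \<subseteq> half_strip R \<theta> b"
        using b1 by (auto simp: half_strip_def in_cbox_complex_iff xl_def)
      have Fb: "cmod (F z) \<le> D * exp (- c * exp (p * Re z))"
        if "z \<in> cbox (Complex xl (\<theta> - b1)) (Complex X (\<theta> + b1))" for z
        using bound[of z] that sub by (auto simp: in_cbox_complex_iff xl_def)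
      have "cmod (F (Complex x \<theta>)) \<le> D * exp (l * (exp (q * xl) - exp (q * Re (Complex x \<theta>)) * cos (q * (Im (Complex x \<theta>) - \<theta>))))"
      proof (rule rectangle_decay)
        show "F holomorphic_on cbox (Complex xl (\<theta> - b1)) (Complex X (\<theta> + b1))"
          using holo sub by (rule holomorphic_on_subset)
        show "Complex x \<theta> \<in> cbox (Complex xl (\<theta> - b1)) (Complex X (\<theta> + b1))"
          using x X b1 by (auto simp: in_cbox_complex_iff xl_def)
        show "cmod (F z) \<le> D" if "z \<in> cbox (Complex xl (\<theta> - b1)) (Complex X (\<theta> + b1))" for z
        proof -
          have "D * exp (- c * exp (p * Re z)) \<le> D * 1" using \<open>0 < D\<close> \<open>0 < c\<close> by (intro mult_left_mono) auto
          then show ?thesis using Fb[OF that] by simp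
        qed
        show "cmod (F z) \<le> D * exp (- l * exp (q * X))"
          if "z \<in> cbox (Complex xl (\<theta> - b1)) (Complex X (\<theta> + b1))" "Re z = X" for z
        proof -
          have "D * exp (- c * exp (p * Re z)) \<le> D * exp (- l * exp (q * X))"
            using \<open>0 < D\<close> lX that(2) by (intro mult_left_mono) auto
          then show ?thesis using Fb[OF that(1)] by linarith
        qed
      qed (use b1 \<open>0 < q\<close> l \<open>0 < D\<close> in auto)
      then show ?thesis by (simp add: \<Delta>_def algebra_simps)
    qed
    have "((\<lambda>l. D * exp (- l * \<Delta>)) \<longlongrightarrow> D * 0) at_top"
    proof (intro tendsto_intros)
      have "filterlim (\<lambda>l. - l * \<Delta>) at_bot at_top"
        using filterlim_tendsto_pos_mult_at_top[OF tendsto_const \<open>0 < \<Delta>\<close> filterlim_ident]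
        by (simp add: filterlim_uminus_at_top mult.commute)
      then show "((\<lambda>l. exp (- l * \<Delta>)) \<longlongrightarrow> 0) at_top" by (rule filterlim_compose[OF exp_at_bot])
    qed
    moreover have "eventually (\<lambda>l. cmod (F (Complex x \<theta>)) \<le> D * exp (- l * \<Delta>)) at_top"
      using eventually_ge_at_top[of 0] by eventually_elim (use main in auto)
    ultimately have "cmod (F (Complex x \<theta>)) \<le> D * 0" by (rule tendsto_lowerbound) simp
    then show False using nz by simp
  qed
  show ?thesis
  proof (rule analytic_continuation[of F "half_strip R \<theta> b" "(\<lambda>x. Complex x \<theta>) ` {max R R' + 1<..}"])
    show "connected (half_strip R \<theta> b)" by (simp add: convex_connected convex_half_strip)
    show "(\<lambda>x. Complex x \<theta>) ` {max R R' + 1<..} \<subseteq> half_strip R \<theta> b"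
      using \<open>0 < b\<close> by (auto simp: half_strip_def)
    show "Complex (max R R' + 2) \<theta> \<in> half_strip R \<theta> b"
      using \<open>0 < b\<close> by (auto simp: half_strip_def)
    show "Complex (max R R' + 2) \<theta> islimpt (\<lambda>x. Complex x \<theta>) ` {max R R' + 1<..}"
      unfolding islimpt_approachable
    proof (intro allI impI)
      fix e :: real assume "0 < e"
      then show "\<exists>x'\<in>(\<lambda>x. Complex x \<theta>) ` {max R R' + 1<..}. x' \<noteq> Complex (max R R' + 2) \<theta> \<and> dist x' (Complex (max R R' + 2) \<theta>) < e"
        by (intro bexI[of _ "Complex (max R R' + 2 + e / 2) \<theta>"]) (auto simp: dist_norm cmod_def)
    qed
  qed (use holo z line open_half_strip in auto)
qed

section \<open>A Tauberian theorem in one variable\<close>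

text \<open>The hypothesis \<open>coeff\<close>, with \<open>y\<close> chosen optimally, says that
  \<open>|g m| \<le> G A\<^sup>m m\<^bsup>m/\<kappa>\<^esup>\<close>: the series is Gevrey of order \<open>1/\<kappa>\<close>. In the variable \<open>z\<close>
  with \<open>u = e\<^bsup>-z\<^esup>\<close>, the terms up to index \<open>\<nu> e\<^bsup>\<kappa> Re z\<^esup>\<close> decrease geometrically.\<close>

locale gevrey_coeffs =
  fixes g :: "nat \<Rightarrow> complex" and G \<nu> \<kappa> :: real
  assumes pos: "0 \<le> G" "0 < \<nu>" "0 < \<kappa>"
    and coeff: "\<And>m y. real m \<le> \<nu> * exp (\<kappa> * y) \<Longrightarrow> cmod (g m) \<le> G * exp (real m * (y - 1))"
begin

definition P :: "nat \<Rightarrow> complex \<Rightarrow> complex" where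
  "P n z = (\<Sum>m<n. g m * exp (- (of_nat m * z)))"

definition nn :: "real \<Rightarrow> nat" where
  "nn x = nat \<lfloor>\<nu> * exp (\<kappa> * x)\<rfloor>"

lemma holomorphic_P: "P n holomorphic_on S"
  unfolding P_def by (intro holomorphic_intros)

lemma exp_nat_floor: "0 \<le> t \<Longrightarrow> exp (- real (nat \<lfloor>t\<rfloor>)) \<le> exp 1 * exp (- t)"
  unfolding exp_add[symmetric] by simp linarith

lemma exp_nn: "exp (- real (nn x)) \<le> exp 1 * exp (- (\<nu> * exp (\<kappa> * x)))"
  unfolding nn_def using pos by (intro exp_nat_floor) auto

lemma nn_mono: "x \<le> y \<Longrightarrow> nn x \<le> nn y"
  unfolding nn_def using pos by (intro nat_mono floor_mono mult_left_mono) auto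

lemma less_nnD: "m < nn x \<Longrightarrow> real m \<le> \<nu> * exp (\<kappa> * x)"
  unfolding nn_def by linarith

lemma P_diff:
  assumes "n1 \<le> n2" "n2 \<le> nn (Re z)"
  shows "cmod (P n2 z - P n1 z) \<le> 2 * G * exp (- real n1)"
proof -
  \<comment> \<open>The claim is put into telescoping form for the induction: every term is at most
    G e^-n, and e^-n <= 2 (e^-n - e^-(n+1)) because e >= 2.\<close>
  have "cmod (P n2 z - P n1 z) \<le> 2 * G * (exp (- real n1) - exp (- real n2))"
    using assms
  proof (induction n2 rule: dec_induct)
    case (step n)
    have e: "2 \<le> exp (1::real)" using exp_ge_add_one_self[of 1] by simp
    have "cmod (g n * exp (- (of_nat n * z))) \<le> G * exp (real n * (Re z - 1)) * exp (- (real n * Re z))"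
      unfolding norm_mult using coeff[OF less_nnD, of n "Re z"] step pos by (intro mult_mono) auto
    also have "\<dots> = G * exp (- real n)" by (simp add: mult_exp_exp algebra_simps)
    also have "\<dots> \<le> G * (2 * (exp (- real n) - exp (- real (Suc n))))"
    proof (intro mult_left_mono pos)
      have "2 * exp (- real (Suc n)) \<le> exp 1 * exp (- real (Suc n))" using e by (intro mult_right_mono) auto
      also have "\<dots> = exp (- real n)" by (simp add: exp_add[symmetric])
      finally show "exp (- real n) \<le> 2 * (exp (- real n) - exp (- real (Suc n)))" by simp
    qed
    finally have "cmod (g n * exp (- (of_nat n * z))) \<le> 2 * G * (exp (- real n) - exp (- real (Suc n)))"
      by (simp only: mult_ac)
    moreover have "P (Suc n) z - P n1 z = (P n z - P n1 z) + g n * exp (- (of_nat n * z))"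
      by (simp add: P_def)
    ultimately have "cmod (P (Suc n) z - P n1 z) \<le> 2 * G * (exp (- real n1) - exp (- real n)) + 2 * G * (exp (- real n) - exp (- real (Suc n)))"
      using step norm_triangle_ineq[of "P n z - P n1 z" "g n * exp (- (of_nat n * z))"] by (smt (verit) less_imp_le Suc_leD)
    then show ?case by (simp add: algebra_simps)
  qed auto
  also have "\<dots> \<le> 2 * G * exp (- real n1)" using pos by (intro mult_left_mono) auto
  finally show ?thesis .
qed

text \<open>In the variable u = e^-z the error is O (exp (- c |u|^-p)); exponent \<kappa> would be
  the optimal truncation error of a series of Gevrey order 1/\<kappa>. The condition
  \<open>0 \<le> R\<close> keeps Re z positive, so that a larger p is a stronger statement.\<close>

definition small :: "(complex \<Rightarrow> complex) \<Rightarrow> real \<Rightarrow> real \<Rightarrow> real \<Rightarrow> bool" where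
  "small h \<theta> p b \<longleftrightarrow> (\<exists>D\<ge>0. \<exists>c>0. \<exists>R\<ge>0. \<forall>z\<in>half_strip R \<theta> b.
     cmod (h z - P (nn (Re z)) z) \<le> D * exp (- c * exp (p * Re z)))"

lemma small_mono:
  assumes "small h \<theta> p b" "p' \<le> p" "b' \<le> b"
  shows "small h \<theta> p' b'"
proof -
  obtain D c R where *: "0 \<le> D" "0 < c" "0 \<le> R"
    "\<And>z. z \<in> half_strip R \<theta> b \<Longrightarrow> cmod (h z - P (nn (Re z)) z) \<le> D * exp (- c * exp (p * Re z))"
    using assms(1) by (auto simp: small_def)
  have "cmod (h z - P (nn (Re z)) z) \<le> D * exp (- c * exp (p' * Re z))" if "z \<in> half_strip R \<theta> b'" for z
  proof -
    have "z \<in> half_strip R \<theta> b" using that assms by (auto simp: half_strip_def)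
    then have "cmod (h z - P (nn (Re z)) z) \<le> D * exp (- c * exp (p * Re z))" by (rule *)
    also have "\<dots> \<le> D * exp (- c * exp (p' * Re z))"
      using * assms that by (auto simp: half_strip_def intro!: mult_left_mono mult_right_mono)
    finally show ?thesis .
  qed
  then show ?thesis unfolding small_def using * by blast
qed

text \<open>Truncating at the integer part of \<mu> e^(K Re z) with \<mu> below both \<nu> and
  \<nu>' is admissible for the asymptotics of h and for \<open>P_diff\<close>; both errors are then
  multiples of e^-M.\<close>

lemma small_init:
  assumes "0 < \<nu>'" "K \<le> \<kappa>" "0 \<le> C"
    and asymp: "\<And>z M. z \<in> half_strip R \<theta> b \<Longrightarrow> real M \<le> \<nu>' * exp (K * Re z) \<Longrightarrow>
      cmod (h z - P M z) \<le> C * exp (- real M)"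
  shows "small h \<theta> K b"
proof -
  define \<mu> where "\<mu> = min \<nu> \<nu>'"
  have \<mu>: "0 < \<mu>" "\<mu> \<le> \<nu>" "\<mu> \<le> \<nu>'" using pos assms by (auto simp: \<mu>_def)
  define R1 where "R1 = max R 0"
  have "cmod (h z - P (nn (Re z)) z) \<le> ((C + 2 * G) * exp 1) * exp (- \<mu> * exp (K * Re z))"
    if z: "z \<in> half_strip R1 \<theta> b" for z
  proof -
    define M where "M = nat \<lfloor>\<mu> * exp (K * Re z)\<rfloor>"
    have zR: "z \<in> half_strip R \<theta> b" "0 \<le> Re z" using z by (auto simp: half_strip_def R1_def)
    have M: "real M \<le> \<mu> * exp (K * Re z)" unfolding M_def using \<mu> by simp
    have "\<mu> * exp (K * Re z) \<le> \<nu>' * exp (K * Re z)" using \<mu> by simp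
    with M have 1: "cmod (h z - P M z) \<le> C * exp (- real M)" by (intro asymp[OF zR(1)]) linarith
    have "\<mu> * exp (K * Re z) \<le> \<nu> * exp (\<kappa> * Re z)"
      using \<mu> zR assms pos by (intro mult_mono) (auto intro: mult_right_mono)
    then have "M \<le> nn (Re z)" unfolding M_def nn_def by (intro nat_mono floor_mono)
    then have 2: "cmod (P (nn (Re z)) z - P M z) \<le> 2 * G * exp (- real M)" by (rule P_diff) simp
    have "h z - P (nn (Re z)) z = (h z - P M z) - (P (nn (Re z)) z - P M z)" by simp
    then have "cmod (h z - P (nn (Re z)) z) \<le> cmod (h z - P M z) + cmod (P (nn (Re z)) z - P M z)"
      by (metis norm_triangle_ineq4)
    also have "\<dots> \<le> (C + 2 * G) * exp (- real M)" using 1 2 by (simp add: algebra_simps)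
    also have "\<dots> \<le> (C + 2 * G) * (exp 1 * exp (- (\<mu> * exp (K * Re z))))"
      unfolding M_def using \<mu> pos assms by (intro mult_left_mono exp_nat_floor) auto
    finally show ?thesis by (simp add: algebra_simps)
  qed
  then show ?thesis unfolding small_def using \<mu> pos assms
    by (intro exI[of _ "(C + 2 * G) * exp 1"] conjI exI[of _ \<mu>] exI[of _ R1]) (auto simp: R1_def)
qed

text \<open>On \<open>Re z \<ge> xl\<close> compare \<open>h\<close> with the fixed partial sum of index \<open>nn xl\<close>, up to the abscissa
  \<open>X = (\<kappa>/p) xl\<close>, where the known decay is as small as the truncation error at \<open>xl\<close>.\<close>

lemma small_boost:
  assumes sm: "small h \<theta> p b" and holo: "h holomorphic_on half_strip R0 \<theta> b"
    and p: "0 < p" "p < \<kappa>" and q: "0 < q" "q < p" "pi / 2 < q * b" "q < q'"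
  shows "small h \<theta> (\<kappa> - q / p * (\<kappa> - p)) (pi / (2 * q'))"
proof -
  obtain D c R where D: "0 \<le> D" and c: "0 < c" and R: "0 \<le> R"
    and bnd: "\<And>z. z \<in> half_strip R \<theta> b \<Longrightarrow> cmod (h z - P (nn (Re z)) z) \<le> D * exp (- c * exp (p * Re z))"
    using sm by (auto simp: small_def)
  \<comment> \<open>The exponent produced by the comparison: l e^(q xl) = \<mu> e^(p' xl) for the l
    and X chosen below. Equivalently, the gap to \<kappa> shrinks by the factor q/p.\<close>
  define p' where "p' = \<kappa> - q / p * (\<kappa> - p)"
  have p': "p' = (p - q) * (\<kappa> / p) + q" "p' < \<kappa>" "0 < p'"
  proof -
    show "p' = (p - q) * (\<kappa> / p) + q" unfolding p'_def using p by (simp add: field_simps)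
    have "0 < q / p * (\<kappa> - p)" using p q by (intro mult_pos_pos) auto
    then show "p' < \<kappa>" by (simp add: p'_def)
    have "q / p * (\<kappa> - p) \<le> 1 * (\<kappa> - p)" using p q by (intro mult_right_mono) auto
    then have "q / p * (\<kappa> - p) \<le> \<kappa> - p" by simp
    then show "0 < p'" using p unfolding p'_def by (smt (verit))
  qed
  have "0 < b" using q by (smt (verit) mult_nonneg_nonpos pi_half_gt_zero)
  define b1 where "b1 = min ((pi / (2 * q) + b) / 2) (pi / q)"
  have "pi / (2 * q) < b" using q by (simp add: field_simps)
  then have b1: "b1 < b" "pi / 2 \<le> q * b1" "q * b1 \<le> pi" "0 < b1" "pi / (2 * q) < b1"
    using \<open>0 < q\<close> \<open>0 < b\<close> by (auto simp: b1_def min_def field_simps)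
  define \<mu> where "\<mu> = min c \<nu>"
  have \<mu>: "0 < \<mu>" "\<mu> \<le> c" "\<mu> \<le> \<nu>" using c pos by (auto simp: \<mu>_def)
  \<comment> \<open>Since q < q', the cosine is at least this positive number on the narrower strip
    of half-width \<pi>/(2q').\<close>
  define \<delta> where "\<delta> = cos (q * (pi / (2 * q')))"
  have \<delta>: "0 < \<delta>"
    unfolding \<delta>_def
  proof (intro cos_gt_zero_pi)
    have "q * (pi / (2 * q')) > 0" using q by simp
    then show "- (pi / 2) < q * (pi / (2 * q'))" using pi_gt_zero by linarith
    show "q * (pi / (2 * q')) < pi / 2" using q by (simp add: field_simps)
  qed
  \<comment> \<open>The left edge is placed at distance t from Re z, with t so large that the gain
    e^(q Re z) \<delta> is at least twice the loss e^(q xl) from that edge.\<close>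
  define t where "t = max 0 (ln (2 / \<delta>) / q)"
  have t: "0 \<le> t" "2 \<le> exp (q * t) * \<delta>"
  proof -
    have "ln (2 / \<delta>) \<le> q * t" using q by (auto simp: t_def max_def field_simps)
    then have "exp (ln (2 / \<delta>)) \<le> exp (q * t)" by simp
    then show "2 \<le> exp (q * t) * \<delta>" using \<delta> by (simp add: field_simps)
  qed (simp add: t_def)
  define D' where "D' = D + 2 * exp 1 * G"
  have D': "0 \<le> D'" using D pos by (simp add: D'_def)
  \<comment> \<open>Far enough to the right that xl exceeds R, R0 and 0, and that xl >= t p /
    (\<kappa> - p), which is exactly Re z <= X.\<close>
  define R1 where "R1 = max R R0 + t + 1 + t * p / (\<kappa> - p) + max 0 (- R0)"
  have ratio: "0 \<le> t * p / (\<kappa> - p)" using t p by auto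
  have main: "cmod (h z - P (nn (Re z)) z) \<le> (2 * D') * exp (- (\<mu> * exp (- p' * t)) * exp (p' * Re z))"
    if z: "z \<in> half_strip R1 \<theta> (pi / (2 * q'))" for z
  proof -
    define xl where "xl = Re z - t"
    define X where "X = \<kappa> / p * xl"
    have zR: "R1 < Re z" "\<bar>Im z - \<theta>\<bar> < pi / (2 * q')" using z by (auto simp: half_strip_def)
    have xl: "0 < xl" "R < xl" "R0 < xl" "t * p / (\<kappa> - p) \<le> xl" "xl \<le> Re z"
      using zR R ratio t unfolding xl_def R1_def by linarith+
    have X: "Re z \<le> X" "xl \<le> X"
    proof -
      have "t * p \<le> xl * (\<kappa> - p)" using xl(4) p by (simp add: field_simps)
      then show "Re z \<le> X" unfolding X_def using p by (simp add: field_simps xl_def)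
      then show "xl \<le> X" using xl(5) by simp
    qed
    have pX: "p * X = \<kappa> * xl" using p by (simp add: X_def)
    define S where "S = cbox (Complex xl (\<theta> - b1)) (Complex X (\<theta> + b1))"
    define F where "F w = h w - P (nn xl) w" for w
    have trunc: "cmod (P (nn (Re w)) w - P (nn xl) w) \<le> 2 * exp 1 * G * exp (- (\<mu> * exp (\<kappa> * xl)))"
      if "xl \<le> Re w" for w
    proof -
      have "cmod (P (nn (Re w)) w - P (nn xl) w) \<le> 2 * G * exp (- real (nn xl))"
        using that by (intro P_diff nn_mono) auto
      also have "\<dots> \<le> 2 * G * (exp 1 * exp (- (\<nu> * exp (\<kappa> * xl))))"
        using pos by (intro mult_left_mono exp_nn) auto
      also have "\<dots> \<le> 2 * G * (exp 1 * exp (- (\<mu> * exp (\<kappa> * xl))))"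
        using pos \<mu> by (intro mult_left_mono) auto
      finally show ?thesis by (simp add: mult_ac)
    qed
    have FS: "cmod (F w) \<le> D * exp (- \<mu> * exp (p * Re w)) + 2 * exp 1 * G * exp (- (\<mu> * exp (\<kappa> * xl)))"
      if "w \<in> S" for w
    proof -
      have w: "w \<in> half_strip R \<theta> b" "xl \<le> Re w"
        using that xl b1 by (auto simp: S_def in_cbox_complex_iff half_strip_def)
      have "F w = (h w - P (nn (Re w)) w) + (P (nn (Re w)) w - P (nn xl) w)" by (simp add: F_def)
      then have "cmod (F w) \<le> cmod (h w - P (nn (Re w)) w) + cmod (P (nn (Re w)) w - P (nn xl) w)"
        by (metis norm_triangle_ineq)
      moreover have "D * exp (- c * exp (p * Re w)) \<le> D * exp (- \<mu> * exp (p * Re w))"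
        using D \<mu> by (intro mult_left_mono) auto
      ultimately show ?thesis using bnd[OF w(1)] trunc[OF w(2)] by linarith
    qed
    \<comment> \<open>Chosen so that exp (- l e^(q X)) equals the bound exp (- \<mu> e^(\<kappa>
      xl)) available on the right edge.\<close>
    define l where "l = \<mu> * exp ((p - q) * X)"
    have lX: "l * exp (q * X) = \<mu> * exp (\<kappa> * xl)"
      unfolding l_def pX[symmetric] by (simp add: exp_add[symmetric] algebra_simps)
    have ll: "l * exp (q * xl) = \<mu> * exp (p' * xl)"
      unfolding l_def p'(1) X_def by (simp add: exp_add[symmetric] algebra_simps)
    have "pi / (2 * q') < pi / (2 * q)" using q by (simp add: field_simps)
    then have zS: "z \<in> S"
      using zR xl X b1 by (auto simp: S_def in_cbox_complex_iff)
    have "cmod (F z) \<le> D' * exp (l * (exp (q * xl) - exp (q * Re z) * cos (q * (Im z - \<theta>))))"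
    proof (rule rectangle_decay[where b = b1 and X = X])
      have "S \<subseteq> half_strip R0 \<theta> b"
        using xl b1 by (auto simp: S_def in_cbox_complex_iff half_strip_def)
      then show "F holomorphic_on cbox (Complex xl (\<theta> - b1)) (Complex X (\<theta> + b1))"
        unfolding F_def S_def[symmetric]
        by (intro holomorphic_intros holomorphic_P holomorphic_on_subset[OF holo])
      show "cmod (F w) \<le> D'" if "w \<in> cbox (Complex xl (\<theta> - b1)) (Complex X (\<theta> + b1))" for w
      proof -
        have "D * exp (- \<mu> * exp (p * Re w)) \<le> D * 1" using D \<mu> by (intro mult_left_mono) auto
        moreover have "2 * exp 1 * G * exp (- (\<mu> * exp (\<kappa> * xl))) \<le> 2 * exp 1 * G * 1"
          using pos \<mu> by (intro mult_left_mono) auto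
        ultimately show ?thesis using FS[of w] that unfolding S_def D'_def by linarith
      qed
      show "cmod (F w) \<le> D' * exp (- l * exp (q * X))"
        if "w \<in> cbox (Complex xl (\<theta> - b1)) (Complex X (\<theta> + b1))" "Re w = X" for w
      proof -
        have "cmod (F w) \<le> D * exp (- \<mu> * exp (\<kappa> * xl)) + 2 * exp 1 * G * exp (- (\<mu> * exp (\<kappa> * xl)))"
          using FS[of w] that by (simp add: S_def pX)
        also have "\<dots> = D' * exp (- (l * exp (q * X)))" unfolding lX D'_def by (simp add: algebra_simps)
        finally show ?thesis by simp
      qed
    qed (use zS b1 q \<mu> D' in \<open>auto simp: S_def l_def\<close>)
    also have "\<dots> \<le> D' * exp (- (l * exp (q * xl)))"
    proof -
      have "\<delta> \<le> cos \<bar>q * (Im z - \<theta>)\<bar>"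
        unfolding \<delta>_def
      proof (rule cos_monotone_0_pi_le)
        show "\<bar>q * (Im z - \<theta>)\<bar> \<le> q * (pi / (2 * q'))"
          unfolding abs_mult using q zR by (intro mult_mono) auto
        have "q * (pi / (2 * q')) \<le> pi / 2" using q by (simp add: field_simps)
        then show "q * (pi / (2 * q')) \<le> pi" using pi_gt_zero by linarith
      qed simp
      then have "exp (q * Re z) * \<delta> \<le> exp (q * Re z) * cos (q * (Im z - \<theta>))" by simp
      moreover have "exp (q * Re z) * \<delta> = exp (q * xl) * (exp (q * t) * \<delta>)"
        by (simp add: xl_def exp_add[symmetric] algebra_simps)
      moreover have "exp (q * xl) * 2 \<le> exp (q * xl) * (exp (q * t) * \<delta>)" using t by simp
      ultimately have "exp (q * xl) - exp (q * Re z) * cos (q * (Im z - \<theta>)) \<le> - exp (q * xl)" by linarith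
      then have "l * (exp (q * xl) - exp (q * Re z) * cos (q * (Im z - \<theta>))) \<le> l * (- exp (q * xl))"
        using \<mu> by (intro mult_left_mono) (auto simp: l_def)
      then show ?thesis using D' by (intro mult_left_mono) auto
    qed
    finally have Fz: "cmod (F z) \<le> D' * exp (- (\<mu> * exp (p' * xl)))" by (simp add: ll)
    have "\<mu> * exp (p' * xl) \<le> \<mu> * exp (\<kappa> * xl)" using \<mu> p' xl by (intro mult_left_mono) (auto intro: mult_right_mono)
    then have "2 * exp 1 * G * exp (- (\<mu> * exp (\<kappa> * xl))) \<le> 2 * exp 1 * G * exp (- (\<mu> * exp (p' * xl)))"
      using pos by (intro mult_left_mono) auto
    also have "\<dots> \<le> D' * exp (- (\<mu> * exp (p' * xl)))" using D by (intro mult_right_mono) (auto simp: D'_def)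
    finally have 2: "cmod (P (nn (Re z)) z - P (nn xl) z) \<le> D' * exp (- (\<mu> * exp (p' * xl)))"
      using trunc[OF xl(5)] by linarith
    have "h z - P (nn (Re z)) z = F z - (P (nn (Re z)) z - P (nn xl) z)" by (simp add: F_def)
    then have "cmod (h z - P (nn (Re z)) z) \<le> cmod (F z) + cmod (P (nn (Re z)) z - P (nn xl) z)"
      by (metis norm_triangle_ineq4)
    then have "cmod (h z - P (nn (Re z)) z) \<le> (2 * D') * exp (- (\<mu> * exp (p' * xl)))" using Fz 2 by simp
    also have "exp (p' * xl) = exp (- p' * t) * exp (p' * Re z)"
      by (simp add: xl_def exp_add[symmetric] algebra_simps)
    finally show ?thesis by (simp add: mult.assoc)
  qed
  have "0 \<le> R1" using R t ratio by (simp add: R1_def)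
  then show ?thesis
    unfolding small_def p'_def[symmetric] using main D' \<mu>
    by (intro exI[of _ "2 * D'"] conjI exI[of _ "\<mu> * exp (- p' * t)"] exI[of _ R1]) auto
qed

text \<open>Iteration of \<open>small_boost\<close>: each round multiplies \<kappa> minus the
  exponent by at most Q/K < 1, so the exponents tend to \<kappa>. The losses of width can be made so
  small that a half-width \<pi>/(2Q) > \<pi>/(2K) always remains.\<close>

lemma small_improve:
  assumes sm: "small h \<theta> K b" and holo: "h holomorphic_on half_strip R0 \<theta> b"
    and K: "0 < K" "K < \<kappa>" and b: "pi / (2 * K) < b" and p: "p < \<kappa>"
  obtains b' where "pi / (2 * K) < b'" "b' \<le> b" "small h \<theta> p b'"
proof -
  have "0 < b" using b K by (smt (verit) divide_pos_pos pi_gt_zero)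
  then have "pi / (2 * b) < K" using b K by (simp add: field_simps)
  then obtain Q where Q: "pi / (2 * b) < Q" "Q < K" using dense by blast
  have bq: "pi / (2 * q) < b" if "pi / (2 * b) < q" for q
  proof -
    have "0 < q" using that \<open>0 < b\<close> by (smt (verit) divide_pos_pos pi_gt_zero)
    then show ?thesis using that \<open>0 < b\<close> by (simp add: field_simps)
  qed
  have Qpos: "0 < Q" using Q \<open>0 < b\<close> by (smt (verit) divide_pos_pos pi_gt_zero)
  \<comment> \<open>Lower bounds for the exponents reached: the initial gap \<kappa> - K shrinks
    geometrically.\<close>
  define pp where "pp i = \<kappa> - (Q / K) ^ i * (\<kappa> - K)" for i
  have iter: "small h \<theta> (pp i) (pi / (2 * q'))" if "pi / (2 * b) < q'" "q' \<le> Q" for i q'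
    using that
  proof (induction i arbitrary: q')
    case 0
    then show ?case using sm bq[of q'] by (auto simp: pp_def intro: small_mono)
  next
    case (Suc i)
    \<comment> \<open>The induction covers all q' at once. Two intermediate values q2 < q < q' are
      inserted: the wider strip of q2 carries the induction hypothesis, and q is the comparison
      exponent.\<close>
    obtain q where q: "pi / (2 * b) < q" "q < q'" using Suc.prems dense by blast
    obtain q2 where q2: "pi / (2 * b) < q2" "q2 < q" using q dense by blast
    have q2pos: "0 < q2" using q2 \<open>0 < b\<close> by (smt (verit) divide_pos_pos pi_gt_zero)
    have pw: "0 < (Q / K) ^ i" "(Q / K) ^ i \<le> 1" using Qpos Q K by (auto intro!: power_le_one)
    have ppi: "K \<le> pp i" "pp i < \<kappa>"
    proof -
      have "(Q / K) ^ i * (\<kappa> - K) \<le> 1 * (\<kappa> - K)" using pw K by (intro mult_right_mono) auto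
      then show "K \<le> pp i" unfolding pp_def by simp
      have "0 < (Q / K) ^ i * (\<kappa> - K)" using pw K by (intro mult_pos_pos) auto
      then show "pp i < \<kappa>" unfolding pp_def by simp
    qed
    have "small h \<theta> (\<kappa> - q / pp i * (\<kappa> - pp i)) (pi / (2 * q'))"
    proof (rule small_boost)
      show "small h \<theta> (pp i) (pi / (2 * q2))" using Suc q q2 by auto
      have "half_strip R0 \<theta> (pi / (2 * q2)) \<subseteq> half_strip R0 \<theta> b"
        using bq[OF q2(1)] by (auto simp: half_strip_def)
      then show "h holomorphic_on half_strip R0 \<theta> (pi / (2 * q2))"
        using holo holomorphic_on_subset by blast
      show "pi / 2 < q * (pi / (2 * q2))" using q2 q2pos by (simp add: field_simps)
    qed (use ppi K q q2 q2pos Suc.prems Q in auto)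
    moreover have "pp (Suc i) \<le> \<kappa> - q / pp i * (\<kappa> - pp i)"
    proof -
      have "q / pp i \<le> Q / K" using q q2 q2pos Suc.prems ppi K by (intro frac_le) auto
      then have "q / pp i * (\<kappa> - pp i) \<le> Q / K * (\<kappa> - pp i)" using ppi by (intro mult_right_mono) auto
      then show ?thesis by (simp add: pp_def)
    qed
    ultimately show ?case by (rule small_mono) simp
  qed
  have "(\<lambda>i. pp i) \<longlonglongrightarrow> \<kappa> - 0 * (\<kappa> - K)"
    unfolding pp_def using Q Qpos K by (intro tendsto_intros LIMSEQ_power_zero) auto
  then have "eventually (\<lambda>i. p < pp i) sequentially" using p by (intro order_tendstoD) auto
  then obtain i where "p < pp i" by (auto simp: eventually_sequentially)
  then have "small h \<theta> p (pi / (2 * Q))" using iter[of Q i] Q by (auto intro: small_mono)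
  moreover have "pi / (2 * K) < pi / (2 * Q)" using Q Qpos by (simp add: field_simps)
  ultimately show thesis using that[of "pi / (2 * Q)"] bq[of Q] Q by auto
qed

end

text \<open>Strong induction: subtracting the two expansions of order m + 1 leaves (c m - g m) u^m =
  O (u^(m+1)). It identifies Taylor coefficients with the coefficients of an asymptotic expansion
  along the positive axis.\<close>

lemma power_series_coeffs_unique:
  fixes c g :: "nat \<Rightarrow> complex"
  assumes "\<And>M. \<exists>B. \<exists>\<delta>>0. \<forall>u. 0 < u \<and> u < \<delta> \<longrightarrow>
      cmod (\<Psi> u - (\<Sum>m<M. c m * of_real u ^ m)) \<le> B * u ^ M"
    and "\<And>M. \<exists>B. \<exists>\<delta>>0. \<forall>u. 0 < u \<and> u < \<delta> \<longrightarrow>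
      cmod (\<Psi> u - (\<Sum>m<M. g m * of_real u ^ m)) \<le> B * u ^ M"
  shows "c m = g m"
proof (induction m rule: less_induct)
  case (less m)
  obtain B1 \<delta>1 where 1: "0 < \<delta>1" "\<And>u. 0 < u \<Longrightarrow> u < \<delta>1 \<Longrightarrow>
      cmod (\<Psi> u - (\<Sum>m<Suc m. c m * of_real u ^ m)) \<le> B1 * u ^ Suc m" using assms(1) by meson
  obtain B2 \<delta>2 where 2: "0 < \<delta>2" "\<And>u. 0 < u \<Longrightarrow> u < \<delta>2 \<Longrightarrow>
      cmod (\<Psi> u - (\<Sum>m<Suc m. g m * of_real u ^ m)) \<le> B2 * u ^ Suc m" using assms(2) by meson
  have le: "cmod (c m - g m) \<le> (B1 + B2) * u" if u: "0 < u" "u < min \<delta>1 \<delta>2" for u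
  proof -
    have "(\<Sum>i<m. c i * of_real u ^ i) = (\<Sum>i<m. g i * of_real u ^ i)"
      using less by (intro sum.cong) auto
    then have "(c m - g m) * of_real u ^ m = (\<Psi> u - (\<Sum>m<Suc m. g m * of_real u ^ m)) -
        (\<Psi> u - (\<Sum>m<Suc m. c m * of_real u ^ m))" by (simp add: algebra_simps)
    then have "cmod ((c m - g m) * of_real u ^ m) \<le> cmod (\<Psi> u - (\<Sum>m<Suc m. g m * of_real u ^ m)) +
        cmod (\<Psi> u - (\<Sum>m<Suc m. c m * of_real u ^ m))" by (simp only: norm_triangle_ineq4)
    also have "\<dots> \<le> B2 * u ^ Suc m + B1 * u ^ Suc m"
      using 1(2)[of u] 2(2)[of u] u by (intro add_mono) auto
    finally have "cmod ((c m - g m) * of_real u ^ m) \<le> B2 * u ^ Suc m + B1 * u ^ Suc m" .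
    then have "cmod (c m - g m) * u ^ m \<le> ((B1 + B2) * u) * u ^ m"
    proof -
      have "cmod ((c m - g m) * of_real u ^ m) = cmod (c m - g m) * u ^ m"
        using u by (simp add: norm_mult norm_power)
      moreover have "B2 * u ^ Suc m + B1 * u ^ Suc m = ((B1 + B2) * u) * u ^ m" by (simp add: algebra_simps)
      ultimately show ?thesis using \<open>cmod ((c m - g m) * of_real u ^ m) \<le> B2 * u ^ Suc m + B1 * u ^ Suc m\<close> by simp
    qed
    then show ?thesis using u by simp
  qed
  have "((\<lambda>u. (B1 + B2) * u) \<longlongrightarrow> (B1 + B2) * 0) (at_right 0)" by (intro tendsto_intros)
  moreover have "eventually (\<lambda>u. cmod (c m - g m) \<le> (B1 + B2) * u) (at_right 0)"
    using le 1(1) 2(1) unfolding eventually_at_right_field by (intro exI[of _ "min \<delta>1 \<delta>2"]) auto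
  ultimately have "cmod (c m - g m) \<le> (B1 + B2) * 0"
    by (rule tendsto_lowerbound) (simp add: trivial_limit_at_right_real)
  then show ?case by simp
qed

text \<open>A bounded holomorphic \<open>2\<pi>\<i>\<close>-periodic function on a half plane is a bounded
  holomorphic function of \<open>e\<^bsup>-z\<^esup>\<close>.\<close>

lemma periodic_coeff_bound:
  assumes holo: "H holomorphic_on {z. R < Re z}" and bound: "\<And>z. R < Re z \<Longrightarrow> cmod (H z) \<le> C"
    and per: "\<And>z. R < Re z \<Longrightarrow> H (z + 2 * of_real pi * \<i>) = H z"
    and asymp: "\<And>M. \<exists>B X. \<forall>x>X. cmod (H (of_real x) - (\<Sum>m<M. g m * exp (- (of_nat m * of_real x)))) \<le> B * exp (- (real M * x))"
  shows "cmod (g m) \<le> C * exp (real m * R)"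
proof -
  define \<rho> where "\<rho> = exp (- R)"
  have "0 < \<rho>" by (simp add: \<rho>_def)
  have C0: "0 \<le> C" by (rule order_trans[OF norm_ge_zero bound[of "of_real (R + 1)"]]) simp
  have per_nat: "H (z + of_nat n * (2 * of_real pi * \<i>)) = H z" if "R < Re z" for z n
  proof (induction n)
    case (Suc n)
    have "H (z + of_nat (Suc n) * (2 * of_real pi * \<i>)) = H ((z + of_nat n * (2 * of_real pi * \<i>)) + 2 * of_real pi * \<i>)"
      by (simp add: algebra_simps)
    also have "\<dots> = H (z + of_nat n * (2 * of_real pi * \<i>))" using that by (intro per) simp
    finally show ?case using Suc by simp
  qed simp
  have per_exp: "H z = H w" if ex: "exp z = exp w" and "R < Re z" "R < Re w" for z w
  proof -
    obtain n :: int where "z = w + complex_of_real (real_of_int (2 * n) * pi) * \<i>"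
      using ex unfolding exp_eq by blast
    then have n: "z = w + of_int n * (2 * of_real pi * \<i>)" by simp
    show ?thesis
    proof (cases "0 \<le> n")
      case True
      then have "z = w + of_nat (nat n) * (2 * of_real pi * \<i>)" using n by (simp add: algebra_simps)
      then show ?thesis using per_nat[of w "nat n"] that by simp
    next
      case False
      then have "w = z + of_nat (nat (- n)) * (2 * of_real pi * \<i>)" using n by (simp add: algebra_simps)
      then show ?thesis using per_nat[of z "nat (- n)"] that by simp
    qed
  qed
  \<comment> \<open>\<open>Ln\<close> jumps by a period of H across the negative axis, so the
    composite is holomorphic there too.\<close>
  define \<Phi> where "\<Phi> u = H (- Ln u)" for u
  have Re_Ln: "R < Re (- Ln u)" if "u \<noteq> 0" "cmod u < \<rho>" for u
  proof -
    have "ln (cmod u) < ln \<rho>" using that by (subst ln_less_cancel_iff) (auto simp: \<rho>_def)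
    then show ?thesis using that by (simp add: \<rho>_def)
  qed
  have "\<Phi> holomorphic_on ball 0 \<rho> - {0}"
    unfolding holomorphic_on_def
  proof
    fix u0 :: complex assume u0: "u0 \<in> ball 0 \<rho> - {0}"
    \<comment> \<open>Around u0 the branch Ln (u / u0) + Ln u0 is holomorphic, and
      \<open>per_exp\<close> shows that it gives the same function.\<close>
    define W where "W = (ball 0 \<rho> - {0}) \<inter> (\<lambda>u. u / u0) -` (- \<real>\<^sub>\<le>\<^sub>0)"
    have "u0 \<noteq> 0" using u0 by simp
    have "open W" unfolding W_def
      by (intro open_Int open_vimage continuous_intros open_delete) (use closed_nonpos_Reals_complex \<open>u0 \<noteq> 0\<close> in \<open>auto simp: open_Compl\<close>)
    have "u0 \<in> W" using u0 by (auto simp: W_def)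
    have eq: "H (- (Ln (u / u0) + Ln u0)) = \<Phi> u" if "u \<in> W" for u
      unfolding \<Phi>_def
    proof (rule per_exp)
      have u: "u \<noteq> 0" "cmod u < \<rho>" "u0 \<noteq> 0" using that u0 by (auto simp: W_def)
      show "exp (- (Ln (u / u0) + Ln u0)) = exp (- Ln u)" using u by (simp add: exp_minus exp_diff inverse_eq_divide)
      show "R < Re (- Ln u)" using u by (intro Re_Ln)
      have "Re (- (Ln (u / u0) + Ln u0)) = Re (- Ln u)"
        using u by (simp add: norm_divide ln_div)
      then show "R < Re (- (Ln (u / u0) + Ln u0))" using \<open>R < Re (- Ln u)\<close> by simp
    qed
    have "(\<lambda>u. H (- (Ln (u / u0) + Ln u0))) holomorphic_on W"
    proof (rule holomorphic_on_compose_gen[of "\<lambda>u. - (Ln (u / u0) + Ln u0)" W H "{z. R < Re z}", unfolded o_def])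
      show "(\<lambda>u. - (Ln (u / u0) + Ln u0)) holomorphic_on W"
        using u0 by (intro holomorphic_intros) (auto simp: W_def)
      show "(\<lambda>u. - (Ln (u / u0) + Ln u0)) ` W \<subseteq> {z. R < Re z}"
      proof safe
        fix u assume "u \<in> W"
        then have u: "u \<noteq> 0" "cmod u < \<rho>" "u0 \<noteq> 0" using u0 by (auto simp: W_def)
        have "Re (- (Ln (u / u0) + Ln u0)) = Re (- Ln u)"
          using u by (simp add: norm_divide ln_div)
        then show "R < Re (- (Ln (u / u0) + Ln u0))" using Re_Ln u by simp
      qed
    qed (rule holo)
    then have "\<Phi> holomorphic_on W" using eq by (rule holomorphic_transform)
    then have "\<Phi> field_differentiable at u0"
      using \<open>open W\<close> \<open>u0 \<in> W\<close> holomorphic_on_imp_differentiable_at by blast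
    then show "\<Phi> field_differentiable at u0 within ball 0 \<rho> - {0}"
      by (rule field_differentiable_at_within)
  qed
  moreover have \<Phi>C: "cmod (\<Phi> u) \<le> C" if "u \<noteq> 0" "cmod u < \<rho>" for u
    unfolding \<Phi>_def using that by (intro bound Re_Ln)
  then have "eventually (\<lambda>u. cmod (\<Phi> u) \<le> C) (at 0)"
    unfolding eventually_at using \<open>0 < \<rho>\<close> by (intro exI[of _ \<rho>]) auto
  ultimately obtain \<Psi> where \<Psi>: "\<Psi> holomorphic_on ball 0 \<rho>" "\<And>u. u \<in> ball 0 \<rho> - {0} \<Longrightarrow> \<Psi> u = \<Phi> u"
    using holomorphic_on_extend_bounded[of \<Phi> "ball 0 \<rho>" 0] \<open>0 < \<rho>\<close> by auto
  define c where "c n = (deriv ^^ n) \<Psi> 0 / fact n" for n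
  \<comment> \<open>Cauchy's inequality on circles of radius r < \<rho>, followed by the limit r to
    \<rho>, which keeps the constant C and the radius sharp.\<close>
  have c_le: "cmod (c n) \<le> C / \<rho> ^ n" for n
  proof -
    have "cmod (c n) \<le> C / r ^ n" if r: "0 < r" "r < \<rho>" for r
    proof -
      have "cmod ((deriv ^^ n) \<Psi> 0) \<le> (fact n) * C / r ^ n"
      proof (rule Cauchy_inequality)
        show "\<Psi> holomorphic_on ball 0 r" by (rule holomorphic_on_subset[OF \<Psi>(1)]) (use r in auto)
        show "continuous_on (cball 0 r) \<Psi>"
          by (rule holomorphic_on_imp_continuous_on, rule holomorphic_on_subset[OF \<Psi>(1)]) (use r in auto)
        show "cmod (\<Psi> x) \<le> C" if "cmod (0 - x) = r" for x
          using \<Psi>(2)[of x] \<Phi>C[of x] that r by auto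
      qed (use r in auto)
      then show ?thesis by (simp add: c_def norm_divide field_simps)
    qed
    then have "eventually (\<lambda>r. cmod (c n) \<le> C / r ^ n) (at_left \<rho>)"
      unfolding eventually_at_left_field using \<open>0 < \<rho>\<close> by (intro exI[of _ 0]) auto
    moreover have "((\<lambda>r. C / r ^ n) \<longlongrightarrow> C / \<rho> ^ n) (at_left \<rho>)"
      using \<open>0 < \<rho>\<close> by (intro tendsto_intros) auto
    ultimately show ?thesis by (intro tendsto_lowerbound[of "\<lambda>r. C / r ^ n" _ "at_left \<rho>"]) (auto simp: trivial_limit_at_left_real)
  qed
  have "c m = g m"
  proof (rule power_series_coeffs_unique[where \<Psi> = "\<lambda>u. \<Psi> (of_real u)"])
    fix M
    show "\<exists>B. \<exists>\<delta>>0. \<forall>u. 0 < u \<and> u < \<delta> \<longrightarrow>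
      cmod (\<Psi> (of_real u) - (\<Sum>m<M. c m * of_real u ^ m)) \<le> B * u ^ M"
    proof (rule exI[of _ "2 * C / \<rho> ^ M"], rule exI[of _ "\<rho> / 2"], intro conjI allI impI)
      fix u :: real assume u: "0 < u \<and> u < \<rho> / 2"
      have s: "(\<lambda>n. c n * of_real u ^ n) sums \<Psi> (of_real u)"
        using holomorphic_power_series[OF \<Psi>(1), of "of_real u"] u by (simp add: c_def)
      then have sM: "(\<lambda>n. c (n + M) * of_real u ^ (n + M)) sums (\<Psi> (of_real u) - (\<Sum>m<M. c m * of_real u ^ m))"
        using sums_iff_shift[of "\<lambda>n. c n * of_real u ^ n" M] by simp
      have le: "norm (c (n + M) * of_real u ^ (n + M)) \<le> C / \<rho> ^ M * u ^ M * (1 / 2) ^ n" for n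
      proof -
        have "norm (c (n + M) * of_real u ^ (n + M)) \<le> (C / \<rho> ^ (n + M)) * u ^ (n + M)"
          unfolding norm_mult using c_le[of "n + M"] u C0 \<open>0 < \<rho>\<close> by (intro mult_mono) (auto simp: norm_power)
        also have "\<dots> = C / \<rho> ^ M * u ^ M * (u / \<rho>) ^ n"
          by (simp add: power_add power_divide field_simps)
        also have "\<dots> \<le> C / \<rho> ^ M * u ^ M * (1 / 2) ^ n"
          using u C0 \<open>0 < \<rho>\<close> by (intro mult_left_mono power_mono) (auto simp: field_simps)
        finally show ?thesis .
      qed
      have "(\<lambda>n. C / \<rho> ^ M * u ^ M * (1 / 2) ^ n) sums (C / \<rho> ^ M * u ^ M * 2)"
        using sums_mult[OF geometric_sums[of "1 / 2 :: real"], of "C / \<rho> ^ M * u ^ M"] by simp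
      then have "cmod (\<Psi> (of_real u) - (\<Sum>m<M. c m * of_real u ^ m)) \<le> C / \<rho> ^ M * u ^ M * 2"
        using norm_sums_le[OF sM _ le] by blast
      then show "cmod (\<Psi> (of_real u) - (\<Sum>m<M. c m * of_real u ^ m)) \<le> 2 * C / \<rho> ^ M * u ^ M"
        by (simp add: mult_ac)
    qed (use \<open>0 < \<rho>\<close> in auto)
    obtain B X where BX: "\<And>x. x > X \<Longrightarrow> cmod (H (of_real x) - (\<Sum>m<M. g m * exp (- (of_nat m * of_real x)))) \<le> B * exp (- (real M * x))"
      using asymp[of M] by blast
    show "\<exists>B. \<exists>\<delta>>0. \<forall>u. 0 < u \<and> u < \<delta> \<longrightarrow>
      cmod (\<Psi> (of_real u) - (\<Sum>m<M. g m * of_real u ^ m)) \<le> B * u ^ M"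
    proof (rule exI[of _ B], rule exI[of _ "min \<rho> (exp (- X))"], intro conjI allI impI)
      fix u :: real assume u: "0 < u \<and> u < min \<rho> (exp (- X))"
      define x where "x = - ln u"
      have "ln u < ln (exp (- X))" using u by (subst ln_less_cancel_iff) auto
      then have "X < x" by (simp add: x_def)
      have ux: "u = exp (- x)" using u by (simp add: x_def)
      have "of_real u ^ m = exp (- (of_nat m * complex_of_real x))" for m :: nat
      proof -
        have "complex_of_real u ^ m = exp (- complex_of_real x) ^ m" by (simp add: ux exp_of_real flip: of_real_minus)
        then show ?thesis by (simp add: exp_of_nat_mult[symmetric])
      qed
      moreover have "\<Psi> (of_real u) = H (of_real x)"
        using \<Psi>(2)[of "of_real u"] u by (simp add: \<Phi>_def x_def Ln_of_real)
      moreover have "u ^ M = exp (- (real M * x))" by (simp add: ux exp_of_nat_mult[symmetric])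
      ultimately show "cmod (\<Psi> (of_real u) - (\<Sum>m<M. g m * of_real u ^ m)) \<le> B * u ^ M"
        using BX[OF \<open>X < x\<close>] by simp
    qed (use \<open>0 < \<rho>\<close> in auto)
  qed
  then have "cmod (g m) \<le> C / \<rho> ^ m" using c_le[of m] by simp
  also have "\<dots> = C * exp (real m * R)"
    by (simp add: \<rho>_def exp_of_nat_mult[symmetric] exp_minus field_simps)
  finally show ?thesis .
qed

context gevrey_coeffs
begin

text \<open>The sum of the series in the strip around \<open>\<theta>\<close>, up to errors that are small of order
  \<open>p > K\<close>; by Watson's lemma such sums agree on overlaps of half-width more than \<open>\<pi>/(2p)\<close>.\<close>

definition strip_sum :: "real \<Rightarrow> real \<Rightarrow> real \<Rightarrow> real \<Rightarrow> (complex \<Rightarrow> complex) \<Rightarrow> bool" where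
  "strip_sum K p R \<theta> h \<longleftrightarrow> (\<exists>b>pi / (2 * K). h holomorphic_on half_strip R \<theta> b \<and> small h \<theta> p b)"

text \<open>Both sums are compared with the same partial sum, so their difference is small of order
  p on a strip around the mean of the two centres. Its half-width exceeds \<pi>/(2K) - (\<pi>/K -
  \<pi>/p)/2 = \<pi>/(2p), just what Watson's lemma needs.\<close>

lemma strip_sum_agree:
  assumes "strip_sum K p R \<theta>1 h1" "strip_sum K p R \<theta>2 h2" "0 < K" "0 < p"
    and near: "\<bar>\<theta>1 - \<theta>2\<bar> < pi / K - pi / p"
    and z: "R < Re z" "\<bar>Im z - \<theta>1\<bar> \<le> pi / (2 * K)" "\<bar>Im z - \<theta>2\<bar> \<le> pi / (2 * K)"
  shows "h1 z = h2 z"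
proof -
  obtain b1 where b1: "pi / (2 * K) < b1" "h1 holomorphic_on half_strip R \<theta>1 b1" "small h1 \<theta>1 p b1"
    using assms(1) by (auto simp: strip_sum_def)
  obtain b2 where b2: "pi / (2 * K) < b2" "h2 holomorphic_on half_strip R \<theta>2 b2" "small h2 \<theta>2 p b2"
    using assms(2) by (auto simp: strip_sum_def)
  obtain D1 c1 R1 where 1: "0 \<le> D1" "0 < c1"
    "\<And>z. z \<in> half_strip R1 \<theta>1 b1 \<Longrightarrow> cmod (h1 z - P (nn (Re z)) z) \<le> D1 * exp (- c1 * exp (p * Re z))"
    using b1(3) by (auto simp: small_def)
  obtain D2 c2 R2 where 2: "0 \<le> D2" "0 < c2"
    "\<And>z. z \<in> half_strip R2 \<theta>2 b2 \<Longrightarrow> cmod (h2 z - P (nn (Re z)) z) \<le> D2 * exp (- c2 * exp (p * Re z))"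
    using b2(3) by (auto simp: small_def)
  define b where "b = min b1 b2 - \<bar>\<theta>1 - \<theta>2\<bar> / 2"
  define \<theta> where "\<theta> = (\<theta>1 + \<theta>2) / 2"
  have sub1: "half_strip r \<theta> b \<subseteq> half_strip r \<theta>1 b1" for r
  proof
    fix w assume "w \<in> half_strip r \<theta> b"
    then have w: "r < Re w" "\<bar>Im w - \<theta>\<bar> < b" by (auto simp: half_strip_def)
    have "\<bar>\<theta> - \<theta>1\<bar> = \<bar>\<theta>1 - \<theta>2\<bar> / 2" "b \<le> b1 - \<bar>\<theta>1 - \<theta>2\<bar> / 2"
      unfolding \<theta>_def b_def by (simp_all add: abs_if field_simps)
    then have "\<bar>Im w - \<theta>1\<bar> < b1" using w by linarith
    then show "w \<in> half_strip r \<theta>1 b1" using w by (simp add: half_strip_def)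
  qed
  have sub2: "half_strip r \<theta> b \<subseteq> half_strip r \<theta>2 b2" for r
  proof
    fix w assume "w \<in> half_strip r \<theta> b"
    then have w: "r < Re w" "\<bar>Im w - \<theta>\<bar> < b" by (auto simp: half_strip_def)
    have "\<bar>\<theta> - \<theta>2\<bar> = \<bar>\<theta>1 - \<theta>2\<bar> / 2" "b \<le> b2 - \<bar>\<theta>1 - \<theta>2\<bar> / 2"
      unfolding \<theta>_def b_def by (simp_all add: abs_if field_simps)
    then have "\<bar>Im w - \<theta>2\<bar> < b2" using w by linarith
    then show "w \<in> half_strip r \<theta>2 b2" using w by (simp add: half_strip_def)
  qed
  note sub = sub1 sub2
  have "h1 z - h2 z = 0"
  proof (rule watson[of "\<lambda>z. h1 z - h2 z" R \<theta> b "max R1 R2" "D1 + D2" "min c1 c2" p])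
    show "(\<lambda>z. h1 z - h2 z) holomorphic_on half_strip R \<theta> b"
      using b1(2) b2(2) sub[of R] by (intro holomorphic_on_diff) (rule holomorphic_on_subset; assumption)+
    show "0 < p" "0 < min c1 c2" using assms 1 2 by auto
    define A B where "A = pi / K" and "B = pi / p"
    have AB: "pi / (2 * K) = A / 2" "pi / (2 * p) = B / 2" by (simp_all add: A_def B_def)
    have "\<bar>\<theta>1 - \<theta>2\<bar> < A - B" using near by (simp add: A_def B_def)
    then show "pi / (2 * p) < b" using b1(1) b2(1) unfolding b_def AB by (simp add: min_def field_simps)
    show "z \<in> half_strip R \<theta> b"
    proof -
      have "\<bar>Im z - \<theta>\<bar> + \<bar>\<theta>1 - \<theta>2\<bar> / 2 = max \<bar>Im z - \<theta>1\<bar> \<bar>Im z - \<theta>2\<bar>"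
        unfolding \<theta>_def by (simp add: abs_if max_def field_simps)
      then have "\<bar>Im z - \<theta>\<bar> < b" using z b1(1) b2(1) unfolding b_def by linarith
      then show ?thesis using z by (simp add: half_strip_def)
    qed
    fix z assume z: "z \<in> half_strip R \<theta> b" "max R1 R2 < Re z"
    have "z \<in> half_strip R1 \<theta>1 b1" "z \<in> half_strip R2 \<theta>2 b2"
      using sub[of R] z by (auto simp: half_strip_def)
    then have *: "cmod (h1 z - P (nn (Re z)) z) \<le> D1 * exp (- c1 * exp (p * Re z))"
      "cmod (h2 z - P (nn (Re z)) z) \<le> D2 * exp (- c2 * exp (p * Re z))"
      using 1 2 by auto
    have "D1 * exp (- c1 * exp (p * Re z)) \<le> D1 * exp (- min c1 c2 * exp (p * Re z))"
      "D2 * exp (- c2 * exp (p * Re z)) \<le> D2 * exp (- min c1 c2 * exp (p * Re z))"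
      using 1 2 by (auto intro!: mult_left_mono)
    then have "cmod (h1 z - P (nn (Re z)) z) + cmod (h2 z - P (nn (Re z)) z) \<le> (D1 + D2) * exp (- min c1 c2 * exp (p * Re z))"
      using * by (simp add: algebra_simps)
    moreover have "cmod (h1 z - h2 z) \<le> cmod (h1 z - P (nn (Re z)) z) + cmod (h2 z - P (nn (Re z)) z)"
      by (metis diff_diff_eq2 diff_add_cancel norm_triangle_ineq4)
    ultimately show "cmod (h1 z - h2 z) \<le> (D1 + D2) * exp (- min c1 c2 * exp (p * Re z))" by linarith
  qed
  then show ?thesis by simp
qed

lemma P_periodic: "P n (z + 2 * of_real pi * \<i>) = P n z"
proof -
  have "exp (- (of_nat m * (z + 2 * of_real pi * \<i>))) = exp (- (of_nat m * z))" for m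
  proof -
    have "- (of_nat m * (z + 2 * of_real pi * \<i>)) = - (of_nat m * z) + (of_int (2 * (- int m)) * of_real pi) * \<i>"
      by (simp add: algebra_simps)
    then show ?thesis unfolding exp_eq by (metis of_real_mult of_real_of_int_eq)
  qed
  then show ?thesis by (simp add: P_def)
qed

text \<open>The partial sums are 2\<pi>i-periodic, so a translate of a sum approximates the same
  partial sums. This gives the periodicity of the glued function.\<close>

lemma strip_sum_shift:
  assumes "strip_sum K p R \<theta> h"
  shows "strip_sum K p R (\<theta> - 2 * pi) (\<lambda>z. h (z + 2 * of_real pi * \<i>))"
proof -
  obtain b where b: "pi / (2 * K) < b" "h holomorphic_on half_strip R \<theta> b" "small h \<theta> p b"
    using assms by (auto simp: strip_sum_def)
  have shift: "z + 2 * of_real pi * \<i> \<in> half_strip r \<theta> b" if "z \<in> half_strip r (\<theta> - 2 * pi) b" for z r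
    using that by (auto simp: half_strip_def algebra_simps)
  have "(\<lambda>z. h (z + 2 * of_real pi * \<i>)) holomorphic_on half_strip R (\<theta> - 2 * pi) b"
    by (rule holomorphic_on_compose_gen[of "\<lambda>z. z + 2 * of_real pi * \<i>" _ h "half_strip R \<theta> b", unfolded o_def])
       (use b shift in \<open>auto intro!: holomorphic_intros\<close>)
  moreover obtain D c R' where *: "0 \<le> D" "0 < c" "0 \<le> R'"
    "\<And>z. z \<in> half_strip R' \<theta> b \<Longrightarrow> cmod (h z - P (nn (Re z)) z) \<le> D * exp (- c * exp (p * Re z))"
    using b(3) by (auto simp: small_def)
  have "cmod (h (z + 2 * of_real pi * \<i>) - P (nn (Re z)) z) \<le> D * exp (- c * exp (p * Re z))"
    if "z \<in> half_strip R' (\<theta> - 2 * pi) b" for z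
    using *(4)[OF shift[OF that]] by (simp add: P_periodic)
  then have "small (\<lambda>z. h (z + 2 * of_real pi * \<i>)) (\<theta> - 2 * pi) p b"
    unfolding small_def using * by blast
  ultimately show ?thesis unfolding strip_sum_def using b(1) by blast
qed

text \<open>The free y in the asymptotics encodes Gevrey order 1/K: y = Re z is the choice for
  \<open>small_init\<close>, and a fixed y gives an ordinary expansion of order M. The tolerance
  \<epsilon> means that strips centred only near each direction suffice, which is how singular
  directions are avoided; its bound keeps centres of neighbouring strips closer than \<pi>/K -
  \<pi>/p.\<close>

theorem tauberian_one_variable:
  assumes K: "0 < K" "K < p" "p < \<kappa>" and \<epsilon>: "\<epsilon> < pi / (2 * K) - pi / (2 * p)"
    and sums: "\<And>\<theta>. \<exists>\<theta>' b h. \<bar>\<theta> - \<theta>'\<bar> \<le> \<epsilon> \<and> pi / (2 * K) < b \<and> h holomorphic_on half_strip R \<theta>' b \<and>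
      (\<forall>z\<in>half_strip R \<theta>' b. cmod (h z) \<le> C) \<and>
      (\<exists>\<nu>'>0. \<exists>C'\<ge>0. \<forall>z\<in>half_strip R \<theta>' b. \<forall>M y. real M \<le> \<nu>' * exp (K * y) \<longrightarrow>
         cmod (h z - P M z) \<le> C' * exp (real M * (y - 1 - Re z)))"
  shows "cmod (g m) \<le> C * exp (real m * R)"
proof -
  have "\<exists>\<theta>' h. \<bar>\<theta> - \<theta>'\<bar> \<le> \<epsilon> \<and> strip_sum K p R \<theta>' h \<and>
      (\<forall>z\<in>half_strip R \<theta>' (pi / (2 * K)). cmod (h z) \<le> C) \<and>
      (\<forall>M. \<exists>B. \<forall>z\<in>half_strip R \<theta>' (pi / (2 * K)). cmod (h z - P M z) \<le> B * exp (- (real M * Re z)))" for \<theta>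
  proof -
    obtain \<theta>' b h \<nu>' C' where h: "\<bar>\<theta> - \<theta>'\<bar> \<le> \<epsilon>" "pi / (2 * K) < b" "h holomorphic_on half_strip R \<theta>' b"
      "\<And>z. z \<in> half_strip R \<theta>' b \<Longrightarrow> cmod (h z) \<le> C" "0 < \<nu>'" "0 \<le> C'"
      and as: "\<And>z M y. z \<in> half_strip R \<theta>' b \<Longrightarrow> real M \<le> \<nu>' * exp (K * y) \<Longrightarrow>
         cmod (h z - P M z) \<le> C' * exp (real M * (y - 1 - Re z))"
      using sums[of \<theta>] by blast
    have "small h \<theta>' K b"
    proof (rule small_init[OF \<open>0 < \<nu>'\<close> _ \<open>0 \<le> C'\<close>])
      show "cmod (h z - P M z) \<le> C' * exp (- real M)"
        if "z \<in> half_strip R \<theta>' b" "real M \<le> \<nu>' * exp (K * Re z)" for z M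
        using as[OF that] by simp
    qed (use K in auto)
    then obtain b' where b': "pi / (2 * K) < b'" "b' \<le> b" "small h \<theta>' p b'"
      by (rule small_improve[of h \<theta>' K b R p]) (use h K in auto)
    have "half_strip R \<theta>' b' \<subseteq> half_strip R \<theta>' b" using b' by (auto simp: half_strip_def)
    then have "strip_sum K p R \<theta>' h"
      unfolding strip_sum_def using b' h(3) holomorphic_on_subset by blast
    moreover have sub: "half_strip R \<theta>' (pi / (2 * K)) \<subseteq> half_strip R \<theta>' b" using h by (auto simp: half_strip_def)
    moreover have "\<exists>B. \<forall>z\<in>half_strip R \<theta>' (pi / (2 * K)). cmod (h z - P M z) \<le> B * exp (- (real M * Re z))" for M
    proof -
      \<comment> \<open>With this y the admissible range reaches M + 1, so M is admissible; the
        constant depends on M, which is harmless for an expansion of fixed order.\<close>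
      define y where "y = ln (real (Suc M) / \<nu>') / K"
      have "\<nu>' * exp (K * y) = real (Suc M)" using \<open>0 < \<nu>'\<close> K by (simp add: y_def)
      then have "real M \<le> \<nu>' * exp (K * y)" by simp
      from as[OF _ this] have "cmod (h z - P M z) \<le> C' * exp (real M * (y - 1)) * exp (- (real M * Re z))"
        if "z \<in> half_strip R \<theta>' b" for z
        using that by (simp add: mult_exp_exp algebra_simps)
      then show ?thesis using sub by blast
    qed
    ultimately show ?thesis using h(1,4) by blast
  qed
  then obtain TH HH where TH: "\<And>\<theta>. \<bar>\<theta> - TH \<theta>\<bar> \<le> \<epsilon>" and HH: "\<And>\<theta>. strip_sum K p R (TH \<theta>) (HH \<theta>)"
    and HC: "\<And>\<theta> z. z \<in> half_strip R (TH \<theta>) (pi / (2 * K)) \<Longrightarrow> cmod (HH \<theta> z) \<le> C"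
    and HB: "\<And>\<theta> M. \<exists>B. \<forall>z\<in>half_strip R (TH \<theta>) (pi / (2 * K)). cmod (HH \<theta> z - P M z) \<le> B * exp (- (real M * Re z))"
    by metis
  have \<epsilon>K: "\<epsilon> < pi / (2 * K)" using \<epsilon> K by (smt (verit) divide_pos_pos pi_gt_zero)
  have \<epsilon>2: "2 * \<epsilon> < pi / K - pi / p" using \<epsilon> K by (simp add: field_simps)
  \<comment> \<open>If Im z and Im z0 differ by less than \<gamma>, the chosen centres differ by
    less than \<pi>/K - \<pi>/p, and z still lies within \<pi>/(2K) of the centre chosen for
    z0.\<close>
  define \<gamma> where "\<gamma> = min (pi / K - pi / p - 2 * \<epsilon>) (pi / (2 * K) - \<epsilon>)"
  have \<gamma>: "0 < \<gamma>" "\<gamma> \<le> pi / K - pi / p - 2 * \<epsilon>" "\<gamma> \<le> pi / (2 * K) - \<epsilon>" using \<epsilon>2 \<epsilon>K by (auto simp: \<gamma>_def)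
  define H where "H z = HH (Im z) z" for z
  have H_eq: "H z = h z" if "strip_sum K p R \<theta> h" "R < Re z" "\<bar>TH (Im z) - \<theta>\<bar> < pi / K - pi / p" "\<bar>Im z - \<theta>\<bar> \<le> pi / (2 * K)" for z h \<theta>
    unfolding H_def
  proof (rule strip_sum_agree[OF HH that(1)])
    show "\<bar>Im z - TH (Im z)\<bar> \<le> pi / (2 * K)" using TH[of "Im z"] \<epsilon>K by linarith
  qed (use that K in auto)
  show ?thesis
  proof (rule periodic_coeff_bound[of H R C g m])
    show "H holomorphic_on {z. R < Re z}"
      unfolding holomorphic_on_def
    proof
      fix z0 assume "z0 \<in> {z. R < Re z}"
      then have z0: "R < Re z0" by simp
      define W where "W = half_strip R (Im z0) \<gamma>"
      obtain b where b: "pi / (2 * K) < b" "HH (Im z0) holomorphic_on half_strip R (TH (Im z0)) b"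
        using HH[of "Im z0"] by (auto simp: strip_sum_def)
      have near: "\<bar>TH (Im z) - TH (Im z0)\<bar> < pi / K - pi / p" "\<bar>Im z - TH (Im z0)\<bar> \<le> pi / (2 * K)" "R < Re z"
        if "z \<in> W" for z
        using that TH[of "Im z"] TH[of "Im z0"] \<gamma> unfolding W_def half_strip_def mem_Collect_eq by linarith+
      have "W \<subseteq> half_strip R (TH (Im z0)) b"
      proof
        fix z assume "z \<in> W"
        from near[OF this] b(1) show "z \<in> half_strip R (TH (Im z0)) b"
          unfolding half_strip_def mem_Collect_eq by linarith
      qed
      then have "HH (Im z0) holomorphic_on W" using b(2) holomorphic_on_subset by blast
      then have "H holomorphic_on W"
      proof (rule holomorphic_transform)
        show "HH (Im z0) z = H z" if "z \<in> W" for z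
          using H_eq[OF HH near(3)[OF that] near(1)[OF that] near(2)[OF that]] by simp
      qed
      moreover have "open W" "z0 \<in> W" using open_half_strip z0 \<gamma> by (auto simp: W_def half_strip_def)
      ultimately show "H field_differentiable at z0 within {z. R < Re z}"
        using holomorphic_on_imp_differentiable_at field_differentiable_at_within by blast
    qed
    have in_strip: "z \<in> half_strip R (TH (Im z)) (pi / (2 * K))" if "R < Re z" for z
      using that TH[of "Im z"] \<epsilon>K unfolding half_strip_def mem_Collect_eq by linarith
    then show "cmod (H z) \<le> C" if "R < Re z" for z
      unfolding H_def using that by (intro HC)
    show "H (z + 2 * of_real pi * \<i>) = H z" if "R < Re z" for z
    proof -
      let ?\<theta> = "Im z + 2 * pi"
      \<comment> \<open>The sum selected one period higher, translated back, is a strip sum with a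
        centre near Im z and hence agrees with the sum selected there.\<close>
      have "H z = HH ?\<theta> (z + 2 * of_real pi * \<i>)"
      proof (rule H_eq[where h = "\<lambda>z. HH ?\<theta> (z + 2 * of_real pi * \<i>)"])
        show "strip_sum K p R (TH ?\<theta> - 2 * pi) (\<lambda>z. HH ?\<theta> (z + 2 * of_real pi * \<i>))"
          by (rule strip_sum_shift[OF HH])
        show "\<bar>TH (Im z) - (TH ?\<theta> - 2 * pi)\<bar> < pi / K - pi / p"
          using TH[of "Im z"] TH[of ?\<theta>] \<epsilon>2 by linarith
        show "\<bar>Im z - (TH ?\<theta> - 2 * pi)\<bar> \<le> pi / (2 * K)"
          using TH[of ?\<theta>] \<epsilon>K by linarith
      qed (rule that)
      then show ?thesis by (simp add: H_def)
    qed
    fix M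
    obtain B where B: "\<And>z. z \<in> half_strip R (TH 0) (pi / (2 * K)) \<Longrightarrow> cmod (HH 0 z - P M z) \<le> B * exp (- (real M * Re z))"
      using HB by blast
    have "cmod (H (of_real x) - (\<Sum>m<M. g m * exp (- (of_nat m * of_real x)))) \<le> B * exp (- (real M * x))" if "R < x" for x
      using B[of "of_real x"] in_strip[of "of_real x"] that by (simp add: H_def P_def)
    then show "\<exists>B X. \<forall>x>X. cmod (H (of_real x) - (\<Sum>m<M. g m * exp (- (of_nat m * of_real x)))) \<le> B * exp (- (real M * x))"
      by blast
  qed
qed

end

section \<open>Dominated power series in several variables\<close>

lemma bounded_bilinear_scaleC: "bounded_bilinear ((*\<^sub>C) :: complex \<Rightarrow> 'e::complex_banach \<Rightarrow> 'e)"
proof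
  show "(r *\<^sub>R a) *\<^sub>C b = r *\<^sub>R (a *\<^sub>C b)" for r a and b :: 'e
    by (metis scaleC_of_real scaleC_scaleC scaleR_conv_of_real)
  show "\<exists>K. \<forall>a (b :: 'e). norm (a *\<^sub>C b) \<le> norm a * norm b * K"
    by (intro exI[of _ 1]) (simp add: norm_scaleC)
qed (simp_all add: scaleC_add_left scaleC_add_right scaleC_scaleR)

lemmas bounded_linear_scaleC_right = bounded_bilinear.bounded_linear_right[OF bounded_bilinear_scaleC]
lemmas bounded_linear_scaleC_left = bounded_bilinear.bounded_linear_left[OF bounded_bilinear_scaleC]
lemmas scaleC_zero_right [simp] = bounded_bilinear.zero_right[OF bounded_bilinear_scaleC]
lemmas scaleC_zero_left [simp] = bounded_bilinear.zero_left[OF bounded_bilinear_scaleC]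
lemmas scaleC_diff_right = bounded_bilinear.diff_right[OF bounded_bilinear_scaleC]
lemmas scaleC_sum_right = bounded_bilinear.sum_right[OF bounded_bilinear_scaleC]
lemmas scaleC_sum_left = bounded_bilinear.sum_left[OF bounded_bilinear_scaleC]

section \<open>Multi-indices, boxes and dominated unordered sums\<close>

definition mdeg :: "nat^'d::finite \<Rightarrow> nat" where
  "mdeg \<beta> = (\<Sum>j\<in>UNIV. \<beta> $ j)"

definition rpow :: "('d::finite \<Rightarrow> real) \<Rightarrow> nat^'d \<Rightarrow> real" where
  "rpow \<rho> \<beta> = (\<Prod>j\<in>UNIV. \<rho> j ^ (\<beta> $ j))"

lemma norm_mpow: "cmod (mpow x \<beta>) = rpow (\<lambda>j. cmod (x $ j)) \<beta>"
  by (simp add: mpow_def rpow_def norm_power flip: prod_norm)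

lemma rpow_mono: "(\<And>j. 0 \<le> \<rho> j) \<Longrightarrow> (\<And>j. \<rho> j \<le> \<rho>' j) \<Longrightarrow> rpow \<rho> \<beta> \<le> rpow \<rho>' \<beta>"
  unfolding rpow_def by (intro prod_mono conjI zero_le_power power_mono) auto

lemma rpow_nonneg: "(\<And>j. 0 \<le> \<rho> j) \<Longrightarrow> 0 \<le> rpow \<rho> \<beta>"
  unfolding rpow_def by (intro prod_nonneg) auto

lemma rpow_const: "rpow (\<lambda>_. r) \<beta> = r ^ mdeg \<beta>"
  by (simp add: rpow_def mdeg_def power_sum)

lemma rpow_scale: "rpow (\<lambda>j. t * \<rho> j) \<beta> = t ^ mdeg \<beta> * rpow \<rho> \<beta>"
  by (simp add: rpow_def mdeg_def power_sum power_mult_distrib prod.distrib)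

lemma mpow_add: "mpow x (\<beta> + \<gamma>) = mpow x \<beta> * mpow x \<gamma>"
  by (simp add: mpow_def power_add prod.distrib)

lemma mpow_mult: "mpow x (n *s \<beta>) = mpow x \<beta> ^ n"
  by (simp add: mpow_def prod_power_distrib mult.commute[of n] power_mult)

lemma mdeg_add: "mdeg (\<beta> + \<gamma>) = mdeg \<beta> + mdeg \<gamma>"
  by (simp add: mdeg_def sum.distrib)

lemma mdeg_mult: "mdeg (n *s \<beta>) = n * mdeg \<beta>"
  by (simp add: mdeg_def sum_distrib_left)

lemma mpow_scale: "mpow (c *s x) \<beta> = c ^ mdeg \<beta> * mpow x \<beta>"
  by (simp add: mpow_def mdeg_def power_sum power_mult_distrib prod.distrib)

text \<open>Boxes are used as exhausting finite sets because over a box a sum of products factors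
  into a product of sums, one for each variable.\<close>

definition mbox :: "nat \<Rightarrow> (nat^'d::finite) set" where
  "mbox n = {\<beta>. \<forall>j. \<beta> $ j < n}"

lemma bij_mbox: "bij_betw vec_lambda (PiE UNIV (\<lambda>_. {..<n})) (mbox n)"
  unfolding mbox_def
  by (rule bij_betwI[where g = vec_nth]) (auto simp: PiE_def)

lemma finite_mbox: "finite (mbox n)"
  using bij_betw_finite[OF bij_mbox] by (metis finite_PiE finite finite_lessThan)

lemma sum_mbox_prod:
  fixes f :: "'d::finite \<Rightarrow> nat \<Rightarrow> 'c::comm_semiring_1"
  shows "(\<Sum>\<beta>\<in>mbox n. \<Prod>j\<in>UNIV. f j (\<beta> $ j)) = (\<Prod>j\<in>UNIV. \<Sum>i<n. f j i)"
  by (subst sum.reindex_bij_betw[OF bij_mbox, symmetric]) (simp add: prod_sum_PiE)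

lemma finite_subset_mbox:
  assumes "finite F"
  obtains n where "F \<subseteq> mbox n"
proof -
  have "\<beta> \<in> mbox (Suc (\<Sum>\<beta>\<in>F. mdeg \<beta>))" if "\<beta> \<in> F" for \<beta>
  proof -
    have "\<beta> $ j \<le> mdeg \<beta>" for j unfolding mdeg_def by (intro member_le_sum) auto
    moreover have "mdeg \<beta> \<le> (\<Sum>\<beta>\<in>F. mdeg \<beta>)" using assms that by (intro member_le_sum) auto
    ultimately show ?thesis by (auto simp: mbox_def less_Suc_eq_le intro: order_trans)
  qed
  then show thesis using that by blast
qed

lemma filterlim_mbox: "filterlim (mbox :: nat \<Rightarrow> (nat^'d::finite) set) (finite_subsets_at_top UNIV) sequentially"
  unfolding filterlim_iff
proof (intro allI impI)
  fix Q :: "(nat^'d) set \<Rightarrow> bool" assume "eventually Q (finite_subsets_at_top UNIV)"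
  then obtain X where X: "finite X" "\<And>Y. finite Y \<Longrightarrow> X \<subseteq> Y \<Longrightarrow> Q Y"
    by (auto simp: eventually_finite_subsets_at_top)
  obtain n where "X \<subseteq> mbox n" using finite_subset_mbox X(1) by blast
  then have "Q (mbox m)" if "m \<ge> n" for m
    using that finite_mbox by (intro X(2)) (auto simp: mbox_def subset_iff intro: less_le_trans)
  then show "eventually (\<lambda>n. Q (mbox n)) sequentially" by (auto simp: eventually_sequentially)
qed

lemma has_sum_mbox:
  assumes "(f has_sum s) UNIV"
  shows "(\<lambda>n. sum f (mbox n)) \<longlonglongrightarrow> s"
  using filterlim_compose[OF assms[unfolded has_sum_def] filterlim_mbox] by (simp add: o_def)

text \<open>Over a surrounding box the sum is a product of d partial geometric series, each at most
  2.\<close>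

lemma sum_half_power_le:
  fixes F :: "(nat^'d::finite) set"
  assumes "finite F"
  shows "(\<Sum>\<beta>\<in>F. (1 / 2) ^ mdeg \<beta>) \<le> (2 :: real) ^ CARD('d)"
proof -
  obtain n where n: "F \<subseteq> mbox n" using finite_subset_mbox assms by blast
  have "(\<Sum>\<beta>\<in>F. (1 / 2) ^ mdeg \<beta>) \<le> (\<Sum>\<beta>\<in>mbox n. (1 / 2) ^ mdeg (\<beta> :: nat^'d) :: real)"
    using n finite_mbox by (intro sum_mono2) auto
  also have "\<dots> = (\<Sum>\<beta>\<in>mbox n. \<Prod>j\<in>(UNIV :: 'd set). (1 / 2) ^ (\<beta> $ j))" by (simp add: mdeg_def power_sum)
  also have "\<dots> = (\<Prod>j\<in>(UNIV :: 'd set). \<Sum>i<n. (1 / 2) ^ i)" by (rule sum_mbox_prod)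
  also have "\<dots> \<le> (\<Prod>j\<in>(UNIV :: 'd set). 2)"
  proof (intro prod_mono conjI sum_nonneg)
    have "(\<Sum>i<n. (1 / 2 :: real) ^ i) = 2 - 2 * (1 / 2) ^ n" by (induction n) auto
    then show "(\<Sum>i<n. (1 / 2 :: real) ^ i) \<le> 2" by simp
  qed auto
  finally show ?thesis by simp
qed

lemma half_power_summable: "(\<lambda>\<beta> :: nat^'d::finite. (1 / 2 :: real) ^ mdeg \<beta>) summable_on UNIV"
  by (intro nonneg_bdd_above_summable_on bdd_aboveI[of _ "2 ^ CARD('d)"]) (use sum_half_power_le in auto)

lemma half_power_infsum_le: "infsum (\<lambda>\<beta> :: nat^'d::finite. (1 / 2 :: real) ^ mdeg \<beta>) A \<le> 2 ^ CARD('d)"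
proof -
  have "(\<lambda>\<beta> :: nat^'d. (1 / 2 :: real) ^ mdeg \<beta>) summable_on A"
    using half_power_summable by (rule summable_on_subset_banach) simp
  then show ?thesis by (rule infsum_le_finite_sums) (use sum_half_power_le in auto)
qed

text \<open>The weights (1/2)^|\<beta>| serve as the standard majorant for series over
  multi-indices; the infimum of what is kept is the index set A, so that tails are covered as
  well.\<close>

lemma half_dominated:
  fixes f :: "nat^'d::finite \<Rightarrow> 'e::banach"
  assumes "\<And>\<beta>. \<beta> \<in> A \<Longrightarrow> norm (f \<beta>) \<le> C * (1 / 2) ^ mdeg \<beta>"
  shows "f abs_summable_on A" "f summable_on A"
    and "norm (infsum f A) \<le> C * infsum (\<lambda>\<beta>. (1 / 2) ^ mdeg \<beta>) A"
    and "0 \<le> C \<Longrightarrow> norm (infsum f A) \<le> C * 2 ^ CARD('d)"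
proof -
  have hs: "(\<lambda>\<beta> :: nat^'d. (1 / 2 :: real) ^ mdeg \<beta>) summable_on A"
    using half_power_summable by (rule summable_on_subset_banach) simp
  then have cs: "(\<lambda>\<beta>. C * (1 / 2) ^ mdeg \<beta>) summable_on A" by (rule summable_on_cmult_right)
  then show abs: "f abs_summable_on A"
    by (rule summable_on_comparison_test) (use assms in auto)
  then show "f summable_on A" by (rule abs_summable_summable)
  have "norm (infsum f A) \<le> infsum (\<lambda>\<beta>. norm (f \<beta>)) A" by (rule norm_infsum_bound[OF abs])
  also have "\<dots> \<le> infsum (\<lambda>\<beta>. C * (1 / 2) ^ mdeg \<beta>) A" using abs cs assms by (rule infsum_mono)
  also have "\<dots> = C * infsum (\<lambda>\<beta>. (1 / 2) ^ mdeg \<beta>) A" by (rule infsum_cmult_right')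
  finally show 1: "norm (infsum f A) \<le> C * infsum (\<lambda>\<beta>. (1 / 2) ^ mdeg \<beta>) A" .
  assume "0 \<le> C"
  then have "C * infsum (\<lambda>\<beta> :: nat^'d. (1 / 2) ^ mdeg \<beta>) A \<le> C * 2 ^ CARD('d)"
    by (intro mult_left_mono half_power_infsum_le)
  with 1 show "norm (infsum f A) \<le> C * 2 ^ CARD('d)" by linarith
qed

lemma half_power_tail: "(\<lambda>n. infsum (\<lambda>\<beta> :: nat^'d::finite. (1 / 2 :: real) ^ mdeg \<beta>) (- mbox n)) \<longlonglongrightarrow> 0"
proof -
  let ?t = "\<lambda>\<beta> :: nat^'d. (1 / 2 :: real) ^ mdeg \<beta>"
  have "infsum ?t (- mbox n) = infsum ?t UNIV - sum ?t (mbox n)" for n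
    using infsum_Diff[of ?t UNIV "mbox n"] half_power_summable
    by (simp add: Compl_eq_Diff_UNIV finite_mbox)
  moreover have "(\<lambda>n. infsum ?t UNIV - sum ?t (mbox n)) \<longlonglongrightarrow> infsum ?t UNIV - infsum ?t UNIV"
    using half_power_summable by (intro tendsto_intros has_sum_mbox has_sum_infsum)
  ultimately show ?thesis by simp
qed

section \<open>Termwise complex differentiation\<close>

definition mpow_deriv :: "complex^'d::finite \<Rightarrow> nat^'d \<Rightarrow> complex^'d \<Rightarrow> complex" where
  "mpow_deriv x \<beta> h = (\<Sum>i\<in>UNIV. (of_nat (\<beta> $ i) * h $ i * (x $ i) ^ (\<beta> $ i - 1)) * (\<Prod>j\<in>UNIV - {i}. (x $ j) ^ (\<beta> $ j)))"

lemma has_derivative_mpow: "((\<lambda>x. mpow x \<beta>) has_derivative mpow_deriv x \<beta>) (at x within S)"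
proof -
  have nth: "((\<lambda>x. x $ i) has_derivative (\<lambda>h. h $ i)) (at x within S)" for i
    by (rule bounded_linear_imp_has_derivative) (rule bounded_linear_vec_nth)
  show ?thesis unfolding mpow_def mpow_deriv_def
    by (rule has_derivative_prod has_derivative_power nth)+
qed

text \<open>Differentiation in the i-th variable loses one factor r i, which the lower bound m
  compensates; for \<beta> $ i = 0 the factor \<beta> $ i removes the term, whatever the truncated
  exponent.\<close>

lemma mpow_deriv_le:
  assumes r: "\<And>j. 0 < r j" "\<And>j. cmod (x $ j) \<le> r j" and m: "0 < m" "\<And>j. m \<le> r j"
  shows "cmod (mpow_deriv x \<beta> h) \<le> real (mdeg \<beta>) / m * rpow r \<beta> * norm h"
proof -
  have "cmod ((of_nat (\<beta> $ i) * h $ i * (x $ i) ^ (\<beta> $ i - 1)) * (\<Prod>j\<in>UNIV - {i}. (x $ j) ^ (\<beta> $ j)))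
      \<le> real (\<beta> $ i) * (1 / m * rpow r \<beta> * norm h)" for i
  proof (cases "\<beta> $ i = 0")
    case False
    have "cmod ((of_nat (\<beta> $ i) * h $ i * (x $ i) ^ (\<beta> $ i - 1)) * (\<Prod>j\<in>UNIV - {i}. (x $ j) ^ (\<beta> $ j)))
       = (real (\<beta> $ i) * cmod (h $ i) * cmod (x $ i) ^ (\<beta> $ i - 1)) * (\<Prod>j\<in>UNIV - {i}. cmod (x $ j) ^ (\<beta> $ j))"
      by (simp add: norm_mult norm_power flip: prod_norm)
    also have "\<dots> \<le> (real (\<beta> $ i) * norm h * r i ^ (\<beta> $ i - 1)) * (\<Prod>j\<in>UNIV - {i}. r j ^ (\<beta> $ j))"
      using r by (intro mult_mono power_mono prod_mono conjI mult_nonneg_nonneg prod_nonneg zero_le_power Finite_Cartesian_Product.norm_nth_le) (auto simp: less_imp_le)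
    also have "\<dots> = real (\<beta> $ i) * norm h * (rpow r \<beta> / r i)"
    proof -
      have "rpow r \<beta> = r i ^ (\<beta> $ i) * (\<Prod>j\<in>UNIV - {i}. r j ^ (\<beta> $ j))"
        unfolding rpow_def by (rule prod.remove) auto
      moreover have "r i ^ (\<beta> $ i) = r i ^ (\<beta> $ i - 1) * r i" using False by (metis power_minus_mult neq0_conv)
      ultimately show ?thesis using r(1)[of i] by simp
    qed
    also have "\<dots> \<le> real (\<beta> $ i) * norm h * (rpow r \<beta> / m)"
      using m rpow_nonneg[of r \<beta>] r by (intro mult_left_mono divide_left_mono) (auto simp: less_imp_le)
    finally show ?thesis by (simp add: mult_ac)
  qed simp
  then have "cmod (mpow_deriv x \<beta> h) \<le> (\<Sum>i\<in>UNIV. real (\<beta> $ i) * (1 / m * rpow r \<beta> * norm h))"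
    unfolding mpow_deriv_def by (intro sum_norm_le) auto
  also have "\<dots> = real (mdeg \<beta>) * (1 / m * rpow r \<beta> * norm h)"
    unfolding mdeg_def of_nat_sum by (rule sum_distrib_right[symmetric])
  finally show ?thesis by (simp add: mult_ac)
qed

lemma mpow_deriv_scale: "mpow_deriv x \<beta> (c *s v) = c * mpow_deriv x \<beta> v"
  by (simp add: mpow_deriv_def sum_distrib_left mult_ac)

text \<open>The margin 4 leaves room for the derivative: in (1/4)^|\<beta>| one factor
  (1/2)^|\<beta>| absorbs the degree |\<beta>|, and the other is the standard majorant.\<close>

lemma norm_mpow_scaleC_le:
  assumes "norm (a \<beta>) * rpow \<rho> \<beta> \<le> C" "\<And>j. 4 * cmod (x $ j) \<le> \<rho> j"
  shows "norm (mpow x \<beta> *\<^sub>C a \<beta>) \<le> C * (1 / 4) ^ mdeg \<beta>"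
proof -
  have "4 ^ mdeg \<beta> * cmod (mpow x \<beta>) \<le> rpow \<rho> \<beta>"
    unfolding norm_mpow rpow_scale[symmetric] using assms(2) by (intro rpow_mono) auto
  then have "norm (a \<beta>) * (4 ^ mdeg \<beta> * cmod (mpow x \<beta>)) \<le> C"
    using assms(1) mult_left_mono[OF _ norm_ge_zero[of "a \<beta>"]] order_trans by blast
  then show ?thesis by (simp add: norm_scaleC power_divide field_simps)
qed

lemma quarter_le_half: "(1 / 4 :: real) ^ n \<le> (1 / 2) ^ n"
  by (intro power_mono) auto

lemma dominated_series:
  fixes a :: "('d::finite, 'e::complex_banach) mfps"
  assumes C: "0 \<le> C" "\<And>\<beta>. norm (a \<beta>) * rpow \<rho> \<beta> \<le> C" and x: "\<And>j. 4 * cmod (x $ j) \<le> \<rho> j"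
  shows "(\<lambda>\<beta>. mpow x \<beta> *\<^sub>C a \<beta>) abs_summable_on UNIV"
    and "(\<lambda>\<beta>. mpow x \<beta> *\<^sub>C a \<beta>) summable_on UNIV"
    and "norm (mfps_sum a x) \<le> C * 2 ^ CARD('d)"
proof -
  have "norm (mpow x \<beta> *\<^sub>C a \<beta>) \<le> C * (1 / 2) ^ mdeg \<beta>" for \<beta>
    using norm_mpow_scaleC_le[of a \<beta> \<rho> C x, OF C(2) x] mult_left_mono[OF quarter_le_half[of "mdeg \<beta>"] C(1)]
    by linarith
  then show "(\<lambda>\<beta>. mpow x \<beta> *\<^sub>C a \<beta>) abs_summable_on UNIV" "(\<lambda>\<beta>. mpow x \<beta> *\<^sub>C a \<beta>) summable_on UNIV"
    "norm (mfps_sum a x) \<le> C * 2 ^ CARD('d)"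
    unfolding mfps_sum_def using half_dominated[of UNIV "\<lambda>\<beta>. mpow x \<beta> *\<^sub>C a \<beta>" C] C(1) by auto
qed

text \<open>The derivatives of the partial sums over boxes converge uniformly on a convex open set,
  so limit and derivative may be exchanged; complex homogeneity is inherited term by term.\<close>

lemma dominated_series_differentiable:
  fixes a :: "('d::finite, 'e::complex_banach) mfps"
  assumes C: "0 \<le> C" "\<And>\<beta>. norm (a \<beta>) * rpow \<rho> \<beta> \<le> C" and \<rho>: "\<And>j. 0 < \<rho> j"
    and x0: "\<And>j. 4 * cmod (x0 $ j) < \<rho> j"
  shows "complex_differentiable_at (mfps_sum a) x0"
proof -
  define S where "S = {x :: complex^'d. \<forall>j. 4 * cmod (x $ j) < \<rho> j}"
  have "x0 \<in> S" using x0 by (simp add: S_def)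
  have "open S" "convex S"
  proof -
    have "S = (\<Inter>j. (\<lambda>x. x $ j) -` ball 0 (\<rho> j / 4))" by (auto simp: S_def mult.commute)
    moreover have "convex ((\<lambda>x :: complex^'d. x $ j) -` ball 0 (\<rho> j / 4))" for j
      by (intro convex_linear_vimage convex_ball bounded_linear.linear bounded_linear_vec_nth)
    moreover have "open ((\<lambda>x :: complex^'d. x $ j) -` ball 0 (\<rho> j / 4))" for j
      by (intro open_vimage open_ball continuous_intros)
    ultimately show "open S" "convex S" by (simp_all add: convex_INT open_INT)
  qed
  define m where "m = Min (range \<rho>) / 4"
  have m: "0 < m" "\<And>j. m \<le> \<rho> j / 4" using \<rho> by (auto simp: m_def)
  define g' where "g' x h = (\<Sum>\<^sub>\<infinity>\<beta>. mpow_deriv x \<beta> h *\<^sub>C a \<beta>)" for x h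
  have dbound: "norm (mpow_deriv x \<beta> h *\<^sub>C a \<beta>) \<le> C / m * norm h * (1 / 2) ^ mdeg \<beta>" if "x \<in> S" for x h \<beta>
  proof -
    have "cmod (mpow_deriv x \<beta> h) \<le> real (mdeg \<beta>) / m * rpow (\<lambda>j. 1 / 4 * \<rho> j) \<beta> * norm h"
      using that \<rho> m by (intro mpow_deriv_le) (auto simp: S_def field_simps less_imp_le)
    then have "norm (mpow_deriv x \<beta> h *\<^sub>C a \<beta>) \<le> (real (mdeg \<beta>) / m * ((1 / 4) ^ mdeg \<beta> * rpow \<rho> \<beta>) * norm h) * norm (a \<beta>)"
      unfolding norm_scaleC rpow_scale by (intro mult_right_mono) auto
    also have "\<dots> = (real (mdeg \<beta>) * (1 / 4) ^ mdeg \<beta>) * (norm h / m) * (norm (a \<beta>) * rpow \<rho> \<beta>)" by simp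
    also have "\<dots> \<le> (1 / 2) ^ mdeg \<beta> * (norm h / m) * C"
    proof (intro mult_mono C)
      have "real (mdeg \<beta>) * (1 / 4) ^ mdeg \<beta> \<le> 2 ^ mdeg \<beta> * (1 / 4) ^ mdeg \<beta>"
        using of_nat_less_two_power[of "mdeg \<beta>", where 'a = real] by (intro mult_right_mono) auto
      also have "\<dots> = (1 / 2) ^ mdeg \<beta>" by (simp add: power_mult_distrib[symmetric])
      finally show "real (mdeg \<beta>) * (1 / 4) ^ mdeg \<beta> \<le> (1 / 2) ^ mdeg \<beta>" .
      show "0 \<le> norm (a \<beta>) * rpow \<rho> \<beta>" using \<rho> by (intro mult_nonneg_nonneg rpow_nonneg) (auto simp: less_imp_le)
    qed (use m in auto)
    finally show ?thesis by (simp add: mult_ac)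
  qed
  note dsum = half_dominated[of _ "\<lambda>\<beta>. mpow_deriv x \<beta> h *\<^sub>C a \<beta>" "C / m * norm h" for x h, OF dbound]
  have S_le: "4 * cmod (x $ j) \<le> \<rho> j" if "x \<in> S" for x j using that by (auto simp: S_def less_imp_le)
  have hs: "((\<lambda>\<beta>. mpow x \<beta> *\<^sub>C a \<beta>) has_sum mfps_sum a x) UNIV" if "x \<in> S" for x
    unfolding mfps_sum_def
    by (intro has_sum_infsum dominated_series(2)[of C a \<rho> x, OF C]) (rule S_le[OF that])
  have "\<exists>g. \<forall>x\<in>S. (\<lambda>n. \<Sum>\<beta>\<in>mbox n. mpow x \<beta> *\<^sub>C a \<beta>) \<longlonglongrightarrow> g x \<and> (g has_derivative g' x) (at x within S)"
  proof (rule has_derivative_sequence[where f' = "\<lambda>n x h. \<Sum>\<beta>\<in>mbox n. mpow_deriv x \<beta> h *\<^sub>C a \<beta>"])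
    show "convex S" by fact
    show "((\<lambda>x. \<Sum>\<beta>\<in>mbox n. mpow x \<beta> *\<^sub>C a \<beta>) has_derivative (\<lambda>h. \<Sum>\<beta>\<in>mbox n. mpow_deriv x \<beta> h *\<^sub>C a \<beta>)) (at x within S)" for n x
      by (intro has_derivative_sum bounded_linear.has_derivative[OF bounded_linear_scaleC_left] has_derivative_mpow)
    show "x0 \<in> S" by fact
    show "(\<lambda>n. \<Sum>\<beta>\<in>mbox n. mpow x0 \<beta> *\<^sub>C a \<beta>) \<longlonglongrightarrow> mfps_sum a x0"
      by (rule has_sum_mbox[OF hs[OF \<open>x0 \<in> S\<close>]])
    fix e :: real assume "0 < e"
    have "(\<lambda>n. C / m * infsum (\<lambda>\<beta> :: nat^'d. (1 / 2 :: real) ^ mdeg \<beta>) (- mbox n)) \<longlonglongrightarrow> C / m * 0"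
      by (intro tendsto_intros half_power_tail)
    then have "eventually (\<lambda>n. C / m * infsum (\<lambda>\<beta> :: nat^'d. (1 / 2 :: real) ^ mdeg \<beta>) (- mbox n) < e) sequentially"
      by (rule order_tendstoD) (use \<open>0 < e\<close> in simp)
    then show "\<forall>\<^sub>F n in sequentially. \<forall>x\<in>S. \<forall>h. norm ((\<Sum>\<beta>\<in>mbox n. mpow_deriv x \<beta> h *\<^sub>C a \<beta>) - g' x h) \<le> e * norm h"
    proof eventually_elim
      case (elim n)
      show ?case
      proof (intro ballI allI)
        fix x h assume "x \<in> S"
        let ?f = "\<lambda>\<beta>. mpow_deriv x \<beta> h *\<^sub>C a \<beta>"
        have "infsum ?f (UNIV - mbox n) = g' x h - infsum ?f (mbox n)"
          unfolding g'_def using dsum(2)[OF \<open>x \<in> S\<close>] by (intro infsum_Diff) auto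
        then have "norm (sum ?f (mbox n) - g' x h) = norm (infsum ?f (- mbox n))"
          by (simp add: finite_mbox Compl_eq_Diff_UNIV norm_minus_commute)
        also have "\<dots> \<le> C / m * norm h * infsum (\<lambda>\<beta> :: nat^'d. (1 / 2 :: real) ^ mdeg \<beta>) (- mbox n)"
          by (rule dsum(3)[OF \<open>x \<in> S\<close>])
        also have "\<dots> = (C / m * infsum (\<lambda>\<beta> :: nat^'d. (1 / 2 :: real) ^ mdeg \<beta>) (- mbox n)) * norm h" by simp
        also have "\<dots> \<le> e * norm h" using elim by (intro mult_right_mono) auto
        finally show "norm (sum ?f (mbox n) - g' x h) \<le> e * norm h" .
      qed
    qed
  qed
  then obtain g where g: "\<And>x. x \<in> S \<Longrightarrow> (\<lambda>n. \<Sum>\<beta>\<in>mbox n. mpow x \<beta> *\<^sub>C a \<beta>) \<longlonglongrightarrow> g x"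
    "\<And>x. x \<in> S \<Longrightarrow> (g has_derivative g' x) (at x within S)" by blast
  have "g x = mfps_sum a x" if "x \<in> S" for x
    using LIMSEQ_unique g(1) has_sum_mbox[OF hs] that by blast
  moreover have "(g has_derivative g' x0) (at x0)"
    using g(2)[OF \<open>x0 \<in> S\<close>] \<open>open S\<close> \<open>x0 \<in> S\<close> by (metis at_within_open)
  ultimately have "(mfps_sum a has_derivative g' x0) (at x0)"
    using \<open>open S\<close> \<open>x0 \<in> S\<close> by (metis has_derivative_transform_within_open)
  moreover have "g' x0 (c *s v) = c *\<^sub>C g' x0 v" for c v
  proof -
    have "g' x0 (c *s v) = (\<Sum>\<^sub>\<infinity>\<beta>. c *\<^sub>C (mpow_deriv x0 \<beta> v *\<^sub>C a \<beta>))"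
      by (simp add: g'_def mpow_deriv_scale scaleC_scaleC)
    also have "\<dots> = c *\<^sub>C g' x0 v"
      unfolding g'_def using dsum(2)[OF \<open>x0 \<in> S\<close>]
      by (intro infsumI has_sum_bounded_linear[OF bounded_linear_scaleC_right, unfolded o_def] has_sum_infsum)
    finally show ?thesis .
  qed
  ultimately show ?thesis unfolding complex_differentiable_at_def by blast
qed

text \<open>The radii \<rho> may depend on the point while C may not. This allows domains that are
  unbounded in one variable, as in the definition of \<open>Ohat'\<close>.\<close>

lemma in_bounded_holo_series:
  fixes a :: "('d::finite, 'e::complex_banach) mfps"
  assumes C: "0 \<le> C"
    and U: "\<And>x. x \<in> U \<Longrightarrow> \<exists>\<rho>. (\<forall>j. 4 * cmod (x $ j) < \<rho> j) \<and> (\<forall>\<beta>. norm (a \<beta>) * rpow \<rho> \<beta> \<le> C)"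
  shows "a \<in> bounded_holo_series U" and "\<And>x. x \<in> U \<Longrightarrow> norm (mfps_sum a x) \<le> C * 2 ^ CARD('d)"
proof -
  have *: "(\<lambda>\<beta>. mpow x \<beta> *\<^sub>C a \<beta>) summable_on UNIV \<and> norm (mfps_sum a x) \<le> C * 2 ^ CARD('d) \<and>
      complex_differentiable_at (mfps_sum a) x" if "x \<in> U" for x
  proof -
    have "\<exists>\<rho>. (\<forall>j. 4 * cmod (x $ j) < \<rho> j) \<and> (\<forall>\<beta>. norm (a \<beta>) * rpow \<rho> \<beta> \<le> C)" using U[OF that] .
    then obtain \<rho> where \<rho>: "\<And>j. 4 * cmod (x $ j) < \<rho> j" "\<And>\<beta>. norm (a \<beta>) * rpow \<rho> \<beta> \<le> C" by blast
    have "0 < \<rho> j" for j using \<rho>(1)[of j] by (smt (verit) norm_ge_zero)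
    then show ?thesis
      using dominated_series[of C a \<rho> x] dominated_series_differentiable[of C a \<rho> x] C \<rho> by (auto simp: less_imp_le)
  qed
  then show "norm (mfps_sum a x) \<le> C * 2 ^ CARD('d)" if "x \<in> U" for x using that by blast
  have "bounded (mfps_sum a ` U)" using * by (intro boundedI[of _ "C * 2 ^ CARD('d)"]) auto
  then show "a \<in> bounded_holo_series U"
    unfolding bounded_holo_series_def bounded_holo_def converges_on_def using * by blast
qed

section \<open>Cauchy estimates\<close>

lemma has_sum_finite_sum:
  fixes f :: "'i \<Rightarrow> 'a \<Rightarrow> 'b::topological_comm_monoid_add"
  assumes "finite I" "\<And>i. i \<in> I \<Longrightarrow> (f i has_sum s i) A"
  shows "((\<lambda>x. \<Sum>i\<in>I. f i x) has_sum (\<Sum>i\<in>I. s i)) A"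
  using assms by (induction I rule: finite_induct) (auto intro: has_sum_add)

lemma sum_cis_power:
  assumes "\<bar>k\<bar> < int n" "k \<noteq> 0"
  shows "(\<Sum>l<n. cis (2 * pi * of_int k / of_nat n) ^ l) = 0"
proof -
  have n: "0 < n" using assms by linarith
  let ?w = "cis (2 * pi * of_int k / of_nat n)"
  have "?w \<noteq> 1"
  proof
    assume "?w = 1"
    then have "exp (\<i> * of_real (2 * pi * of_int k / of_nat n)) = 1" by (simp add: cis_conv_exp)
    then obtain m :: int where "2 * pi * of_int k / of_nat n = of_int (2 * m) * pi"
      unfolding exp_eq_1 by auto
    then have "real_of_int k = of_int (m * int n)" using n by (simp add: field_simps)
    then have "k = m * int n" unfolding of_int_eq_iff .
    then show False using assms by (metis abs_mult abs_of_nat dvd_imp_le_int dvd_triv_right not_less abs_of_pos abs_ge_zero)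
  qed
  moreover have "?w ^ n = 1"
  proof -
    have "?w ^ n = cis (2 * pi * of_int k)" using n by (subst Complex.DeMoivre) simp
    then show ?thesis using cis_multiple_2pi[of "of_int k"] by simp
  qed
  ultimately show ?thesis by (simp add: geometric_sum)
qed

text \<open>Averaging \<open>c\<^bsup>-\<beta>\<^esup> \<Sum> b\<^sub>\<gamma> c\<^sup>\<gamma>\<close> over the vectors \<open>c\<close> of \<open>n\<close>-th roots of unity
  keeps only the terms with \<open>\<gamma> \<equiv> \<beta>\<close> modulo \<open>n\<close>.\<close>

lemma cauchy_estimate_torus:
  fixes b :: "('d::finite, 'e::complex_banach) mfps"
  assumes abs: "(\<lambda>\<beta>. norm (b \<beta>)) summable_on UNIV"
    and bound: "\<And>c. (\<And>j. cmod (c $ j) = 1) \<Longrightarrow> norm (mfps_sum b c) \<le> M"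
  shows "norm (b \<beta>) \<le> M"
proof -
  have main: "norm (b \<beta>) \<le> M + infsum (\<lambda>\<gamma>. norm (b \<gamma>)) (- mbox n)" if \<beta>n: "\<beta> \<in> mbox n" and n: "0 < n" for n
  proof -
    define u where "u l = (\<chi> j. cis (2 * pi * real (l $ j) / real n))" for l :: "nat^'d"
    \<comment> \<open>The average of u^\<gamma> times the conjugate of u^\<beta> over all vectors u
      of n-th roots of unity: 1 at \<beta>, 0 elsewhere in the box, and of modulus at most 1
      outside. Aliasing thus costs at most the tail outside the box.\<close>
    define K where "K \<gamma> = (\<Prod>j\<in>UNIV. (\<Sum>i<n. cis (2 * pi * of_int (int (\<gamma> $ j) - int (\<beta> $ j)) / real n) ^ i)) / of_nat n ^ CARD('d)" for \<gamma> :: "nat^'d"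
    have character: "mpow (u l) \<gamma> * cnj (mpow (u l) \<beta>) = (\<Prod>j\<in>UNIV. cis (2 * pi * of_int (int (\<gamma> $ j) - int (\<beta> $ j)) / real n) ^ (l $ j))" for l \<gamma>
    proof -
      have "cis (2 * pi * real i / real n) ^ p * cnj (cis (2 * pi * real i / real n) ^ q) = cis (2 * pi * of_int (int p - int q) / real n) ^ i" for i p q
        by (simp add: Complex.DeMoivre cis_cnj cis_mult algebra_simps add_divide_distrib diff_divide_distrib)
      then show ?thesis by (simp add: mpow_def u_def flip: prod.distrib)
    qed
    have card: "of_nat (card (mbox n :: (nat^'d) set)) = (of_nat n ^ CARD('d) :: complex)"
      using sum_mbox_prod[of "\<lambda>(_::'d) _. 1 :: complex" n] by simp
    have avg: "(\<Sum>l\<in>mbox n. mpow (u l) \<gamma> * cnj (mpow (u l) \<beta>)) / of_nat n ^ CARD('d) = K \<gamma>" for \<gamma>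
      unfolding character K_def by (subst sum_mbox_prod) simp
    have K_le: "cmod (K \<gamma>) \<le> 1" for \<gamma>
    proof -
      have "cmod (\<Sum>l\<in>mbox n. mpow (u l) \<gamma> * cnj (mpow (u l) \<beta>)) \<le> (\<Sum>l\<in>(mbox n :: (nat^'d) set). 1)"
        by (intro sum_norm_le) (simp add: norm_mult norm_mpow u_def rpow_const)
      also have "\<dots> = real n ^ CARD('d)" using sum_mbox_prod[of "\<lambda>(_::'d) _. 1 :: real" n] by simp
      finally show ?thesis unfolding avg[symmetric] using n by (simp add: norm_divide norm_power field_simps)
    qed
    have K\<beta>: "K \<beta> = 1" using n by (simp add: K_def)
    have K0: "K \<gamma> = 0" if \<gamma>: "\<gamma> \<in> mbox n" "\<gamma> \<noteq> \<beta>" for \<gamma>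
    proof -
      obtain j where "\<gamma> $ j \<noteq> \<beta> $ j" using \<gamma>(2) by (auto simp: vec_eq_iff)
      moreover have "\<gamma> $ j < n" "\<beta> $ j < n" using \<gamma>(1) \<beta>n by (auto simp: mbox_def)
      ultimately have "(\<Sum>i<n. cis (2 * pi * of_int (int (\<gamma> $ j) - int (\<beta> $ j)) / real n) ^ i) = 0"
        by (intro sum_cis_power) auto
      then have "(\<Prod>j\<in>UNIV. (\<Sum>i<n. cis (2 * pi * of_int (int (\<gamma> $ j) - int (\<beta> $ j)) / real n) ^ i)) = 0"
        by (intro prod_zero) auto
      then show ?thesis by (simp add: K_def)
    qed
    have hs: "((\<lambda>\<gamma>. mpow c \<gamma> *\<^sub>C b \<gamma>) has_sum mfps_sum b c) UNIV" if "\<And>j. cmod (c $ j) = 1" for c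
      unfolding mfps_sum_def
      by (rule has_sum_infsum, rule abs_summable_summable) (use abs that in \<open>simp add: norm_scaleC norm_mpow rpow_const\<close>)
    have u1: "cmod (u l $ j) = 1" for l j by (simp add: u_def)
    define T where "T = (\<Sum>l\<in>mbox n. cnj (mpow (u l) \<beta>) *\<^sub>C mfps_sum b (u l))"
    have "((\<lambda>\<gamma>. \<Sum>l\<in>mbox n. cnj (mpow (u l) \<beta>) *\<^sub>C (mpow (u l) \<gamma> *\<^sub>C b \<gamma>)) has_sum T) UNIV"
      unfolding T_def
      by (intro has_sum_finite_sum finite_mbox has_sum_bounded_linear[OF bounded_linear_scaleC_right, unfolded o_def] hs u1)
    then have "((\<lambda>\<gamma>. (1 / of_nat n ^ CARD('d)) *\<^sub>C (\<Sum>l\<in>mbox n. cnj (mpow (u l) \<beta>) *\<^sub>C (mpow (u l) \<gamma> *\<^sub>C b \<gamma>))) has_sum (1 / of_nat n ^ CARD('d)) *\<^sub>C T) UNIV"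
      by (rule has_sum_bounded_linear[OF bounded_linear_scaleC_right, unfolded o_def])
    moreover have "(1 / of_nat n ^ CARD('d)) *\<^sub>C (\<Sum>l\<in>mbox n. cnj (mpow (u l) \<beta>) *\<^sub>C (mpow (u l) \<gamma> *\<^sub>C b \<gamma>)) = K \<gamma> *\<^sub>C b \<gamma>" for \<gamma>
      unfolding avg[symmetric] by (simp add: scaleC_scaleC scaleC_sum_left[symmetric] mult.commute)
    ultimately have KT: "((\<lambda>\<gamma>. K \<gamma> *\<^sub>C b \<gamma>) has_sum (1 / of_nat n ^ CARD('d)) *\<^sub>C T) UNIV" by simp
    have "norm T \<le> (\<Sum>l\<in>(mbox n :: (nat^'d) set). M)"
      unfolding T_def using u1 by (intro sum_norm_le) (simp add: norm_scaleC norm_mpow rpow_const bound)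
    also have "\<dots> = real n ^ CARD('d) * M"
      using sum_mbox_prod[of "\<lambda>(_::'d) _. 1 :: real" n] by simp
    finally have TM: "norm ((1 / of_nat n ^ CARD('d) :: complex) *\<^sub>C T) \<le> M"
      using n by (simp add: norm_scaleC norm_divide norm_power field_simps)
    have Kbox: "((\<lambda>\<gamma>. K \<gamma> *\<^sub>C b \<gamma>) has_sum b \<beta>) (mbox n)"
    proof -
      have "(\<Sum>\<gamma>\<in>mbox n. K \<gamma> *\<^sub>C b \<gamma>) = (\<Sum>\<gamma>\<in>{\<beta>}. K \<gamma> *\<^sub>C b \<gamma>)"
        using \<beta>n K0 finite_mbox by (intro sum.mono_neutral_right) auto
      then show ?thesis using K\<beta> finite_mbox by (intro has_sum_finiteI) (simp_all add: scaleC_one)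
    qed
    have "((\<lambda>\<gamma>. K \<gamma> *\<^sub>C b \<gamma>) has_sum ((1 / of_nat n ^ CARD('d)) *\<^sub>C T - b \<beta>)) (UNIV - mbox n)"
      by (rule has_sum_Diff[OF KT Kbox]) simp
    moreover have sb: "(\<lambda>\<gamma>. norm (b \<gamma>)) summable_on (UNIV - mbox n)"
      using abs by (rule summable_on_subset_banach) simp
    have sK: "(\<lambda>\<gamma>. norm (K \<gamma> *\<^sub>C b \<gamma>)) summable_on (UNIV - mbox n)"
      using sb by (rule summable_on_comparison_test) (use K_le in \<open>auto simp: norm_scaleC mult_left_le_one_le\<close>)
    ultimately have "norm ((1 / of_nat n ^ CARD('d)) *\<^sub>C T - b \<beta>) \<le> infsum (\<lambda>\<gamma>. norm (K \<gamma> *\<^sub>C b \<gamma>)) (UNIV - mbox n)"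
      by (intro norm_has_sum_bound[OF has_sum_infsum[OF sK]])
    also have "\<dots> \<le> infsum (\<lambda>\<gamma>. norm (b \<gamma>)) (UNIV - mbox n)"
      using sK sb by (rule infsum_mono) (use K_le in \<open>auto simp: norm_scaleC mult_left_le_one_le\<close>)
    finally have "norm ((1 / of_nat n ^ CARD('d)) *\<^sub>C T - b \<beta>) \<le> infsum (\<lambda>\<gamma>. norm (b \<gamma>)) (- mbox n)"
      by (simp add: Compl_eq_Diff_UNIV)
    then show ?thesis
      using TM norm_triangle_ineq2[of "b \<beta>" "(1 / of_nat n ^ CARD('d)) *\<^sub>C T"] by (simp add: norm_minus_commute)
  qed
  \<comment> \<open>As n grows the aliasing error disappears, because the tails of an absolutely
    summable family tend to 0.\<close>
  have "infsum (\<lambda>\<gamma>. norm (b \<gamma>)) (- mbox n) = infsum (\<lambda>\<gamma>. norm (b \<gamma>)) UNIV - sum (\<lambda>\<gamma>. norm (b \<gamma>)) (mbox n)" for n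
    using infsum_Diff[of "\<lambda>\<gamma>. norm (b \<gamma>)" UNIV "mbox n"] abs
    by (simp add: Compl_eq_Diff_UNIV finite_mbox)
  moreover have "(\<lambda>n. M + (infsum (\<lambda>\<gamma>. norm (b \<gamma>)) UNIV - sum (\<lambda>\<gamma>. norm (b \<gamma>)) (mbox n))) \<longlonglongrightarrow> M + (infsum (\<lambda>\<gamma>. norm (b \<gamma>)) UNIV - infsum (\<lambda>\<gamma>. norm (b \<gamma>)) UNIV)"
    using abs by (intro tendsto_intros has_sum_mbox has_sum_infsum)
  ultimately have lim: "(\<lambda>n. M + infsum (\<lambda>\<gamma>. norm (b \<gamma>)) (- mbox n)) \<longlonglongrightarrow> M" by simp
  obtain N where N: "{\<beta>} \<subseteq> mbox N" using finite_subset_mbox[of "{\<beta>}"] by blast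
  have "\<beta> \<in> mbox n" if "n \<ge> N" for n using N that by (auto simp: mbox_def intro: less_le_trans)
  then have "norm (b \<beta>) \<le> M + infsum (\<lambda>\<gamma>. norm (b \<gamma>)) (- mbox n)" if "n \<ge> Suc N" for n
    using that by (intro main) auto
  then show ?thesis
    by (intro tendsto_lowerbound[OF lim]) (auto simp: eventually_sequentially)
qed

text \<open>Cauchy's criterion: a term outside a suitable finite set is the difference of two finite
  sums that both lie within 1 of the total.\<close>

lemma converges_on_bounded_terms:
  assumes "(f summable_on UNIV)"
  obtains C where "0 \<le> C" "\<And>x. norm (f x :: 'e::banach) \<le> C"
proof -
  have "(sum f \<longlongrightarrow> infsum f UNIV) (finite_subsets_at_top UNIV)"
    using has_sum_infsum[OF assms] by (simp add: has_sum_def)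
  then have "eventually (\<lambda>F. dist (sum f F) (infsum f UNIV) < 1) (finite_subsets_at_top UNIV)"
    by (rule tendstoD) simp
  then obtain X where X: "finite X" "\<And>Y. finite Y \<Longrightarrow> X \<subseteq> Y \<Longrightarrow> dist (sum f Y) (infsum f UNIV) < 1"
    by (auto simp: eventually_finite_subsets_at_top)
  define C where "C = 2 + (\<Sum>x\<in>X. norm (f x))"
  have "norm (f x) \<le> C" for x
  proof (cases "x \<in> X")
    case True
    then have "norm (f x) \<le> (\<Sum>x\<in>X. norm (f x))" using X(1) by (intro member_le_sum) auto
    then show ?thesis by (simp add: C_def)
  next
    case False
    have "dist (sum f (insert x X)) (sum f X) < 2"
      using X(2)[of X] X(2)[of "insert x X"] X(1) dist_triangle2[of "sum f (insert x X)" "sum f X" "infsum f UNIV"] by fastforce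
    then have "norm (f x) < 2" using False X(1) by (simp add: dist_norm)
    moreover have "0 \<le> (\<Sum>x\<in>X. norm (f x))" by (intro sum_nonneg) auto
    ultimately show ?thesis by (simp add: C_def)
  qed
  moreover have "0 \<le> C" unfolding C_def by (intro add_nonneg_nonneg sum_nonneg) auto
  ultimately show thesis using that by blast
qed

text \<open>Convergence at one point with all coordinates r/2 makes the series absolutely convergent
  on the torus of radius r/4, where averaging applies; hence the rate 4/r. Only points with nonzero
  coordinates occur, as sector estimates require.\<close>

lemma cauchy_estimate:
  fixes a :: "('d::finite, 'e::complex_banach) mfps"
  assumes conv: "converges_on a (polydisc r)" and "0 < r"
    and bound: "\<And>x. x \<in> polydisc r \<Longrightarrow> (\<And>j. x $ j \<noteq> 0) \<Longrightarrow> norm (mfps_sum a x) \<le> M"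
  shows "norm (a \<beta>) \<le> M * (4 / r) ^ mdeg \<beta>"
proof -
  define x0 :: "complex^'d" where "x0 = (\<chi> j. of_real (r / 2))"
  have "x0 \<in> polydisc r" using \<open>0 < r\<close> by (simp add: polydisc_def x0_def)
  then have "(\<lambda>\<beta>. mpow x0 \<beta> *\<^sub>C a \<beta>) summable_on UNIV" using conv by (simp add: converges_on_def)
  then obtain C where C: "0 \<le> C" "\<And>\<beta>. norm (mpow x0 \<beta> *\<^sub>C a \<beta>) \<le> C" by (rule converges_on_bounded_terms) blast
  have C': "(r / 2) ^ mdeg \<beta> * norm (a \<beta>) \<le> C" for \<beta>
    using C(2)[of \<beta>] \<open>0 < r\<close> by (simp add: norm_scaleC norm_mpow x0_def rpow_const)
  define b where "b \<beta> = of_real ((r / 4) ^ mdeg \<beta>) *\<^sub>C a \<beta>" for \<beta>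
  have nb: "norm (b \<beta>) = (r / 4) ^ mdeg \<beta> * norm (a \<beta>)" for \<beta>
    using \<open>0 < r\<close> by (simp add: b_def norm_scaleC norm_power)
  have "norm (b \<beta>) \<le> C * (1 / 2) ^ mdeg \<beta>" for \<beta>
  proof -
    have "norm (b \<beta>) = (1 / 2) ^ mdeg \<beta> * ((r / 2) ^ mdeg \<beta> * norm (a \<beta>))"
      unfolding nb by (simp add: power_mult_distrib[symmetric] flip: mult.assoc)
    also have "\<dots> \<le> (1 / 2) ^ mdeg \<beta> * C" by (intro mult_left_mono C') auto
    finally show ?thesis by (simp add: mult.commute)
  qed
  then have "b abs_summable_on UNIV" by (rule half_dominated(1))
  then have "norm (b \<beta>) \<le> M"
  proof (rule cauchy_estimate_torus)
    fix c :: "complex^'d" assume c: "\<And>j. cmod (c $ j) = 1"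
    have "mfps_sum b c = mfps_sum a (of_real (r / 4) *s c)"
      unfolding mfps_sum_def b_def mpow_scale by (simp add: scaleC_scaleC mult.commute)
    moreover have "norm (mfps_sum a (of_real (r / 4) *s c)) \<le> M"
    proof (rule bound)
      show "of_real (r / 4) *s c \<in> polydisc r" using \<open>0 < r\<close> c by (simp add: polydisc_def norm_mult)
      show "(of_real (r / 4) *s c) $ j \<noteq> 0" for j using \<open>0 < r\<close> c[of j] by auto
    qed
    ultimately show "norm (mfps_sum b c) \<le> M" by simp
  qed
  then show ?thesis using \<open>0 < r\<close> by (simp add: nb power_divide field_simps)
qed

section \<open>Partial sums of the decomposition along a monomial\<close>

definition trunc :: "nat^'d::finite \<Rightarrow> nat \<Rightarrow> ('d, 'e::complex_banach) mfps \<Rightarrow> ('d, 'e) mfps" where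
  "trunc \<alpha> N a = (\<lambda>\<beta>. if N *s \<alpha> \<le> \<beta> then 0 else a \<beta>)"

lemma mult_vec_le_mono: "n \<le> m \<Longrightarrow> n *s (\<alpha> :: nat^'d::finite) \<le> m *s \<alpha>"
  by (simp add: less_eq_vec_def)

text \<open>Passing from N to N + 1 adds exactly the monomials divisible by x^(N\<alpha>) but not by
  x^((N+1)\<alpha>), and these form a shifted copy of the N-th component.\<close>

lemma has_sum_trunc:
  fixes a :: "('d::finite, 'e::complex_banach) mfps"
  assumes "\<And>n. (\<lambda>\<beta>. mpow x \<beta> *\<^sub>C mono_coeff \<alpha> a n \<beta>) summable_on UNIV"
  shows "((\<lambda>\<beta>. mpow x \<beta> *\<^sub>C trunc \<alpha> N a \<beta>) has_sum (\<Sum>n<N. mpow x (n *s \<alpha>) *\<^sub>C mfps_sum (mono_coeff \<alpha> a n) x)) UNIV"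
proof (induction N)
  case 0
  have "trunc \<alpha> 0 a = (\<lambda>_. 0)" by (auto simp: trunc_def less_eq_vec_def)
  then show ?case by simp
next
  case (Suc N)
  have "((\<lambda>\<gamma>. mpow x (N *s \<alpha>) *\<^sub>C (mpow x \<gamma> *\<^sub>C mono_coeff \<alpha> a N \<gamma>)) has_sum (mpow x (N *s \<alpha>) *\<^sub>C mfps_sum (mono_coeff \<alpha> a N) x)) UNIV"
    unfolding mfps_sum_def
    by (intro has_sum_bounded_linear[OF bounded_linear_scaleC_right, unfolded o_def] has_sum_infsum assms)
  moreover define g where "g \<beta> = (if N *s \<alpha> \<le> \<beta> \<and> \<not> Suc N *s \<alpha> \<le> \<beta> then mpow x \<beta> *\<^sub>C a \<beta> else 0)" for \<beta>
  have g: "g (N *s \<alpha> + \<gamma>) = mpow x (N *s \<alpha>) *\<^sub>C (mpow x \<gamma> *\<^sub>C mono_coeff \<alpha> a N \<gamma>)" for \<gamma>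
    by (simp add: g_def mono_coeff_def mpow_add scaleC_scaleC less_eq_vec_def)
  ultimately have "((g \<circ> (\<lambda>\<gamma>. N *s \<alpha> + \<gamma>)) has_sum (mpow x (N *s \<alpha>) *\<^sub>C mfps_sum (mono_coeff \<alpha> a N) x)) UNIV"
    by (simp add: o_def)
  then have "(g has_sum (mpow x (N *s \<alpha>) *\<^sub>C mfps_sum (mono_coeff \<alpha> a N) x)) (range (\<lambda>\<gamma>. N *s \<alpha> + \<gamma>))"
    by (subst has_sum_reindex) (auto simp: inj_on_def)
  moreover have "\<beta> \<in> range (\<lambda>\<gamma>. N *s \<alpha> + \<gamma>)" if "g \<beta> \<noteq> 0" for \<beta>
  proof -
    have "N *s \<alpha> \<le> \<beta>" using that by (auto simp: g_def split: if_splits)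
    then have "\<beta> = N *s \<alpha> + (\<chi> j. \<beta> $ j - (N *s \<alpha>) $ j)" by (auto simp: less_eq_vec_def vec_eq_iff)
    then show ?thesis by blast
  qed
  ultimately have "(g has_sum (mpow x (N *s \<alpha>) *\<^sub>C mfps_sum (mono_coeff \<alpha> a N) x)) UNIV"
    by (subst has_sum_cong_neutral[of "range (\<lambda>\<gamma>. N *s \<alpha> + \<gamma>)" UNIV g g]) auto
  from has_sum_add[OF Suc this]
  have "((\<lambda>\<beta>. mpow x \<beta> *\<^sub>C trunc \<alpha> N a \<beta> + g \<beta>) has_sum (\<Sum>n<Suc N. mpow x (n *s \<alpha>) *\<^sub>C mfps_sum (mono_coeff \<alpha> a n) x)) UNIV"
    by simp
  moreover have "mpow x \<beta> *\<^sub>C trunc \<alpha> N a \<beta> + g \<beta> = mpow x \<beta> *\<^sub>C trunc \<alpha> (Suc N) a \<beta>" for \<beta>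
    using order_trans[OF mult_vec_le_mono[of N "Suc N" \<alpha>]] by (auto simp: g_def trunc_def)
  ultimately show ?case by simp
qed

lemma sum_mono_coeffs_eq_trunc:
  fixes a :: "('d::finite, 'e::complex_banach) mfps"
  assumes "\<And>n. mono_coeff \<alpha> a n \<in> bounded_holo_series U" "x \<in> U"
  shows "(\<Sum>n<N. mpow x (n *s \<alpha>) *\<^sub>C mfps_sum (mono_coeff \<alpha> a n) x) = mfps_sum (trunc \<alpha> N a) x"
  unfolding mfps_sum_def[of "trunc \<alpha> N a"]
  using assms by (intro infsumI[symmetric] has_sum_trunc) (auto simp: bounded_holo_series_def converges_on_def)

section \<open>Coefficient growth and sums in a direction\<close>

definition exp_bounded :: "('d::finite, 'e::complex_banach) mfps \<Rightarrow> real \<Rightarrow> real \<Rightarrow> bool" where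
  "exp_bounded a C A \<longleftrightarrow> 0 \<le> C \<and> 1 \<le> A \<and> (\<forall>\<beta>. norm (a \<beta>) \<le> C * A ^ mdeg \<beta>)"

text \<open>The Gevrey condition on the level of coefficients. For s >= 0 and positive \<alpha> the
  sharpest admissible n is the least of the quotients \<beta> $ j div \<alpha> $ j; allowing every
  larger n avoids naming that minimum.\<close>

definition coeff_growth :: "nat^'d::finite \<Rightarrow> real \<Rightarrow> ('d, 'e::complex_banach) mfps \<Rightarrow> bool" where
  "coeff_growth \<alpha> s a \<longleftrightarrow> (\<exists>C\<ge>0. \<exists>A\<ge>1. \<forall>n \<beta>. \<not> Suc n *s \<alpha> \<le> \<beta> \<longrightarrow>
     norm (a \<beta>) \<le> C * A ^ mdeg \<beta> * fact n powr s)"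

lemma exp_boundedD:
  fixes a :: "('d::finite, 'e::complex_banach) mfps"
  assumes "exp_bounded a C A"
  shows "a \<in> bounded_holo_series (polydisc (1 / (4 * A)))"
    and "x \<in> polydisc (1 / (4 * A)) \<Longrightarrow> norm (mfps_sum a x) \<le> C * 2 ^ CARD('d)"
proof -
  have A: "0 \<le> C" "1 \<le> A" "\<And>\<beta>. norm (a \<beta>) \<le> C * A ^ mdeg \<beta>" using assms by (auto simp: exp_bounded_def)
  have "\<exists>\<rho>. (\<forall>j. 4 * cmod (x $ j) < \<rho> j) \<and> (\<forall>\<beta>. norm (a \<beta>) * rpow \<rho> \<beta> \<le> C)" if "x \<in> polydisc (1 / (4 * A))" for x
  proof (intro exI[of _ "\<lambda>_. 1 / A"] conjI allI)
    show "4 * cmod (x $ j) < 1 / A" for j using that A(2) by (simp add: polydisc_def field_simps)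
    show "norm (a \<beta>) * rpow (\<lambda>_. 1 / A) \<beta> \<le> C" for \<beta>
      using A(2) A(3)[of \<beta>] by (simp add: rpow_const power_divide field_simps)
  qed
  note * = in_bounded_holo_series[OF A(1) this]
  show "a \<in> bounded_holo_series (polydisc (1 / (4 * A)))" by (rule *(1))
  show "x \<in> polydisc (1 / (4 * A)) \<Longrightarrow> norm (mfps_sum a x) \<le> C * 2 ^ CARD('d)" by (rule *(2))
qed

lemma bounded_holo_series_mono: "U \<subseteq> V \<Longrightarrow> a \<in> bounded_holo_series V \<Longrightarrow> a \<in> bounded_holo_series U"
  unfolding bounded_holo_series_def bounded_holo_def converges_on_def
  by (auto intro: bounded_subset[OF _ image_mono])

lemma fact_powr_mono: "0 \<le> s \<Longrightarrow> m \<le> n \<Longrightarrow> (fact m :: real) powr s \<le> fact n powr s"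
  by (intro powr_mono2 fact_mono) auto

lemma fact_powr_ge_one: "0 \<le> s \<Longrightarrow> 1 \<le> (fact n :: real) powr s"
  by (intro ge_one_powr_ge_zero fact_ge_1)

lemma growth_index:
  assumes "\<not> Suc n *s (\<alpha> :: nat^'d::finite) \<le> \<beta>"
  obtains m where "m \<le> n" "m *s \<alpha> \<le> \<beta>" "\<not> Suc m *s \<alpha> \<le> \<beta>"
proof -
  define m where "m = (LEAST m. \<not> Suc m *s \<alpha> \<le> \<beta>)"
  have "\<not> Suc m *s \<alpha> \<le> \<beta>" "m \<le> n"
    unfolding m_def using assms by (rule LeastI, intro Least_le) (rule assms)
  moreover have "m *s \<alpha> \<le> \<beta>"
  proof (cases m)
    case (Suc m')
    then have "m' < (LEAST m. \<not> Suc m *s \<alpha> \<le> \<beta>)" by (simp add: m_def)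
    then show ?thesis using not_less_Least Suc by blast
  qed (simp add: less_eq_vec_def)
  ultimately show thesis using that by blast
qed

lemma mdeg_mono: "\<beta> \<le> \<gamma> \<Longrightarrow> mdeg \<beta> \<le> mdeg \<gamma>"
  unfolding mdeg_def less_eq_vec_def by (intro sum_mono) auto

lemma mdeg_pos: "\<forall>j. 0 < (\<alpha> :: nat^'d::finite) $ j \<Longrightarrow> 0 < mdeg \<alpha>"
  unfolding mdeg_def by (subst zero_less_iff_neq_zero) (auto simp: sum_eq_0_iff)

lemma mult_le_mdeg:
  assumes "\<forall>j. 0 < (\<alpha> :: nat^'d::finite) $ j" "m *s \<alpha> \<le> \<beta>"
  shows "m \<le> mdeg \<beta>"
proof -
  have "m * 1 \<le> m * mdeg \<alpha>" using mdeg_pos[OF assms(1)] by (intro mult_le_mono) auto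
  also have "\<dots> \<le> mdeg \<beta>" using mdeg_mono[OF assms(2)] by (simp add: mdeg_mult)
  finally show ?thesis by simp
qed

text \<open>Writing \<beta> = m \<alpha> + \<gamma> with m maximal makes the coefficient one of the
  m-th component, to which Cauchy's estimate applies; B^m is absorbed since m is at most the degree
  of \<beta>.\<close>

lemma coeff_growth_of_components:
  fixes a :: "('d::finite, 'e::complex_banach) mfps"
  assumes \<alpha>: "\<forall>j. 0 < \<alpha> $ j" and "0 \<le> s" "0 < r" "0 \<le> D" "0 \<le> B"
    and conv: "\<And>n. converges_on (mono_coeff \<alpha> a n) (polydisc r)"
    and bound: "\<And>n x. x \<in> polydisc r \<Longrightarrow> (\<And>j. x $ j \<noteq> 0) \<Longrightarrow>
      norm (mfps_sum (mono_coeff \<alpha> a n) x) \<le> D * B ^ n * fact n powr s"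
  shows "coeff_growth \<alpha> s a"
proof -
  define B' where "B' = max 1 \<bar>B\<bar>"
  define E where "E = max 1 (4 / r)"
  have BE: "1 \<le> B'" "1 \<le> E" "\<bar>B\<bar> \<le> B'" "4 / r \<le> E" by (auto simp: B'_def E_def)
  have "norm (a \<beta>) \<le> D * (B' * E) ^ mdeg \<beta> * fact n powr s" if nle: "\<not> Suc n *s \<alpha> \<le> \<beta>" for n \<beta>
  proof -
    obtain m where m: "m \<le> n" "m *s \<alpha> \<le> \<beta>" "\<not> Suc m *s \<alpha> \<le> \<beta>" using growth_index[OF nle] .
    define \<gamma> where "\<gamma> = (\<chi> j. \<beta> $ j - (m *s \<alpha>) $ j)"
    have \<beta>: "\<beta> = m *s \<alpha> + \<gamma>" using m(2) by (simp add: \<gamma>_def vec_eq_iff less_eq_vec_def)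
    have "\<not> \<alpha> \<le> \<gamma>" using m(3) unfolding \<beta> by (simp add: less_eq_vec_def)
    then have "a \<beta> = mono_coeff \<alpha> a m \<gamma>" by (simp add: mono_coeff_def \<beta>)
    also have "norm \<dots> \<le> (D * B ^ m * fact m powr s) * (4 / r) ^ mdeg \<gamma>"
      by (rule cauchy_estimate[OF conv \<open>0 < r\<close> bound])
    also have "\<dots> \<le> (D * B' ^ mdeg \<beta> * fact n powr s) * E ^ mdeg \<beta>"
    proof (intro mult_mono)
      have "B ^ m \<le> \<bar>B\<bar> ^ m" by (simp flip: power_abs)
      also have "\<dots> \<le> B' ^ m" using BE by (intro power_mono) auto
      also have "\<dots> \<le> B' ^ mdeg \<beta>" using BE mult_le_mdeg[OF \<alpha> m(2)] by (intro power_increasing) auto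
      finally show "B ^ m \<le> B' ^ mdeg \<beta>" .
      show "fact m powr s \<le> (fact n :: real) powr s" using assms m by (intro fact_powr_mono)
      have "(4 / r) ^ mdeg \<gamma> \<le> E ^ mdeg \<gamma>" using BE \<open>0 < r\<close> by (intro power_mono) auto
      also have "\<dots> \<le> E ^ mdeg \<beta>" using BE by (intro power_increasing) (auto simp: \<beta> mdeg_add)
      finally show "(4 / r) ^ mdeg \<gamma> \<le> E ^ mdeg \<beta>" .
    qed (use BE assms in auto)
    finally show ?thesis by (simp add: power_mult_distrib mult_ac)
  qed
  moreover have "1 \<le> B' * E" using BE mult_mono[of 1 B' 1 E] by simp
  ultimately show ?thesis unfolding coeff_growth_def using \<open>0 \<le> D\<close> by blast
qed

lemma coeff_growth_gevrey:
  assumes "\<forall>j. 0 < \<alpha> $ j" "0 \<le> s" "gevrey_series s (mono_coeff \<alpha> a)"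
  shows "coeff_growth \<alpha> s a"
proof -
  obtain r B D where "0 < r" "0 < B" "0 < D"
    "\<And>n. mono_coeff \<alpha> a n \<in> bounded_holo_series (polydisc r)"
    "\<And>n x. x \<in> polydisc r \<Longrightarrow> norm (mfps_sum (mono_coeff \<alpha> a n) x) \<le> D * B ^ n * fact n powr s"
    using assms(3) unfolding gevrey_series_def by blast
  then show ?thesis
    using assms by (intro coeff_growth_of_components[of \<alpha> s r D B a]) (auto simp: bounded_holo_series_def)
qed

lemma coeff_growth_mono:
  assumes "coeff_growth \<alpha> s a" "s \<le> s'"
  shows "coeff_growth \<alpha> s' a"
proof -
  obtain C A where *: "0 \<le> C" "1 \<le> A" "\<And>n \<beta>. \<not> Suc n *s \<alpha> \<le> \<beta> \<Longrightarrow> norm (a \<beta>) \<le> C * A ^ mdeg \<beta> * fact n powr s"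
    using assms(1) unfolding coeff_growth_def by blast
  have "norm (a \<beta>) \<le> C * A ^ mdeg \<beta> * fact n powr s'" if "\<not> Suc n *s \<alpha> \<le> \<beta>" for n \<beta>
  proof -
    have "C * A ^ mdeg \<beta> * fact n powr s \<le> C * A ^ mdeg \<beta> * fact n powr s'"
      using assms(2) * by (intro mult_left_mono powr_mono fact_ge_1) auto
    then show ?thesis using *(3)[OF that] by linarith
  qed
  then show ?thesis unfolding coeff_growth_def using * by blast
qed

text \<open>The factorial goes into the constant and the rate A is unaffected, so all components and
  truncations live on one common polydisc.\<close>

lemma coeff_growth_exp_bounded:
  fixes a :: "('d::finite, 'e::complex_banach) mfps"
  assumes "0 \<le> C" "1 \<le> A" "0 \<le> s" and g: "\<And>n \<beta>. \<not> Suc n *s \<alpha> \<le> \<beta> \<Longrightarrow> norm (a \<beta>) \<le> C * A ^ mdeg \<beta> * fact n powr s"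
  shows "exp_bounded (mono_coeff \<alpha> a n) (C * (A ^ mdeg \<alpha>) ^ n * fact n powr s) A"
    and "exp_bounded (trunc \<alpha> n a) (C * fact n powr s) A"
proof -
  have "norm (mono_coeff \<alpha> a n \<beta>) \<le> C * (A ^ mdeg \<alpha>) ^ n * fact n powr s * A ^ mdeg \<beta>" for \<beta>
  proof (cases "\<alpha> \<le> \<beta>")
    case False
    then have "\<not> Suc n *s \<alpha> \<le> n *s \<alpha> + \<beta>" by (simp add: less_eq_vec_def)
    from g[OF this] have "norm (a (n *s \<alpha> + \<beta>)) \<le> C * A ^ (n * mdeg \<alpha> + mdeg \<beta>) * fact n powr s"
      by (simp only: mdeg_add mdeg_mult)
    also have "A ^ (n * mdeg \<alpha> + mdeg \<beta>) = (A ^ mdeg \<alpha>) ^ n * A ^ mdeg \<beta>"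
      by (metis power_add power_mult mult.commute)
    finally show ?thesis using False by (simp add: mono_coeff_def mult_ac)
  qed (use assms in \<open>auto simp: mono_coeff_def\<close>)
  then show "exp_bounded (mono_coeff \<alpha> a n) (C * (A ^ mdeg \<alpha>) ^ n * fact n powr s) A"
    using assms by (auto simp: exp_bounded_def)
  have "norm (trunc \<alpha> n a \<beta>) \<le> C * fact n powr s * A ^ mdeg \<beta>" for \<beta>
  proof (cases "n *s \<alpha> \<le> \<beta>")
    case False
    then have "\<not> Suc n *s \<alpha> \<le> \<beta>" using order_trans[OF mult_vec_le_mono[of n "Suc n" \<alpha>]] by auto
    from g[OF this] show ?thesis using False by (simp add: trunc_def mult_ac)
  qed (use assms in \<open>auto simp: trunc_def\<close>)
  then show "exp_bounded (trunc \<alpha> n a) (C * fact n powr s) A"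
    using assms by (auto simp: exp_bounded_def)
qed

section \<open>Sectors, sums in a direction and finite nets of directions\<close>

definition sector_dom :: "nat^'d::finite \<Rightarrow> real \<Rightarrow> (complex^'d) set" where
  "sector_dom \<alpha> \<rho> = {x. \<forall>j. cmod (x $ j) ^ (\<alpha> $ j) < \<rho>}"

lemma sector_dom_subset_polydisc:
  fixes \<alpha> :: "nat^'d::finite"
  assumes "0 < R" "R \<le> 1"
  shows "sector_dom \<alpha> (R ^ mdeg \<alpha>) \<subseteq> polydisc R"
proof
  fix x :: "complex^'d" assume x: "x \<in> sector_dom \<alpha> (R ^ mdeg \<alpha>)"
  have "cmod (x $ j) < R" for j
  proof (rule ccontr)
    assume "\<not> cmod (x $ j) < R"
    then have "R ^ (\<alpha> $ j) \<le> cmod (x $ j) ^ (\<alpha> $ j)" using assms by (intro power_mono) auto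
    moreover have "\<alpha> $ j \<le> mdeg \<alpha>" unfolding mdeg_def by (intro member_le_sum) auto
    then have "R ^ mdeg \<alpha> \<le> R ^ (\<alpha> $ j)" using assms by (intro power_decreasing) auto
    moreover have "cmod (x $ j) ^ (\<alpha> $ j) < R ^ mdeg \<alpha>" using x by (simp add: sector_dom_def)
    ultimately show False by linarith
  qed
  then show "x \<in> polydisc R" by (simp add: polydisc_def)
qed

lemma polydisc_subset_sector_dom:
  fixes \<alpha> :: "nat^'d::finite"
  assumes "\<forall>j. 0 < \<alpha> $ j" "\<rho> \<le> 1"
  shows "polydisc \<rho> \<subseteq> sector_dom \<alpha> \<rho>"
proof
  fix x :: "complex^'d" assume x: "x \<in> polydisc \<rho>"
  have "cmod (x $ j) ^ (\<alpha> $ j) < \<rho>" for j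
  proof -
    have "cmod (x $ j) < \<rho>" using x by (simp add: polydisc_def)
    moreover have "cmod (x $ j) ^ (\<alpha> $ j) \<le> cmod (x $ j) ^ 1"
      using assms \<open>cmod (x $ j) < \<rho>\<close> by (intro power_decreasing) (auto simp: Suc_leI)
    ultimately show ?thesis by simp
  qed
  then show "x \<in> sector_dom \<alpha> \<rho>" by (simp add: sector_dom_def)
qed

lemma sector_dom_mono: "\<rho> \<le> \<rho>' \<Longrightarrow> sector_dom \<alpha> \<rho> \<subseteq> sector_dom \<alpha> \<rho>'"
  unfolding sector_dom_def by (auto intro: less_le_trans)

lemma mono_sector_mono: "a' \<le> a \<Longrightarrow> b \<le> b' \<Longrightarrow> \<rho> \<le> \<rho>' \<Longrightarrow> mono_sector \<alpha> a b \<rho> \<subseteq> mono_sector \<alpha> a' b' \<rho>'"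
  unfolding mono_sector_def by (auto intro: less_le_trans)

lemma mono_sector_dom: "(x, \<phi>) \<in> mono_sector \<alpha> a b \<rho> \<Longrightarrow> x \<in> sector_dom \<alpha> \<rho>"
  by (auto simp: mono_sector_def sector_dom_def)

lemma holo_on_sector_mono: "S \<subseteq> T \<Longrightarrow> holo_on_sector \<alpha> f T \<Longrightarrow> holo_on_sector \<alpha> f S"
  by (auto simp: holo_on_sector_def)

text \<open>Summability in the direction \<open>\<theta>\<close>, with constants that are uniform on a closed subsector
  which is still wide enough.\<close>

definition dir_sum ::
    "nat^'d::finite \<Rightarrow> real \<Rightarrow> ('d, 'e::complex_banach) mfps \<Rightarrow> real \<Rightarrow> real \<Rightarrow> real \<Rightarrow> real \<Rightarrow> bool" where
  "dir_sum \<alpha> k a \<rho> C A \<theta> \<longleftrightarrow> (\<forall>n. mono_coeff \<alpha> a n \<in> bounded_holo_series (sector_dom \<alpha> \<rho>)) \<and>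
     (\<exists>\<delta>>pi / k. \<exists>f. holo_on_sector \<alpha> f (mono_sector \<alpha> (\<theta> - \<delta> / 2) (\<theta> + \<delta> / 2) \<rho>) \<and>
       (\<forall>(x, \<phi>)\<in>mono_sector \<alpha> (\<theta> - \<delta> / 2) (\<theta> + \<delta> / 2) \<rho>. \<forall>N.
          norm (f (x, \<phi>) - mfps_sum (trunc \<alpha> N a) x) \<le> C * A ^ N * fact N powr (1 / k) * cmod (mpow x \<alpha>) ^ N))"

lemma dir_sum_mono:
  assumes "dir_sum \<alpha> k a \<rho> C A \<theta>" "\<rho>' \<le> \<rho>" "0 \<le> C" "C \<le> C'" "0 \<le> A" "A \<le> A'"
  shows "dir_sum \<alpha> k a \<rho>' C' A' \<theta>"
proof -
  obtain \<delta> f where f: "pi / k < \<delta>" "holo_on_sector \<alpha> f (mono_sector \<alpha> (\<theta> - \<delta> / 2) (\<theta> + \<delta> / 2) \<rho>)"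
    "\<And>x \<phi> N. (x, \<phi>) \<in> mono_sector \<alpha> (\<theta> - \<delta> / 2) (\<theta> + \<delta> / 2) \<rho> \<Longrightarrow>
       norm (f (x, \<phi>) - mfps_sum (trunc \<alpha> N a) x) \<le> C * A ^ N * fact N powr (1 / k) * cmod (mpow x \<alpha>) ^ N"
    using assms(1) unfolding dir_sum_def by blast
  have sub: "mono_sector \<alpha> (\<theta> - \<delta> / 2) (\<theta> + \<delta> / 2) \<rho>' \<subseteq> mono_sector \<alpha> (\<theta> - \<delta> / 2) (\<theta> + \<delta> / 2) \<rho>"
    using assms by (intro mono_sector_mono) auto
  have "norm (f (x, \<phi>) - mfps_sum (trunc \<alpha> N a) x) \<le> C' * A' ^ N * fact N powr (1 / k) * cmod (mpow x \<alpha>) ^ N"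
    if "(x, \<phi>) \<in> mono_sector \<alpha> (\<theta> - \<delta> / 2) (\<theta> + \<delta> / 2) \<rho>'" for x \<phi> N
  proof -
    have "C * A ^ N * fact N powr (1 / k) * cmod (mpow x \<alpha>) ^ N \<le> C' * A' ^ N * fact N powr (1 / k) * cmod (mpow x \<alpha>) ^ N"
      using assms by (intro mult_right_mono mult_mono power_mono) auto
    moreover have "(x, \<phi>) \<in> mono_sector \<alpha> (\<theta> - \<delta> / 2) (\<theta> + \<delta> / 2) \<rho>" using sub that by blast
    ultimately show ?thesis using f(3)[of x \<phi> N] by linarith
  qed
  moreover have "mono_coeff \<alpha> a n \<in> bounded_holo_series (sector_dom \<alpha> \<rho>')" for n
    using assms(1) bounded_holo_series_mono[OF sector_dom_mono[OF \<open>\<rho>' \<le> \<rho>\<close>]] unfolding dir_sum_def by blast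
  ultimately show ?thesis
    unfolding dir_sum_def using f(1) holo_on_sector_mono[OF sub f(2)] by blast
qed

text \<open>The asymptotic relation has uniform constants only on smaller sectors, so the opening is
  reduced to a value still above \<pi>/k and the radius is halved.\<close>

lemma dir_sum_of_summable:
  assumes "mono_summable_dir \<alpha> k a \<theta>" "0 < k"
  obtains \<rho> C A where "0 < \<rho>" "0 \<le> C" "0 \<le> A" "dir_sum \<alpha> k a \<rho> C A \<theta>"
proof -
  obtain \<delta>0 r f where "pi / k < \<delta>0" and "0 < r" and as: "mono_asymp \<alpha> (1 / k) (\<theta> - \<delta>0 / 2) (\<theta> + \<delta>0 / 2) r f a"
    using assms(1) unfolding mono_summable_dir_def by blast
  obtain r' where r': "0 < r'" "r' \<le> r" and
    comp: "\<And>n. mono_coeff \<alpha> a n \<in> bounded_holo_series (sector_dom \<alpha> r')" and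
    est: "\<And>a' b' \<rho>. \<theta> - \<delta>0 / 2 < a' \<Longrightarrow> a' < b' \<Longrightarrow> b' < \<theta> + \<delta>0 / 2 \<Longrightarrow> 0 < \<rho> \<Longrightarrow> \<rho> < r' \<Longrightarrow>
           (\<exists>C>0. \<exists>A>0. \<forall>(x, \<phi>)\<in>mono_sector \<alpha> a' b' \<rho>. \<forall>N.
              norm (f (x, \<phi>) - (\<Sum>n<N. mpow x (n *s \<alpha>) *\<^sub>C mfps_sum (mono_coeff \<alpha> a n) x))
                \<le> C * A ^ N * fact N powr (1 / k) * cmod (mpow x (N *s \<alpha>)))"
    using as unfolding mono_asymp_def sector_dom_def by blast
  obtain \<delta> where \<delta>: "pi / k < \<delta>" "\<delta> < \<delta>0" using \<open>pi / k < \<delta>0\<close> dense by blast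
  have "0 < \<delta>" using \<delta> assms(2) by (smt (verit) divide_pos_pos pi_gt_zero)
  define \<rho> where "\<rho> = r' / 2"
  have \<rho>: "0 < \<rho>" "\<rho> < r'" using r' by (auto simp: \<rho>_def)
  obtain C A where CA: "0 < C" "0 < A" and
    bd: "\<And>x \<phi> N. (x, \<phi>) \<in> mono_sector \<alpha> (\<theta> - \<delta> / 2) (\<theta> + \<delta> / 2) \<rho> \<Longrightarrow>
              norm (f (x, \<phi>) - (\<Sum>n<N. mpow x (n *s \<alpha>) *\<^sub>C mfps_sum (mono_coeff \<alpha> a n) x))
                \<le> C * A ^ N * fact N powr (1 / k) * cmod (mpow x (N *s \<alpha>))"
  proof -
    have "\<theta> - \<delta>0 / 2 < \<theta> - \<delta> / 2" "\<theta> - \<delta> / 2 < \<theta> + \<delta> / 2" "\<theta> + \<delta> / 2 < \<theta> + \<delta>0 / 2"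
      using \<delta> \<open>0 < \<delta>\<close> by auto
    from est[OF this \<rho>] show thesis using that by blast
  qed
  have comp': "mono_coeff \<alpha> a n \<in> bounded_holo_series (sector_dom \<alpha> \<rho>)" for n
    using bounded_holo_series_mono[OF sector_dom_mono comp] \<rho> by (simp add: less_imp_le)
  have "mono_sector \<alpha> (\<theta> - \<delta> / 2) (\<theta> + \<delta> / 2) \<rho> \<subseteq> mono_sector \<alpha> (\<theta> - \<delta>0 / 2) (\<theta> + \<delta>0 / 2) r"
    using \<delta> \<rho> r' by (intro mono_sector_mono) auto
  moreover have "holo_on_sector \<alpha> f (mono_sector \<alpha> (\<theta> - \<delta>0 / 2) (\<theta> + \<delta>0 / 2) r)"
    using as by (simp add: mono_asymp_def)
  ultimately have "holo_on_sector \<alpha> f (mono_sector \<alpha> (\<theta> - \<delta> / 2) (\<theta> + \<delta> / 2) \<rho>)"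
    by (rule holo_on_sector_mono)
  moreover have "norm (f (x, \<phi>) - mfps_sum (trunc \<alpha> N a) x) \<le> C * A ^ N * fact N powr (1 / k) * cmod (mpow x \<alpha>) ^ N"
    if "(x, \<phi>) \<in> mono_sector \<alpha> (\<theta> - \<delta> / 2) (\<theta> + \<delta> / 2) \<rho>" for x \<phi> N
    using bd[OF that, of N] sum_mono_coeffs_eq_trunc[OF comp' mono_sector_dom[OF that], of N]
    by (simp add: mpow_mult norm_power)
  ultimately have "dir_sum \<alpha> k a \<rho> C A \<theta>"
    unfolding dir_sum_def using \<delta>(1) comp' by blast
  then show thesis using that \<rho>(1) CA less_imp_le by blast
qed

lemma summable_of_dir_sum:
  assumes "dir_sum \<alpha> k a \<rho> C A \<theta>" "a \<in> Ohat'" "0 < \<rho>" "0 \<le> C" "0 \<le> A"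
  shows "mono_summable_dir \<alpha> k a \<theta>"
proof -
  \<comment> \<open>The asymptotic relation asks for strictly positive constants.\<close>
  have "dir_sum \<alpha> k a \<rho> (C + 1) (A + 1) \<theta>" by (rule dir_sum_mono[OF assms(1)]) (use assms in auto)
  then obtain \<delta> f where comp: "\<And>n. mono_coeff \<alpha> a n \<in> bounded_holo_series (sector_dom \<alpha> \<rho>)"
    and f: "pi / k < \<delta>" "holo_on_sector \<alpha> f (mono_sector \<alpha> (\<theta> - \<delta> / 2) (\<theta> + \<delta> / 2) \<rho>)"
    "\<And>x \<phi> N. (x, \<phi>) \<in> mono_sector \<alpha> (\<theta> - \<delta> / 2) (\<theta> + \<delta> / 2) \<rho> \<Longrightarrow>
       norm (f (x, \<phi>) - mfps_sum (trunc \<alpha> N a) x) \<le> (C + 1) * (A + 1) ^ N * fact N powr (1 / k) * cmod (mpow x \<alpha>) ^ N"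
    unfolding dir_sum_def by blast
  have "mono_asymp \<alpha> (1 / k) (\<theta> - \<delta> / 2) (\<theta> + \<delta> / 2) \<rho> f a"
    unfolding mono_asymp_def
  proof (intro conjI, goal_cases)
    case 3
    show ?case
  proof (rule exI[of _ \<rho>], intro conjI allI impI)
    show "mono_coeff \<alpha> a n \<in> bounded_holo_series {x. \<forall>j. cmod (x $ j) ^ (\<alpha> $ j) < \<rho>}" for n
      using comp[of n] by (simp add: sector_dom_def)
    fix a' b' \<rho>' assume *: "\<theta> - \<delta> / 2 < a' \<and> a' < b' \<and> b' < \<theta> + \<delta> / 2 \<and> 0 < \<rho>' \<and> \<rho>' < \<rho>"
    have sub: "mono_sector \<alpha> a' b' \<rho>' \<subseteq> mono_sector \<alpha> (\<theta> - \<delta> / 2) (\<theta> + \<delta> / 2) \<rho>"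
      using * by (intro mono_sector_mono) auto
    have "norm (f (x, \<phi>) - (\<Sum>n<N. mpow x (n *s \<alpha>) *\<^sub>C mfps_sum (mono_coeff \<alpha> a n) x))
        \<le> (C + 1) * (A + 1) ^ N * fact N powr (1 / k) * cmod (mpow x (N *s \<alpha>))"
      if "(x, \<phi>) \<in> mono_sector \<alpha> a' b' \<rho>'" for x \<phi> N
    proof -
      have s: "(x, \<phi>) \<in> mono_sector \<alpha> (\<theta> - \<delta> / 2) (\<theta> + \<delta> / 2) \<rho>" using sub that by blast
      show ?thesis
        using f(3)[OF s, of N] sum_mono_coeffs_eq_trunc[OF comp mono_sector_dom[OF s], of N]
        by (simp add: mpow_mult norm_power)
    qed
    then show "\<exists>C>0. \<exists>A>0. \<forall>(x, \<phi>)\<in>mono_sector \<alpha> a' b' \<rho>'. \<forall>N.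
              norm (f (x, \<phi>) - (\<Sum>n<N. mpow x (n *s \<alpha>) *\<^sub>C mfps_sum (mono_coeff \<alpha> a n) x))
                \<le> C * A ^ N * fact N powr (1 / k) * cmod (mpow x (N *s \<alpha>))"
      using assms by (intro exI[of _ "C + 1"] conjI exI[of _ "A + 1"]) auto
  qed (use assms in auto)
  qed (use f assms in auto)
  then show ?thesis unfolding mono_summable_dir_def using f(1) assms by blast
qed

text \<open>The translates of finitely many singular directions are countable, so every interval of
  length \<delta> contains a direction avoiding them; finitely many such intervals cover one
  period.\<close>

lemma finite_net:
  assumes "finite \<Theta>" "0 < \<delta>"
  obtains \<Phi> where "finite \<Phi>" "\<And>\<phi>. \<exists>\<psi>\<in>\<Phi>. \<exists>l::int. \<bar>\<phi> - \<psi> - 2 * pi * of_int l\<bar> < \<delta>"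
    "\<And>\<psi> \<tau> m. \<psi> \<in> \<Phi> \<Longrightarrow> \<tau> \<in> \<Theta> \<Longrightarrow> \<psi> \<noteq> \<tau> + 2 * pi * of_int (m :: int)"
proof -
  define bad where "bad = (\<lambda>(\<tau>, m :: int). \<tau> + 2 * pi * of_int m) ` (\<Theta> \<times> UNIV)"
  have "countable bad" unfolding bad_def using assms(1) by (intro countable_image countable_SIGMA) (auto simp: countable_finite)
  have "\<exists>\<psi>. \<psi> \<in> {real i * \<delta><..<real (Suc i) * \<delta>} \<and> \<psi> \<notin> bad" for i
  proof (rule ccontr)
    assume "\<not> ?thesis"
    then have "{real i * \<delta><..<real (Suc i) * \<delta>} \<subseteq> bad" by blast
    then have "countable {real i * \<delta><..<real (Suc i) * \<delta>}" using \<open>countable bad\<close> countable_subset by blast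
    then show False using uncountable_open_interval[of "real i * \<delta>" "real (Suc i) * \<delta>"] assms(2) by simp
  qed
  then obtain \<psi> where \<psi>: "\<And>i. real i * \<delta> < \<psi> i" "\<And>i. \<psi> i < real (Suc i) * \<delta>" "\<And>i. \<psi> i \<notin> bad"
    by (metis greaterThanLessThan_iff)
  define n where "n = nat \<lceil>2 * pi / \<delta>\<rceil>"
  show thesis
  proof (rule that[of "\<psi> ` {..n}"])
    show "\<psi>' \<noteq> \<tau> + 2 * pi * of_int m" if "\<psi>' \<in> \<psi> ` {..n}" "\<tau> \<in> \<Theta>" for \<psi>' \<tau> and m :: int
    proof
      assume "\<psi>' = \<tau> + 2 * pi * of_int m"
      then have "\<psi>' \<in> bad" unfolding bad_def using that by (intro image_eqI[of _ _ "(\<tau>, m)"]) auto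
      then show False using that \<psi>(3) by auto
    qed
    fix \<phi> :: real
    define l where "l = \<lfloor>\<phi> / (2 * pi)\<rfloor>"
    define t where "t = \<phi> - 2 * pi * of_int l"
    have "of_int l \<le> \<phi> / (2 * pi)" "\<phi> / (2 * pi) < of_int l + 1" unfolding l_def by linarith+
    then have t: "0 \<le> t" "t < 2 * pi" unfolding t_def by (auto simp: field_simps)
    define i where "i = nat \<lfloor>t / \<delta>\<rfloor>"
    have "0 \<le> t / \<delta>" using t assms by simp
    then have "real i \<le> t / \<delta>" "t / \<delta> < real (Suc i)" unfolding i_def by linarith+
    then have ti: "real i * \<delta> \<le> t" "t < real (Suc i) * \<delta>" using assms by (auto simp: field_simps)
    have "t / \<delta> < 2 * pi / \<delta>" using t assms by (simp add: divide_strict_right_mono)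
    then have "i \<le> n" unfolding i_def n_def by (intro nat_mono) linarith
    moreover have "\<bar>\<phi> - \<psi> i - 2 * pi * of_int l\<bar> < \<delta>"
      using \<psi>(1)[of i] \<psi>(2)[of i] ti unfolding t_def by (simp add: algebra_simps abs_less_iff)
    ultimately show "\<exists>\<psi>'\<in>\<psi> ` {..n}. \<exists>l::int. \<bar>\<phi> - \<psi>' - 2 * pi * of_int l\<bar> < \<delta>" by blast
  qed auto
qed

lemma dir_sum_uniform:
  assumes "finite \<Phi>" "0 < k" "\<And>\<psi>. \<psi> \<in> \<Phi> \<Longrightarrow> mono_summable_dir \<alpha> k a \<psi>"
  shows "\<exists>\<rho> C A. 0 < \<rho> \<and> \<rho> \<le> 1 \<and> 0 \<le> C \<and> 1 \<le> A \<and> (\<forall>\<psi>\<in>\<Phi>. dir_sum \<alpha> k a \<rho> C A \<psi>)"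
  using assms(1,3)
proof (induction \<Phi> rule: finite_induct)
  case empty
  show ?case by (intro exI[of _ 1]) auto
next
  case (insert \<psi> \<Phi>)
  then obtain \<rho> C A where 1: "0 < \<rho>" "\<rho> \<le> 1" "0 \<le> C" "1 \<le> A" "\<And>\<psi>. \<psi> \<in> \<Phi> \<Longrightarrow> dir_sum \<alpha> k a \<rho> C A \<psi>" by auto
  have "mono_summable_dir \<alpha> k a \<psi>" using insert by auto
  then obtain \<rho>' C' A' where 2: "0 < \<rho>'" "0 \<le> C'" "0 \<le> A'" "dir_sum \<alpha> k a \<rho>' C' A' \<psi>"
    using dir_sum_of_summable assms(2) by blast
  have "dir_sum \<alpha> k a (min \<rho> \<rho>') (max C C') (max A A') \<psi>'" if "\<psi>' \<in> insert \<psi> \<Phi>" for \<psi>'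
    using that
  proof
    assume "\<psi>' = \<psi>"
    then show ?thesis using 1 2 by (auto intro!: dir_sum_mono[OF 2(4)])
  next
    assume "\<psi>' \<in> \<Phi>"
    show ?thesis by (rule dir_sum_mono[OF 1(5)[OF \<open>\<psi>' \<in> \<Phi>\<close>]]) (use 1 in auto)
  qed
  then show ?case using 1 2 by (intro exI[of _ "min \<rho> \<rho>'"] exI[of _ "max C C'"] exI[of _ "max A A'"]) auto
qed

text \<open>Finiteness of the net yields a single radius and single constants for all its
  directions, and every angle, singular or not, lies within \<delta> of one of them modulo
  2\<pi>.\<close>

lemma summable_net:
  assumes "a \<in> mono_summable \<alpha> k" "0 < k" "0 < \<delta>"
  obtains \<rho> C A where "0 < \<rho>" "\<rho> \<le> 1" "0 \<le> C" "1 \<le> A"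
    "\<And>\<phi>. \<exists>\<psi>. \<exists>l::int. \<bar>\<phi> - \<psi> - 2 * pi * of_int l\<bar> < \<delta> \<and> dir_sum \<alpha> k a \<rho> C A \<psi>"
proof -
  obtain \<Theta> where \<Theta>: "finite \<Theta>" "\<forall>\<theta>. (\<forall>\<tau>\<in>\<Theta>. \<forall>m::int. \<theta> \<noteq> \<tau> + 2 * pi * of_int m) \<longrightarrow> mono_summable_dir \<alpha> k a \<theta>"
    using assms(1) unfolding mono_summable_def mem_Collect_eq by blast
  obtain \<Phi> where \<Phi>: "finite \<Phi>" "\<And>\<phi>. \<exists>\<psi>\<in>\<Phi>. \<exists>l::int. \<bar>\<phi> - \<psi> - 2 * pi * of_int l\<bar> < \<delta>"
    "\<And>\<psi> \<tau> m. \<psi> \<in> \<Phi> \<Longrightarrow> \<tau> \<in> \<Theta> \<Longrightarrow> \<psi> \<noteq> \<tau> + 2 * pi * of_int (m :: int)"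
    by (rule finite_net[OF \<Theta>(1) assms(3)]) (rule that)
  have sd: "mono_summable_dir \<alpha> k a \<psi>" if "\<psi> \<in> \<Phi>" for \<psi>
  proof -
    have "\<forall>\<tau>\<in>\<Theta>. \<forall>m::int. \<psi> \<noteq> \<tau> + 2 * pi * of_int m" using \<Phi>(3)[OF that] by simp
    then show ?thesis using \<Theta>(2)[rule_format, of \<psi>] by simp
  qed
  have "\<exists>\<rho> C A. 0 < \<rho> \<and> \<rho> \<le> 1 \<and> 0 \<le> C \<and> 1 \<le> A \<and> (\<forall>\<psi>\<in>\<Phi>. dir_sum \<alpha> k a \<rho> C A \<psi>)"
    using \<Phi>(1) assms(2) sd by (rule dir_sum_uniform)
  then obtain \<rho> C A where *: "0 < \<rho>" "\<rho> \<le> 1" "0 \<le> C" "1 \<le> A" "\<And>\<psi>. \<psi> \<in> \<Phi> \<Longrightarrow> dir_sum \<alpha> k a \<rho> C A \<psi>" by blast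
  show thesis by (rule that[OF *(1-4)]) (meson \<Phi>(2) *(5))
qed

lemma mono_sector_memI:
  assumes "\<And>j. x $ j \<noteq> 0" "x \<in> sector_dom \<alpha> \<rho>" "mpow x \<alpha> = of_real (cmod (mpow x \<alpha>)) * cis \<phi>" "a < \<phi>" "\<phi> < b"
  shows "(x, \<phi>) \<in> mono_sector \<alpha> a b \<rho>"
  using assms by (auto simp: mono_sector_def sector_dom_def)

lemma cis_shift: "cis (\<phi> - 2 * pi * of_int l) = cis \<phi>"
  by (simp add: cis_divide[symmetric] cis_multiple_2pi)

lemma mpow_nonzero: "(\<And>j. x $ j \<noteq> 0) \<Longrightarrow> mpow x \<beta> \<noteq> 0"
  by (simp add: mpow_def)

lemma norm_mpow_le_one:
  assumes "x \<in> sector_dom \<alpha> \<rho>" "\<rho> \<le> 1"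
  shows "cmod (mpow x \<alpha>) \<le> 1"
  using assms unfolding norm_mpow rpow_def sector_dom_def
  by (intro prod_le_1) (auto intro: less_imp_le less_le_trans)

lemma fact_Suc_powr_le:
  assumes "0 \<le> s"
  shows "(fact (Suc n) :: real) powr s \<le> (2 powr s) ^ n * fact n powr s"
proof -
  have "real (Suc n) \<le> 2 ^ n" using Suc_leI[OF less_exp[of n]] by (metis of_nat_le_iff of_nat_numeral of_nat_power)
  then have "real (Suc n) powr s \<le> (2 ^ n) powr s" using assms by (intro powr_mono2) auto
  also have "\<dots> = (2 powr s) ^ n" by (simp add: powr_realpow[symmetric] powr_powr mult.commute)
  finally have "real (Suc n) powr s * fact n powr s \<le> (2 powr s) ^ n * fact n powr s" by (intro mult_right_mono) auto
  then show ?thesis by (simp add: powr_mult)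
qed

text \<open>With spacing \<pi>/(2k), less than half the opening of each sector, the sectors over the
  net cover every argument of the monomial. The components are thereby bounded at all points with
  nonzero coordinates of a full polydisc, not only in a sector.\<close>

lemma mono_summable_coeff_growth:
  fixes a :: "('d::finite, 'e::complex_banach) mfps"
  assumes "a \<in> mono_summable \<alpha> k" "0 < k" and \<alpha>: "\<forall>j. 0 < \<alpha> $ j"
  shows "coeff_growth \<alpha> (1 / k) a"
proof -
  obtain \<rho> C A where c: "0 < \<rho>" "\<rho> \<le> 1" "0 \<le> C" "1 \<le> A"
    "\<And>\<phi>. \<exists>\<psi>. \<exists>l::int. \<bar>\<phi> - \<psi> - 2 * pi * of_int l\<bar> < pi / (2 * k) \<and> dir_sum \<alpha> k a \<rho> C A \<psi>"
    by (rule summable_net[OF assms(1,2), of "pi / (2 * k)"]) (use assms(2) in simp, rule that)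
  let ?s = "1 / k"
  have sub: "polydisc \<rho> \<subseteq> sector_dom \<alpha> \<rho>" using \<alpha> c(2) by (rule polydisc_subset_sector_dom)
  have comp: "mono_coeff \<alpha> a n \<in> bounded_holo_series (sector_dom \<alpha> \<rho>)" for n
    using c(5) unfolding dir_sum_def by blast
  show ?thesis
  proof (rule coeff_growth_of_components[OF \<alpha>, where r = \<rho> and D = "2 * C * A" and B = "A * 2 powr ?s"])
    show "converges_on (mono_coeff \<alpha> a n) (polydisc \<rho>)" for n
      using bounded_holo_series_mono[OF sub comp] by (simp add: bounded_holo_series_def)
    fix n and x :: "complex^'d" assume x: "x \<in> polydisc \<rho>" "\<And>j. x $ j \<noteq> 0"
    define \<phi> where "\<phi> = Arg (mpow x \<alpha>)"
    obtain \<psi> and l :: int where \<psi>: "\<bar>\<phi> - \<psi> - 2 * pi * of_int l\<bar> < pi / (2 * k)" "dir_sum \<alpha> k a \<rho> C A \<psi>"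
      using c(5) by blast
    then obtain \<delta> f where f: "pi / k < \<delta>"
      "\<And>x \<phi> N. (x, \<phi>) \<in> mono_sector \<alpha> (\<psi> - \<delta> / 2) (\<psi> + \<delta> / 2) \<rho> \<Longrightarrow>
         norm (f (x, \<phi>) - mfps_sum (trunc \<alpha> N a) x) \<le> C * A ^ N * fact N powr ?s * cmod (mpow x \<alpha>) ^ N"
      unfolding dir_sum_def by blast
    have xs: "x \<in> sector_dom \<alpha> \<rho>" using sub x by blast
    let ?t = "cmod (mpow x \<alpha>)"
    have t: "0 < ?t" "?t \<le> 1" using mpow_nonzero[OF x(2)] norm_mpow_le_one[OF xs c(2)] by auto
    have sec: "(x, \<phi> - 2 * pi * of_int l) \<in> mono_sector \<alpha> (\<psi> - \<delta> / 2) (\<psi> + \<delta> / 2) \<rho>"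
    proof (rule mono_sector_memI[OF x(2) xs])
      show "mpow x \<alpha> = of_real ?t * cis (\<phi> - 2 * pi * of_int l)"
        unfolding cis_shift \<phi>_def by (metis rcis_cmod_Arg rcis_def)
      have "pi / (2 * k) < \<delta> / 2" using f(1) assms(2) by (simp add: field_simps)
      then show "\<psi> - \<delta> / 2 < \<phi> - 2 * pi * of_int l" "\<phi> - 2 * pi * of_int l < \<psi> + \<delta> / 2"
        using \<psi>(1) by linarith+
    qed
    let ?y = "f (x, \<phi> - 2 * pi * of_int l)"
    \<comment> \<open>The n-th component is the difference of two consecutive truncations, each
      close to the same value of f.\<close>
    have "mpow x (n *s \<alpha>) *\<^sub>C mfps_sum (mono_coeff \<alpha> a n) x = mfps_sum (trunc \<alpha> (Suc n) a) x - mfps_sum (trunc \<alpha> n a) x"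
      unfolding sum_mono_coeffs_eq_trunc[OF comp xs, symmetric] by simp
    also have "\<dots> = (?y - mfps_sum (trunc \<alpha> n a) x) - (?y - mfps_sum (trunc \<alpha> (Suc n) a) x)" by simp
    finally have "?t ^ n * norm (mfps_sum (mono_coeff \<alpha> a n) x) \<le>
        norm (?y - mfps_sum (trunc \<alpha> n a) x) + norm (?y - mfps_sum (trunc \<alpha> (Suc n) a) x)"
      by (metis norm_triangle_ineq4 norm_scaleC mpow_mult norm_power)
    also have "\<dots> \<le> C * A ^ n * fact n powr ?s * ?t ^ n + C * A ^ Suc n * fact (Suc n) powr ?s * ?t ^ Suc n"
      by (intro add_mono f(2)[OF sec])
    also have "\<dots> \<le> C * A ^ Suc n * fact (Suc n) powr ?s * ?t ^ n + C * A ^ Suc n * fact (Suc n) powr ?s * ?t ^ n"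
      using c t assms(2) fact_powr_mono[of ?s n "Suc n"]
      by (intro add_mono mult_mono mult_nonneg_nonneg power_increasing power_decreasing) auto
    also have "\<dots> = ?t ^ n * (2 * C * A ^ Suc n * fact (Suc n) powr ?s)" by simp
    finally have "norm (mfps_sum (mono_coeff \<alpha> a n) x) \<le> 2 * C * A ^ Suc n * fact (Suc n) powr ?s"
      using t by simp
    also have "\<dots> \<le> 2 * C * A ^ Suc n * ((2 powr ?s) ^ n * fact n powr ?s)"
      using c assms(2) by (intro mult_left_mono fact_Suc_powr_le) auto
    finally show "norm (mfps_sum (mono_coeff \<alpha> a n) x) \<le> 2 * C * A * (A * 2 powr ?s) ^ n * fact n powr ?s"
      by (simp add: power_mult_distrib mult_ac)
  qed (use c assms in auto)
qed

section \<open>Restriction to monomial curves\<close>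

text \<open>Translation of a factorial bound into the exponential form used in one variable: the
  factorial is at most m^(m/W), and on the admissible range ln m is bounded linearly in y.\<close>

lemma gevrey_bound_exp:
  fixes A s :: real and W :: nat
  assumes "0 < s" "0 < W" "1 \<le> A"
  obtains \<nu> where "0 < \<nu>" "\<And>m y. real m \<le> \<nu> * exp (real W / s * y) \<Longrightarrow>
    A ^ m * fact (m div W) powr s \<le> exp (real m * (y - 1))"
proof -
  \<comment> \<open>Chosen so that \<nu> e^(W y / s) = exp ((W/s) (y - 1 - ln A)), which makes A^m
    m^(s m / W) at most e^(m (y - 1)).\<close>
  define \<nu> where "\<nu> = exp (- (1 + ln A) * (real W / s))"
  have "A ^ m * fact (m div W) powr s \<le> exp (real m * (y - 1))" if my: "real m \<le> \<nu> * exp (real W / s * y)" for m y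
  proof (cases "m = 0")
    case False
    define n where "n = m div W"
    have n: "n \<le> m" "real n \<le> real m / real W" using of_nat_div_le_of_nat[of m W, where 'a = real] by (auto simp: n_def)
    have lnm: "0 \<le> ln (real m)" using False by simp
    have "ln (real m) \<le> ln (\<nu> * exp (real W / s * y))" using my False by (subst ln_le_cancel_iff) (auto simp: \<nu>_def)
    also have "\<dots> = - (1 + ln A) * (real W / s) + real W / s * y" by (simp add: \<nu>_def ln_mult)
    finally have lm: "ln (real m) \<le> (y - 1 - ln A) * (real W / s)" by (simp add: algebra_simps add_divide_distrib)
    have "(fact n :: real) \<le> real n ^ n" using fact_le_power[of n, where 'a = real] by (simp add: of_nat_power)
    also have "\<dots> \<le> real m ^ n" using n by (intro power_mono) auto
    finally have "fact n powr s \<le> (real m ^ n) powr s" using assms by (intro powr_mono2) auto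
    also have "\<dots> = exp (real n * (s * ln (real m)))" using False by (simp add: powr_def ln_realpow)
    also have "\<dots> \<le> exp (real m / real W * (s * ln (real m)))"
      unfolding exp_le_cancel_iff using n lnm assms by (intro mult_right_mono) auto
    also have "\<dots> \<le> exp (real m / real W * (s * ((y - 1 - ln A) * (real W / s))))"
      unfolding exp_le_cancel_iff using lm assms by (intro mult_left_mono) auto
    also have "real m / real W * (s * ((y - 1 - ln A) * (real W / s))) = real m * (y - 1) - real m * ln A"
      using assms by (simp add: field_simps)
    finally have "fact n powr s \<le> exp (real m * (y - 1)) * exp (- (real m * ln A))" by (simp add: exp_add[symmetric])
    moreover have "A ^ m = exp (real m * ln A)" using assms by (simp add: exp_of_nat_mult)
    ultimately have "A ^ m * fact n powr s \<le> exp (real m * ln A) * (exp (real m * (y - 1)) * exp (- (real m * ln A)))"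
      by simp
    also have "\<dots> = exp (real m * (y - 1))" by (simp add: exp_add[symmetric])
    finally show ?thesis by (simp add: n_def)
  qed simp
  then show thesis using that[of \<nu>] by (simp add: \<nu>_def)
qed

definition wdot :: "nat^'d::finite \<Rightarrow> nat^'d \<Rightarrow> nat" where
  "wdot w \<beta> = (\<Sum>j\<in>UNIV. w $ j * \<beta> $ j)"

lemma wdot_mult: "wdot w (n *s \<beta>) = n * wdot w \<beta>"
  by (simp add: wdot_def sum_distrib_left mult_ac)

lemma wdot_mono: "\<beta> \<le> \<gamma> \<Longrightarrow> wdot w \<beta> \<le> wdot w \<gamma>"
  unfolding wdot_def less_eq_vec_def by (intro sum_mono) auto

lemma mdeg_le_wdot: "\<forall>j. 0 < w $ j \<Longrightarrow> mdeg \<beta> \<le> wdot w \<beta>"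
  unfolding mdeg_def wdot_def by (intro sum_mono) (auto simp: Suc_leI)

lemma wdot_le_mdeg: "wdot w \<beta> \<le> mdeg w * mdeg \<beta>"
proof -
  have "wdot w \<beta> \<le> (\<Sum>j\<in>UNIV. mdeg w * \<beta> $ j)"
    unfolding wdot_def by (intro sum_mono mult_right_mono) (auto simp: mdeg_def member_le_sum)
  then show ?thesis by (simp add: mdeg_def sum_distrib_left)
qed

lemma wdot_pos: "\<forall>j. 0 < w $ j \<Longrightarrow> \<forall>j. 0 < \<alpha> $ j \<Longrightarrow> 0 < wdot w \<alpha>"
  using mdeg_pos[of \<alpha>] mdeg_le_wdot[of w \<alpha>] by (meson less_le_trans)

text \<open>Pairing with w is monotone, so the quotient of weighted degrees is an admissible index n
  in \<open>coeff_growth\<close>; this turns the condition for \<alpha> into one for the weighted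
  degree.\<close>

lemma not_Suc_div_wdot_le: "0 < wdot w \<alpha> \<Longrightarrow> \<not> Suc (wdot w \<beta> div wdot w \<alpha>) *s \<alpha> \<le> \<beta>"
proof
  assume "0 < wdot w \<alpha>" "Suc (wdot w \<beta> div wdot w \<alpha>) *s \<alpha> \<le> \<beta>"
  then have "Suc (wdot w \<beta> div wdot w \<alpha>) * wdot w \<alpha> \<le> wdot w \<beta>"
    by (metis wdot_mono wdot_mult)
  moreover have "wdot w \<beta> < Suc (wdot w \<beta> div wdot w \<alpha>) * wdot w \<alpha>"
    using \<open>0 < wdot w \<alpha>\<close> by (metis dividend_less_div_times mult_Suc)
  ultimately show False by simp
qed

lemma finite_wdot_less: "\<forall>j. 0 < w $ j \<Longrightarrow> finite {\<beta> :: nat^'d::finite. wdot w \<beta> < M}"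
proof (rule finite_subset[OF _ finite_mbox[of M]])
  assume w: "\<forall>j. 0 < w $ j"
  have "\<beta> $ j \<le> mdeg \<beta>" for \<beta> :: "nat^'d" and j unfolding mdeg_def by (intro member_le_sum) auto
  then show "{\<beta> :: nat^'d. wdot w \<beta> < M} \<subseteq> mbox M"
    using mdeg_le_wdot[OF w] unfolding mbox_def by (blast intro: le_less_trans order_trans)
qed

lemma finite_wdot_eq: "\<forall>j. 0 < w $ j \<Longrightarrow> finite {\<beta> :: nat^'d::finite. wdot w \<beta> = m}"
  by (rule finite_subset[OF _ finite_wdot_less[of w "Suc m"]]) auto

lemma clinear_contractionD:
  assumes "clinear_contraction L"
  shows "L (x + y) = L x + L y" "L (c *\<^sub>C x) = c * L x" "cmod (L x) \<le> norm x" "bounded_linear L"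
proof -
  show 1: "L (x + y) = L x + L y" "L (c *\<^sub>C x) = c * L x" "cmod (L x) \<le> norm x" for x y c
    using assms by (auto simp: clinear_contraction_def)
  have "L (r *\<^sub>R x) = r *\<^sub>R L x" for r x using 1(2)[of "of_real r" x] by (simp add: scaleC_of_real scaleR_conv_of_real)
  then show "bounded_linear L" using 1 by (intro bounded_linear_intro[of _ 1]) auto
qed

text \<open>The homogeneous component of weighted degree \<open>m\<close>, evaluated at \<open>c\<close> and composed with \<open>L\<close>:
  the coefficient of \<open>u\<^sup>m\<close> of the series \<open>L \<circ> f\<close> on the curve \<open>x\<^sub>j = c\<^sub>j u\<^bsup>w\<^sub>j\<^esup>\<close>.\<close>

definition curve_coeff ::
    "('e::complex_banach \<Rightarrow> complex) \<Rightarrow> complex^'d::finite \<Rightarrow> nat^'d \<Rightarrow> ('d, 'e) mfps \<Rightarrow> nat \<Rightarrow> complex" where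
  "curve_coeff L c w a m = L (\<Sum>\<beta> | wdot w \<beta> = m. mpow c \<beta> *\<^sub>C a \<beta>)"

text \<open>Doubling the rate A frees a factor (1/2)^|\<beta>|, so that summing over all monomials
  of weighted degree m costs only 2^d. The bound does not involve c or L.\<close>

lemma curve_coeff_bound:
  fixes a :: "('d::finite, 'e::complex_banach) mfps"
  assumes w: "\<forall>j. 0 < w $ j" and \<alpha>: "\<forall>j. 0 < \<alpha> $ j" and L: "clinear_contraction L"
    and c: "\<And>j. cmod (c $ j) = 1" and C: "0 \<le> C" "1 \<le> A"
    and growth: "\<And>n \<beta>. \<not> Suc n *s \<alpha> \<le> \<beta> \<Longrightarrow> norm (a \<beta>) \<le> C * A ^ mdeg \<beta> * fact n powr s"
  shows "cmod (curve_coeff L c w a m) \<le> C * 2 ^ CARD('d) * ((2 * A) ^ m * fact (m div wdot w \<alpha>) powr s)"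
proof -
  define F where "F = {\<beta>. wdot w \<beta> = m}"
  have fin: "finite F" unfolding F_def by (rule finite_wdot_eq[OF w])
  have a_le: "norm (a \<beta>) \<le> C * (2 * A) ^ m * fact (m div wdot w \<alpha>) powr s * (1 / 2) ^ mdeg \<beta>" if "\<beta> \<in> F" for \<beta>
  proof -
    have m: "wdot w \<beta> = m" using that by (simp add: F_def)
    then have md: "mdeg \<beta> \<le> m" using mdeg_le_wdot[OF w, of \<beta>] by simp
    have "norm (a \<beta>) \<le> C * A ^ mdeg \<beta> * fact (m div wdot w \<alpha>) powr s"
      using growth[OF not_Suc_div_wdot_le[OF wdot_pos[OF w \<alpha>], of \<beta>]] by (simp add: m)
    also have "\<dots> \<le> C * ((2 * A) ^ m * (1 / 2) ^ mdeg \<beta>) * fact (m div wdot w \<alpha>) powr s"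
    proof (intro mult_right_mono mult_left_mono C)
      have "A ^ mdeg \<beta> = (2 * A * (1 / 2)) ^ mdeg \<beta>" by simp
      also have "\<dots> = (2 * A) ^ mdeg \<beta> * (1 / 2) ^ mdeg \<beta>" by (rule power_mult_distrib)
      also have "\<dots> \<le> (2 * A) ^ m * (1 / 2) ^ mdeg \<beta>"
        using C md by (intro mult_right_mono power_increasing) auto
      finally show "A ^ mdeg \<beta> \<le> (2 * A) ^ m * (1 / 2) ^ mdeg \<beta>" .
    qed simp
    finally show ?thesis by (simp only: mult_ac)
  qed
  have "cmod (curve_coeff L c w a m) \<le> norm (\<Sum>\<beta>\<in>F. mpow c \<beta> *\<^sub>C a \<beta>)"
    unfolding curve_coeff_def F_def by (rule clinear_contractionD(3)[OF L])
  also have "\<dots> \<le> (\<Sum>\<beta>\<in>F. C * (2 * A) ^ m * fact (m div wdot w \<alpha>) powr s * (1 / 2) ^ mdeg \<beta>)"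
    using a_le c by (intro sum_norm_le) (simp add: norm_scaleC norm_mpow rpow_const)
  also have "\<dots> = C * (2 * A) ^ m * fact (m div wdot w \<alpha>) powr s * (\<Sum>\<beta>\<in>F. (1 / 2) ^ mdeg \<beta>)"
    by (simp only: sum_distrib_left)
  also have "\<dots> \<le> C * (2 * A) ^ m * fact (m div wdot w \<alpha>) powr s * 2 ^ CARD('d)"
    using C fin by (intro mult_left_mono sum_half_power_le) auto
  finally show ?thesis by (simp only: mult_ac)
qed

definition curve :: "nat^'d::finite \<Rightarrow> complex^'d \<Rightarrow> complex \<Rightarrow> complex^'d" where
  "curve w c z = (\<chi> j. c $ j * exp (- (of_nat (w $ j) * z)))"

lemma mpow_curve: "mpow (curve w c z) \<beta> = mpow c \<beta> * exp (- (of_nat (wdot w \<beta>) * z))"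
proof -
  have "mpow (curve w c z) \<beta> = mpow c \<beta> * (\<Prod>j\<in>UNIV. exp (- (of_nat (w $ j) * z)) ^ (\<beta> $ j))"
    by (simp add: mpow_def curve_def power_mult_distrib prod.distrib)
  also have "(\<Prod>j\<in>UNIV. exp (- (of_nat (w $ j) * z)) ^ (\<beta> $ j)) = exp (\<Sum>j\<in>UNIV. of_nat (\<beta> $ j) * - (of_nat (w $ j) * z))"
    by (simp only: exp_of_nat_mult exp_sum[OF finite])
  also have "(\<Sum>j\<in>UNIV. of_nat (\<beta> $ j) * - (of_nat (w $ j) * z)) = - (of_nat (wdot w \<beta>) * z)"
    by (simp add: wdot_def sum_distrib_left sum_distrib_right sum_negf mult_ac)
  finally show ?thesis .
qed

lemma norm_curve: "cmod (c $ j) = 1 \<Longrightarrow> cmod (curve w c z $ j) = exp (- (real (w $ j) * Re z))"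
  by (simp add: curve_def norm_mult)

lemma bounded_linear_axis: "bounded_linear (axis j :: complex \<Rightarrow> complex^'d::finite)"
proof (rule bounded_linear_intro[of _ 1])
  show "norm (axis j x :: complex^'d) \<le> norm x * 1" for x :: complex
  proof -
    have "norm (axis j x :: complex^'d) \<le> (\<Sum>i\<in>UNIV. norm (axis j x $ i :: complex))"
      unfolding norm_vec_def by (rule L2_set_le_sum) auto
    also have "\<dots> = (\<Sum>i\<in>UNIV. if i = j then norm x else 0)" by (intro sum.cong) (auto simp: axis_def)
    finally show ?thesis by simp
  qed
qed (auto simp: vec_eq_iff axis_def)

lemma has_derivative_curve:
  "(curve w c has_derivative (\<lambda>h. h *s (\<chi> j. - (of_nat (w $ j)) * curve w c z $ j))) (at z)"
proof -
  have eq: "curve w c = (\<lambda>z. \<Sum>j\<in>UNIV. axis j (c $ j * exp (- (of_nat (w $ j) * z))))"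
    by (rule ext) (simp add: curve_def vec_eq_iff axis_def sum.delta if_distrib cong: if_cong)
  have "((\<lambda>z. c $ j * exp (- (of_nat (w $ j) * z))) has_field_derivative (- (of_nat (w $ j)) * curve w c z $ j)) (at z)" for j
    by (auto intro!: derivative_eq_intros simp: curve_def)
  then have "((\<lambda>z. c $ j * exp (- (of_nat (w $ j) * z))) has_derivative (\<lambda>h. (- (of_nat (w $ j)) * curve w c z $ j) * h)) (at z)" for j
    unfolding has_field_derivative_def .
  then have "((\<lambda>z. \<Sum>j\<in>UNIV. axis j (c $ j * exp (- (of_nat (w $ j) * z)))) has_derivative
      (\<lambda>h. \<Sum>j\<in>UNIV. axis j ((- (of_nat (w $ j)) * curve w c z $ j) * h))) (at z)"
    by (intro has_derivative_sum bounded_linear.has_derivative[OF bounded_linear_axis])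
  moreover have "(\<Sum>j\<in>UNIV. axis j ((- (of_nat (w $ j)) * curve w c z $ j) * h)) = h *s (\<chi> j. - (of_nat (w $ j)) * curve w c z $ j)" for h
    by (simp add: vec_eq_iff axis_def sum.delta if_distrib mult_ac cong: if_cong)
  ultimately show ?thesis unfolding eq by simp
qed

text \<open>In the chart used by \<^const>\<open>holo_on_sector\<close> the argument of the monomial along the curve is
  the affine function \<open>\<omega> - \<langle>w,\<alpha>\<rangle> Im z\<close>.\<close>

lemma holomorphic_along_curve:
  fixes f :: "(complex^'d::finite) \<times> real \<Rightarrow> 'e::complex_banach"
  assumes f: "holo_on_sector \<alpha> f S" and L: "clinear_contraction L"
    and c: "\<And>j. cmod (c $ j) = 1" and "open T"
    and S: "\<And>z. z \<in> T \<Longrightarrow> (curve w c z, \<omega> - real (wdot w \<alpha>) * Im z) \<in> S"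
  shows "(\<lambda>z. L (f (curve w c z, \<omega> - real (wdot w \<alpha>) * Im z))) holomorphic_on T"
  unfolding holomorphic_on_def
proof
  fix z0 assume z0: "z0 \<in> T"
  define W where "W = wdot w \<alpha>"
  define x0 where "x0 = curve w c z0"
  define \<phi>0 where "\<phi>0 = \<omega> - real W * Im z0"
  define F where "F x = f (x, \<phi>0 + Arg (mpow x \<alpha> / mpow x0 \<alpha>))" for x
  have "complex_differentiable_at F x0"
    using f S[OF z0] unfolding holo_on_sector_def F_def x0_def \<phi>0_def W_def by fast
  then obtain D where D: "(F has_derivative D) (at x0)" "\<And>c v. D (c *s v) = c *\<^sub>C D v"
    unfolding complex_differentiable_at_def by blast
  let ?v = "\<chi> j. - (of_nat (w $ j)) * curve w c z0 $ j"
  have "((\<lambda>z. F (curve w c z)) has_derivative (\<lambda>h. D (h *s ?v))) (at z0)"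
    by (rule has_derivative_compose[OF has_derivative_curve]) (use D(1) in \<open>simp add: x0_def\<close>)
  then have "((\<lambda>z. L (F (curve w c z))) has_derivative (\<lambda>h. L (D (h *s ?v)))) (at z0)"
    by (rule bounded_linear.has_derivative[OF clinear_contractionD(4)[OF L]])
  moreover have "(\<lambda>h. L (D (h *s ?v))) = (*) (L (D ?v))"
    by (auto simp: D(2) clinear_contractionD(2)[OF L] mult.commute)
  ultimately have der: "((\<lambda>z. L (F (curve w c z))) has_field_derivative L (D ?v)) (at z0)"
    by (simp add: has_field_derivative_def)
  \<comment> \<open>The region where the argument relative to x0 stays in the principal range, so
    that \<open>Arg\<close> follows the affine function.\<close>
  define U where "U = T \<inter> {z. \<bar>real W * (Im z - Im z0)\<bar> < pi}"
  have "open U" unfolding U_def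
    by (intro open_Int \<open>open T\<close> open_Collect_less continuous_intros)
  have "z0 \<in> U" using z0 by (simp add: U_def)
  have "L (F (curve w c z)) = L (f (curve w c z, \<omega> - real (wdot w \<alpha>) * Im z))" if "z \<in> U" for z
  proof -
    have nz: "mpow c \<alpha> \<noteq> 0" using c by (intro mpow_nonzero) (metis norm_zero zero_neq_one)
    have "mpow (curve w c z) \<alpha> / mpow x0 \<alpha> = exp (- (of_nat W * (z - z0)))"
      using nz by (simp add: x0_def mpow_curve W_def exp_diff[symmetric] algebra_simps)
    also have "\<dots> = rcis (exp (- (real W * (Re z - Re z0)))) (- (real W * (Im z - Im z0)))"
      by (simp add: exp_eq_polar rcis_def)
    finally have "Arg (mpow (curve w c z) \<alpha> / mpow x0 \<alpha>) = - (real W * (Im z - Im z0))"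
      using that by (simp add: U_def Arg_rcis abs_less_iff)
    then have "\<phi>0 + Arg (mpow (curve w c z) \<alpha> / mpow x0 \<alpha>) = \<phi>0 - real W * (Im z - Im z0)" by simp
    also have "\<dots> = \<omega> - real (wdot w \<alpha>) * Im z" unfolding \<phi>0_def W_def by (simp add: algebra_simps)
    finally show ?thesis unfolding F_def by simp
  qed
  from has_field_derivative_transform_within_open[OF der \<open>open U\<close> \<open>z0 \<in> U\<close> this]
  show "(\<lambda>z. L (f (curve w c z, \<omega> - real (wdot w \<alpha>) * Im z))) field_differentiable at z0 within T"
    unfolding field_differentiable_def using has_field_derivative_at_within by blast
qed

text \<open>Since M <= N \<langle>w,\<alpha>\<rangle>, the truncation leaves all monomials of
  weighted degree below M untouched, and they form the partial sum along the curve. The others are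
  dominated because Re z > R and A e^-R <= 1/2.\<close>

lemma curve_truncation:
  fixes a :: "('d::finite, 'e::complex_banach) mfps"
  assumes w: "\<forall>j. 0 < w $ j" and L: "clinear_contraction L" and c: "\<And>j. cmod (c $ j) = 1"
    and C: "0 \<le> C" "1 \<le> A" "0 \<le> s"
    and growth: "\<And>n \<beta>. \<not> Suc n *s \<alpha> \<le> \<beta> \<Longrightarrow> norm (a \<beta>) \<le> C * A ^ mdeg \<beta> * fact n powr s"
    and R: "0 \<le> R" "2 * A \<le> exp R" "R < Re z" and NM: "M \<le> N * wdot w \<alpha>"
  shows "cmod (L (mfps_sum (trunc \<alpha> N a) (curve w c z)) - (\<Sum>m<M. curve_coeff L c w a m * exp (- (of_nat m * z))))
    \<le> C * 2 ^ CARD('d) * fact N powr s * exp R ^ M * exp (- (real M * Re z))"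
proof -
  define x where "x = curve w c z"
  define f where "f \<beta> = mpow x \<beta> *\<^sub>C trunc \<alpha> N a \<beta>" for \<beta>
  define B where "B = {\<beta> :: nat^'d. wdot w \<beta> < M}"
  have finB: "finite B" unfolding B_def by (rule finite_wdot_less[OF w])
  have nx: "cmod (mpow x \<beta>) = exp (- (real (wdot w \<beta>) * Re z))" for \<beta>
    using c by (simp add: x_def mpow_curve norm_mult norm_mpow[of c] rpow_const)
  have bound: "norm (f \<beta>) \<le> (C * fact N powr s * exp R ^ M' * exp (- (real M' * Re z))) * (1 / 2) ^ mdeg \<beta>"
    if "M' \<le> wdot w \<beta>" for M' \<beta>
  proof -
    let ?d = "real (wdot w \<beta>)"
    have "norm (trunc \<alpha> N a \<beta>) \<le> C * fact N powr s * A ^ mdeg \<beta>"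
      using coeff_growth_exp_bounded(2)[OF C growth] by (auto simp: exp_bounded_def)
    then have "norm (f \<beta>) \<le> exp (- (?d * Re z)) * (C * fact N powr s * A ^ mdeg \<beta>)"
      unfolding f_def norm_scaleC nx by (intro mult_left_mono) auto
    also have "\<dots> \<le> (exp (real M' * R) * exp (- (real M' * Re z)) * exp (- (real (mdeg \<beta>) * R))) * (C * fact N powr s * A ^ mdeg \<beta>)"
    proof (intro mult_right_mono)
      \<comment> \<open>Weighted degree in excess of M' is evaluated at R instead of Re z, which
        gives a factor e^-R for each unit of ordinary degree, to be used against A.\<close>
      have "0 \<le> (?d - real M') * (Re z - R)" using that R by (intro mult_nonneg_nonneg) auto
      moreover have "real (mdeg \<beta>) * R \<le> ?d * R" using R mdeg_le_wdot[OF w, of \<beta>] by (intro mult_right_mono) auto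
      ultimately have "- (?d * Re z) \<le> real M' * R + - (real M' * Re z) + - (real (mdeg \<beta>) * R)"
        by (simp add: algebra_simps)
      then show "exp (- (?d * Re z)) \<le> exp (real M' * R) * exp (- (real M' * Re z)) * exp (- (real (mdeg \<beta>) * R))"
        by (simp add: exp_add[symmetric])
    qed (use C in auto)
    also have "\<dots> = (C * fact N powr s * exp R ^ M' * exp (- (real M' * Re z))) * (A * exp (- R)) ^ mdeg \<beta>"
    proof -
      have "exp (- (real (mdeg \<beta>) * R)) = exp (- R) ^ mdeg \<beta>" "exp (real M' * R) = exp R ^ M'"
        by (simp_all add: exp_of_nat_mult[symmetric])
      then show ?thesis by (simp add: power_mult_distrib mult_ac)
    qed
    also have "\<dots> \<le> (C * fact N powr s * exp R ^ M' * exp (- (real M' * Re z))) * (1 / 2) ^ mdeg \<beta>"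
      using C R(2) by (intro mult_left_mono power_mono) (auto simp: exp_minus field_simps)
    finally show ?thesis .
  qed
  have "f summable_on UNIV" by (rule half_dominated(2)) (rule bound[of 0], simp)
  then have "infsum f (UNIV - B) = infsum f UNIV - infsum f B"
    by (intro infsum_Diff) (use finB in auto)
  then have split: "mfps_sum (trunc \<alpha> N a) x - sum f B = infsum f (UNIV - B)"
    using finB by (simp add: mfps_sum_def f_def[abs_def])
  have "sum f B = (\<Sum>\<beta>\<in>B. mpow x \<beta> *\<^sub>C a \<beta>)"
  proof (intro sum.cong refl)
    fix \<beta> assume "\<beta> \<in> B"
    then have "\<not> N *s \<alpha> \<le> \<beta>" using wdot_mono[of "N *s \<alpha>" \<beta> w] NM by (auto simp: B_def wdot_mult)
    then show "f \<beta> = mpow x \<beta> *\<^sub>C a \<beta>" by (simp add: f_def trunc_def)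
  qed
  also have "\<dots> = (\<Sum>m<M. \<Sum>\<beta>\<in>{\<beta> \<in> B. wdot w \<beta> = m}. mpow x \<beta> *\<^sub>C a \<beta>)"
    using finB by (intro sum.group[symmetric]) (auto simp: B_def)
  also have "\<dots> = (\<Sum>m<M. exp (- (of_nat m * z)) *\<^sub>C (\<Sum>\<beta> | wdot w \<beta> = m. mpow c \<beta> *\<^sub>C a \<beta>))"
    unfolding scaleC_sum_right
    by (intro sum.cong) (auto simp: B_def x_def mpow_curve scaleC_scaleC mult.commute)
  finally have "L (sum f B) = (\<Sum>m<M. L (exp (- (of_nat m * z)) *\<^sub>C (\<Sum>\<beta> | wdot w \<beta> = m. mpow c \<beta> *\<^sub>C a \<beta>)))"
    by (simp add: linear_sum[OF bounded_linear.linear[OF clinear_contractionD(4)[OF L]]])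
  also have "\<dots> = (\<Sum>m<M. curve_coeff L c w a m * exp (- (of_nat m * z)))"
    by (simp add: clinear_contractionD(2)[OF L] curve_coeff_def mult.commute)
  finally have "L (mfps_sum (trunc \<alpha> N a) x) - (\<Sum>m<M. curve_coeff L c w a m * exp (- (of_nat m * z))) = L (infsum f (UNIV - B))"
    by (metis split linear_diff[OF bounded_linear.linear[OF clinear_contractionD(4)[OF L]]])
  also have "cmod \<dots> \<le> norm (infsum f (UNIV - B))" by (rule clinear_contractionD(3)[OF L])
  also have "\<dots> \<le> (C * fact N powr s * exp R ^ M * exp (- (real M * Re z))) * 2 ^ CARD('d)"
    by (rule half_dominated(4)) (use bound[of M] C in \<open>auto simp: B_def\<close>)
  finally show ?thesis by (simp add: x_def mult_ac)
qed

text \<open>Each curve and functional is treated by \<open>tauberian_one_variable\<close>. All radii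
  and constants in its conclusion are fixed before c and L, so the bounds for the curve coefficients
  can be averaged over the torus.\<close>

theorem exp_bounded_of_summable:
  fixes a :: "('d::finite, 'e::complex_banach) mfps"
  assumes w: "\<forall>j. 0 < w $ j" and \<alpha>: "\<forall>j. 0 < \<alpha> $ j" and \<alpha>': "\<forall>j. 0 < \<alpha>' $ j"
    and k: "0 < k" and s: "0 < s" and summ: "a \<in> mono_summable \<alpha> k" and gr: "coeff_growth \<alpha>' s a"
    and less: "k * real (wdot w \<alpha>) < real (wdot w \<alpha>') / s"
  obtains C A where "exp_bounded a C A"
proof -
  define W W' where "W = wdot w \<alpha>" and "W' = wdot w \<alpha>'"
  have W: "0 < W" "0 < W'" using wdot_pos[OF w] \<alpha> \<alpha>' by (auto simp: W_def W'_def)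
  define K where "K = k * real W"
  have K: "0 < K" using k W by (simp add: K_def)
  obtain p where p: "K < p" "p < real W' / s" using dense less unfolding K_def W_def W'_def by blast
  define \<epsilon> where "\<epsilon> = (pi / (2 * K) - pi / (2 * p)) / 2"
  have \<epsilon>: "0 < \<epsilon>" "\<epsilon> < pi / (2 * K) - pi / (2 * p)"
  proof -
    have "pi / (2 * p) < pi / (2 * K)" using K p by (intro divide_strict_left_mono) auto
    then show "0 < \<epsilon>" "\<epsilon> < pi / (2 * K) - pi / (2 * p)" by (auto simp: \<epsilon>_def)
  qed
  \<comment> \<open>Summability itself supplies this first growth bound, used for truncations along
    the curve; the second one, of order s, supplies the coefficient hypothesis in one
    variable.\<close>
  obtain C1 A1 where C1: "0 \<le> C1" "1 \<le> A1"
    "\<And>n \<beta>. \<not> Suc n *s \<alpha> \<le> \<beta> \<Longrightarrow> norm (a \<beta>) \<le> C1 * A1 ^ mdeg \<beta> * fact n powr (1 / k)"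
    using mono_summable_coeff_growth[OF summ k \<alpha>] unfolding coeff_growth_def by blast
  obtain C2 A2 where C2: "0 \<le> C2" "1 \<le> A2"
    "\<And>n \<beta>. \<not> Suc n *s \<alpha>' \<le> \<beta> \<Longrightarrow> norm (a \<beta>) \<le> C2 * A2 ^ mdeg \<beta> * fact n powr s"
    using gr unfolding coeff_growth_def by blast
  \<comment> \<open>Along the curve the argument of the monomial changes W times as fast as Im z, so
    angular spacing W \<epsilon> becomes the tolerance \<epsilon> for strips.\<close>
  obtain \<rho> C A where net: "0 < \<rho>" "\<rho> \<le> 1" "0 \<le> C" "1 \<le> A"
    "\<And>\<phi>. \<exists>\<psi>. \<exists>l::int. \<bar>\<phi> - \<psi> - 2 * pi * of_int l\<bar> < real W * \<epsilon> \<and> dir_sum \<alpha> k a \<rho> C A \<psi>"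
    by (rule summable_net[OF summ k, of "real W * \<epsilon>"]) (use W \<epsilon> in simp, rule that)
  \<comment> \<open>Beyond this abscissa the curve lies in the domain of all sectors, and A1 e^-R <=
    1/2 makes the truncated series converge.\<close>
  define R where "R = max (- ln \<rho>) (ln (2 * A1))"
  have R: "0 \<le> R" "exp (- R) \<le> \<rho>" "2 * A1 \<le> exp R"
  proof -
    have "0 \<le> ln (2 * A1)" using C1 by simp
    then show "0 \<le> R" by (simp add: R_def)
    have "exp (- R) \<le> exp (ln \<rho>)" by (simp add: R_def)
    then show "exp (- R) \<le> \<rho>" using net by simp
    have "exp (ln (2 * A1)) \<le> exp R" by (simp add: R_def)
    then show "2 * A1 \<le> exp R" using C1 by simp
  qed
  \<comment> \<open>The maximum covers the rates of the sectorial estimate and of the curve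
    truncation; the power of 2 absorbs the step from the factorial of n to that of n + 1.\<close>
  define A3 where "A3 = max A (exp R) * 2 powr (1 / k)"
  have A3: "1 \<le> A3" unfolding A3_def using net k mult_mono[of 1 "max A (exp R)" 1 "2 powr (1 / k)"]
    by (simp add: ge_one_powr_ge_zero)
  define G' where "G' = C * A + C1 * 2 ^ CARD('d)"
  obtain \<nu> where \<nu>: "0 < \<nu>" "\<And>m y. real m \<le> \<nu> * exp (real W' / s * y) \<Longrightarrow>
    (2 * A2) ^ m * fact (m div W') powr s \<le> exp (real m * (y - 1))"
    by (rule gevrey_bound_exp[of s W' "2 * A2"]) (use s W C2 in auto)
  obtain \<nu>' where \<nu>'0: "0 < \<nu>'" "\<And>m y. real m \<le> \<nu>' * exp (real W / (1 / k) * y) \<Longrightarrow>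
    A3 ^ m * fact (m div W) powr (1 / k) \<le> exp (real m * (y - 1))"
    by (rule gevrey_bound_exp[of "1 / k" W A3]) (use k W A3 in auto)
  have \<nu>': "A3 ^ m * fact (m div W) powr (1 / k) \<le> exp (real m * (y - 1))" if "real m \<le> \<nu>' * exp (K * y)" for m y
    using \<nu>'0(2)[of m y] that by (simp add: K_def mult.commute)
  have coeffs: "cmod (curve_coeff L c w a m) \<le> C * exp (real m * R)"
    if L: "clinear_contraction L" and c: "\<And>j. cmod (c $ j) = 1" for L :: "'e \<Rightarrow> complex" and c m
  proof -
    interpret gevrey_coeffs "curve_coeff L c w a" "C2 * 2 ^ CARD('d)" \<nu> "real W' / s"
    proof
      fix m y assume "real m \<le> \<nu> * exp (real W' / s * y)"
      then have "(2 * A2) ^ m * fact (m div W') powr s \<le> exp (real m * (y - 1))" by (rule \<nu>)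
      then have "C2 * 2 ^ CARD('d) * ((2 * A2) ^ m * fact (m div W') powr s) \<le> C2 * 2 ^ CARD('d) * exp (real m * (y - 1))"
        using C2 by (intro mult_left_mono) auto
      with curve_coeff_bound[OF w \<alpha>' L c C2, where m = m]
      show "cmod (curve_coeff L c w a m) \<le> C2 * 2 ^ CARD('d) * exp (real m * (y - 1))"
        unfolding W'_def by linarith
    qed (use \<nu> s W C2 in auto)
    define \<omega> where "\<omega> = Arg (mpow c \<alpha>)"
    have c\<omega>: "mpow c \<alpha> = cis \<omega>"
      using rcis_cmod_Arg[of "mpow c \<alpha>"] c by (simp add: \<omega>_def rcis_def norm_mpow rpow_const)
    show ?thesis
    proof (rule tauberian_one_variable[OF K p \<epsilon>(2)])
      fix \<theta> :: real
      obtain \<psi> and l :: int where \<psi>: "\<bar>(\<omega> - real W * \<theta>) - \<psi> - 2 * pi * of_int l\<bar> < real W * \<epsilon>"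
        and ds: "dir_sum \<alpha> k a \<rho> C A \<psi>" using net(5) by blast
      obtain \<delta> f where \<delta>: "pi / k < \<delta>" and hf: "holo_on_sector \<alpha> f (mono_sector \<alpha> (\<psi> - \<delta> / 2) (\<psi> + \<delta> / 2) \<rho>)"
        and est: "\<And>x \<phi> N. (x, \<phi>) \<in> mono_sector \<alpha> (\<psi> - \<delta> / 2) (\<psi> + \<delta> / 2) \<rho> \<Longrightarrow>
          norm (f (x, \<phi>) - mfps_sum (trunc \<alpha> N a) x) \<le> C * A ^ N * fact N powr (1 / k) * cmod (mpow x \<alpha>) ^ N"
        using ds unfolding dir_sum_def by blast
      \<comment> \<open>The representative of the argument of c^\<alpha> in the period of the chosen
        direction \<psi>.\<close>
      define \<omega>' where "\<omega>' = \<omega> - 2 * pi * of_int l"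
      \<comment> \<open>The height at which the argument along the curve equals \<psi>; the
        half-opening \<delta>/2 of the sector likewise becomes b after division by W.\<close>
      define \<theta>' where "\<theta>' = (\<omega>' - \<psi>) / real W"
      define b where "b = \<delta> / (2 * real W)"
      define h where "h z = L (f (curve w c z, \<omega>' - real (wdot w \<alpha>) * Im z))" for z
      have W\<theta>': "real W * \<theta>' = \<omega>' - \<psi>" "real W * b = \<delta> / 2" using W by (simp_all add: \<theta>'_def b_def)
      have sec: "(curve w c z, \<omega>' - real (wdot w \<alpha>) * Im z) \<in> mono_sector \<alpha> (\<psi> - \<delta> / 2) (\<psi> + \<delta> / 2) \<rho>"
        if z: "z \<in> half_strip R \<theta>' b" for z
      proof (rule mono_sector_memI)
        have zR: "R < Re z" "\<bar>Im z - \<theta>'\<bar> < b" using z by (auto simp: half_strip_def)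
        show "curve w c z $ j \<noteq> 0" for j using norm_curve[of c j w z] c by (metis exp_not_eq_zero norm_zero)
        show "curve w c z \<in> sector_dom \<alpha> \<rho>"
          unfolding sector_dom_def
        proof safe
          fix j
          have "cmod (curve w c z $ j) ^ (\<alpha> $ j) = exp (- (real (\<alpha> $ j * w $ j) * Re z))"
            by (simp add: norm_curve c exp_of_nat_mult[symmetric] mult_ac)
          also have "\<dots> < exp (- R)"
          proof -
            have "0 < \<alpha> $ j * w $ j" using w \<alpha> by simp
            then have "1 \<le> real (\<alpha> $ j * w $ j)" by linarith
            then have "1 * Re z \<le> real (\<alpha> $ j * w $ j) * Re z" using zR R by (intro mult_right_mono) auto
            then show ?thesis using zR by simp
          qed
          finally show "cmod (curve w c z $ j) ^ (\<alpha> $ j) < \<rho>" using R by linarith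
        qed
        have "mpow (curve w c z) \<alpha> = cis \<omega> * exp (- (of_nat W * z))" by (simp add: mpow_curve c\<omega> W_def)
        also have "\<dots> = of_real (exp (- (real W * Re z))) * cis (\<omega> - real W * Im z)"
          by (simp add: exp_eq_polar cis_mult[symmetric] mult_ac flip: cis_mult) (simp add: cis_mult)
        also have "cis (\<omega> - real W * Im z) = cis (\<omega>' - real W * Im z)"
          using cis_shift[of "\<omega> - real W * Im z" l] by (simp add: \<omega>'_def algebra_simps)
        finally have *: "mpow (curve w c z) \<alpha> = of_real (exp (- (real W * Re z))) * cis (\<omega>' - real W * Im z)" .
        then have "cmod (mpow (curve w c z) \<alpha>) = exp (- (real W * Re z))" by (simp add: norm_mult)
        then show "mpow (curve w c z) \<alpha> = of_real (cmod (mpow (curve w c z) \<alpha>)) * cis (\<omega>' - real (wdot w \<alpha>) * Im z)"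
          using * by (simp add: W_def)
        have "real W * \<bar>Im z - \<theta>'\<bar> < real W * b" using zR W by simp
        moreover have "\<bar>real W * Im z - real W * \<theta>'\<bar> = real W * \<bar>Im z - \<theta>'\<bar>"
          by (simp add: right_diff_distrib[symmetric] abs_mult)
        ultimately have "\<bar>real W * Im z - real W * \<theta>'\<bar> < \<delta> / 2" unfolding W\<theta>'(2) by simp
        then show "\<psi> - \<delta> / 2 < \<omega>' - real (wdot w \<alpha>) * Im z" "\<omega>' - real (wdot w \<alpha>) * Im z < \<psi> + \<delta> / 2"
          unfolding W_def[symmetric] W\<theta>'(1) by linarith+
      qed
      have "real W * \<bar>\<theta> - \<theta>'\<bar> = \<bar>real W * \<theta> - real W * \<theta>'\<bar>"
        using W by (simp add: right_diff_distrib[symmetric] abs_mult)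
      also have "\<dots> < real W * \<epsilon>" unfolding W\<theta>'(1) using \<psi> by (simp add: \<omega>'_def abs_less_iff)
      finally have near: "\<bar>\<theta> - \<theta>'\<bar> \<le> \<epsilon>" using W by simp
      have b: "pi / (2 * K) < b"
        using \<delta> k W by (simp add: b_def K_def field_simps)
      have holo: "h holomorphic_on half_strip R \<theta>' b"
        unfolding h_def by (rule holomorphic_along_curve[OF hf L c open_half_strip sec])
      have hC: "cmod (h z) \<le> C" if "z \<in> half_strip R \<theta>' b" for z
      proof -
        have "trunc \<alpha> 0 a = (\<lambda>_. 0)" by (auto simp: trunc_def less_eq_vec_def)
        then have "norm (f (curve w c z, \<omega>' - real (wdot w \<alpha>) * Im z)) \<le> C"
          using est[OF sec[OF that], of 0] by (simp add: mfps_sum_def)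
        then show ?thesis unfolding h_def using clinear_contractionD(3)[OF L] order_trans by blast
      qed
      have asymp: "cmod (h z - P M z) \<le> G' * exp (real M * (y - 1 - Re z))"
        if z: "z \<in> half_strip R \<theta>' b" and M: "real M \<le> \<nu>' * exp (K * y)" for z M y
      proof -
        \<comment> \<open>Rounding up ensures N W >= M, while the factorial of N stays within a
          geometric factor of that of M div W.\<close>
        define N where "N = Suc (M div W)"
        let ?x = "curve w c z"
        let ?y = "f (?x, \<omega>' - real (wdot w \<alpha>) * Im z)"
        have zR: "R < Re z" using z by (simp add: half_strip_def)
        have NM: "M \<le> N * wdot w \<alpha>"
          using dividend_less_div_times[OF W(1), of M] by (simp add: N_def W_def[symmetric])
        have "N \<le> Suc M" by (simp add: N_def div_le_dividend)
        let ?E = "exp (- (real M * Re z))"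
        let ?B = "max A (exp R)"
        have B: "1 \<le> ?B" using net by simp
        have 1: "norm (?y - mfps_sum (trunc \<alpha> N a) ?x) \<le> C * A * ?B ^ M * fact N powr (1 / k) * ?E"
        proof -
          have "cmod (mpow ?x \<alpha>) ^ N = exp (- (real (N * wdot w \<alpha>) * Re z))"
            using c by (simp add: mpow_curve norm_mult norm_mpow[of c] rpow_const exp_of_nat_mult[symmetric] mult_ac)
          also have "\<dots> \<le> ?E" using NM zR R by (simp add: mult_right_mono flip: of_nat_mult)
          finally have E: "cmod (mpow ?x \<alpha>) ^ N \<le> ?E" .
          have "A ^ N \<le> A ^ Suc M" using net \<open>N \<le> Suc M\<close> by (intro power_increasing) auto
          also have "\<dots> \<le> A * ?B ^ M" using net by (simp add: mult_left_mono power_mono)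
          finally have "C * A ^ N * fact N powr (1 / k) * cmod (mpow ?x \<alpha>) ^ N \<le> C * (A * ?B ^ M) * fact N powr (1 / k) * ?E"
            using net E by (intro mult_mono mult_left_mono mult_right_mono mult_nonneg_nonneg) auto
          then show ?thesis using est[OF sec[OF z], of N] by (simp add: mult_ac)
        qed
        have 2: "cmod (L (mfps_sum (trunc \<alpha> N a) ?x) - P M z) \<le> C1 * 2 ^ CARD('d) * ?B ^ M * fact N powr (1 / k) * ?E"
        proof -
          have "cmod (L (mfps_sum (trunc \<alpha> N a) ?x) - P M z) \<le> C1 * 2 ^ CARD('d) * fact N powr (1 / k) * exp R ^ M * ?E"
            unfolding P_def by (rule curve_truncation[OF w L c C1(1,2) _ C1(3) R(1,3) zR NM]) (use k in auto)
          also have "\<dots> \<le> C1 * 2 ^ CARD('d) * fact N powr (1 / k) * ?B ^ M * ?E"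
            using C1 net B by (intro mult_mono mult_left_mono power_mono mult_nonneg_nonneg) auto
          finally show ?thesis by (simp add: mult_ac)
        qed
        have "h z - P M z = L (?y - mfps_sum (trunc \<alpha> N a) ?x) + (L (mfps_sum (trunc \<alpha> N a) ?x) - P M z)"
          unfolding h_def by (simp add: linear_diff[OF bounded_linear.linear[OF clinear_contractionD(4)[OF L]]])
        then have "cmod (h z - P M z) \<le> cmod (L (?y - mfps_sum (trunc \<alpha> N a) ?x)) + cmod (L (mfps_sum (trunc \<alpha> N a) ?x) - P M z)"
          by (metis norm_triangle_ineq)
        also have "\<dots> \<le> C * A * ?B ^ M * fact N powr (1 / k) * ?E + C1 * 2 ^ CARD('d) * ?B ^ M * fact N powr (1 / k) * ?E"
          using 1 2 clinear_contractionD(3)[OF L, of "?y - mfps_sum (trunc \<alpha> N a) ?x"] by linarith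
        also have "\<dots> = G' * (?B ^ M * fact N powr (1 / k)) * ?E" by (simp add: G'_def algebra_simps)
        also have "\<dots> \<le> G' * (?B ^ M * ((2 powr (1 / k)) ^ M * fact (M div W) powr (1 / k))) * ?E"
        proof (intro mult_right_mono mult_left_mono)
          have "fact N powr (1 / k) \<le> (2 powr (1 / k)) ^ (M div W) * fact (M div W) powr (1 / k)"
            unfolding N_def using k by (intro fact_Suc_powr_le) auto
          also have "\<dots> \<le> (2 powr (1 / k)) ^ M * fact (M div W) powr (1 / k)"
            using k by (intro mult_right_mono power_increasing) (auto simp: div_le_dividend ge_one_powr_ge_zero)
          finally show "fact N powr (1 / k) \<le> (2 powr (1 / k)) ^ M * (fact (M div W) :: real) powr (1 / k)" .
        qed (use net C1 in \<open>auto simp: G'_def\<close>)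
        also have "\<dots> = G' * (A3 ^ M * fact (M div W) powr (1 / k)) * ?E"
          by (simp only: A3_def power_mult_distrib mult.assoc)
        also have "\<dots> \<le> G' * exp (real M * (y - 1)) * ?E"
          using net C1 by (intro mult_right_mono mult_left_mono \<nu>' M) (auto simp: G'_def)
        also have "\<dots> = G' * exp (real M * (y - 1 - Re z))"
          by (simp add: mult.assoc exp_add[symmetric] algebra_simps)
        finally show ?thesis .
      qed
      have "0 \<le> G'" using net C1 by (simp add: G'_def)
      then have "\<exists>\<nu>'>0. \<exists>C'\<ge>0. \<forall>z\<in>half_strip R \<theta>' b. \<forall>M y. real M \<le> \<nu>' * exp (K * y) \<longrightarrow>
         cmod (h z - P M z) \<le> C' * exp (real M * (y - 1 - Re z))"
        using asymp \<nu>'0(1) by blast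
      then show "\<exists>\<theta>' b h. \<bar>\<theta> - \<theta>'\<bar> \<le> \<epsilon> \<and> pi / (2 * K) < b \<and> h holomorphic_on half_strip R \<theta>' b \<and>
        (\<forall>z\<in>half_strip R \<theta>' b. cmod (h z) \<le> C) \<and>
        (\<exists>\<nu>'>0. \<exists>C'\<ge>0. \<forall>z\<in>half_strip R \<theta>' b. \<forall>M y. real M \<le> \<nu>' * exp (K * y) \<longrightarrow>
           cmod (h z - P M z) \<le> C' * exp (real M * (y - 1 - Re z)))"
        using near b holo hC by blast
    qed
  qed
  have "norm (a \<beta>) \<le> C * (exp R ^ mdeg w) ^ mdeg \<beta>" for \<beta>
  proof -
    define m where "m = wdot w \<beta>"
    define F where "F = {\<gamma>. wdot w \<gamma> = m}"
    \<comment> \<open>The part of weighted degree m has finite support, so the torus estimate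
      applies to it without any convergence assumption on a.\<close>
    define a' where "a' \<gamma> = (if wdot w \<gamma> = m then a \<gamma> else 0)" for \<gamma>
    have finF: "finite F" unfolding F_def by (rule finite_wdot_eq[OF w])
    have "norm (a' \<beta>) \<le> C * exp (real m * R)"
    proof (rule cauchy_estimate_torus)
      have "(\<lambda>\<gamma>. norm (a' \<gamma>)) summable_on F" using finF by simp
      then show "(\<lambda>\<gamma>. norm (a' \<gamma>)) summable_on UNIV"
        by (subst summable_on_cong_neutral[of F UNIV]) (auto simp: a'_def F_def)
      fix c :: "complex^'d" assume c: "\<And>j. cmod (c $ j) = 1"
      have "mfps_sum a' c = infsum (\<lambda>\<gamma>. mpow c \<gamma> *\<^sub>C a \<gamma>) F"
        unfolding mfps_sum_def by (rule infsum_cong_neutral) (auto simp: a'_def F_def)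
      then have sum: "mfps_sum a' c = (\<Sum>\<gamma> | wdot w \<gamma> = m. mpow c \<gamma> *\<^sub>C a \<gamma>)" using finF by (simp add: F_def)
      \<comment> \<open>The functional depends on c, which is allowed because \<open>coeffs\<close>
        is uniform in both.\<close>
      obtain L where L: "clinear_contraction L" "L (mfps_sum a' c) = of_real (norm (mfps_sum a' c))"
        using norming_functional .
      have "norm (mfps_sum a' c) = cmod (L (mfps_sum a' c))" by (simp add: L(2))
      also have "\<dots> = cmod (curve_coeff L c w a m)" by (simp add: sum curve_coeff_def)
      also have "\<dots> \<le> C * exp (real m * R)" by (rule coeffs[OF L(1) c])
      finally show "norm (mfps_sum a' c) \<le> C * exp (real m * R)" .
    qed
    also have "\<dots> \<le> C * exp (real (mdeg w * mdeg \<beta>) * R)"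
      using net R wdot_le_mdeg[of w \<beta>] by (intro mult_left_mono) (auto simp: m_def intro!: mult_right_mono simp flip: of_nat_mult)
    also have "exp (real (mdeg w * mdeg \<beta>) * R) = (exp R ^ mdeg w) ^ mdeg \<beta>"
      by (simp only: exp_of_nat_mult power_mult)
    finally show ?thesis by (simp add: a'_def m_def)
  qed
  moreover have "1 \<le> exp R ^ mdeg w" using R by (intro one_le_power) auto
  ultimately have "exp_bounded a C (exp R ^ mdeg w)" using net by (simp add: exp_bounded_def)
  then show thesis by (rule that)
qed

section \<open>Convergent series\<close>

lemma convergent_imp_exp_bounded:
  fixes a :: "('d::finite, 'e::complex_banach) mfps"
  assumes "a \<in> convergent_series"
  obtains C A where "exp_bounded a C A"
proof -
  obtain r where r: "0 < r" "converges_on a (polydisc r)" using assms by (auto simp: convergent_series_def)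
  define x0 :: "complex^'d" where "x0 = (\<chi> j. of_real (r / 2))"
  have "x0 \<in> polydisc r" using r by (simp add: polydisc_def x0_def)
  then have "(\<lambda>\<beta>. mpow x0 \<beta> *\<^sub>C a \<beta>) summable_on UNIV" using r by (simp add: converges_on_def)
  then obtain C where C: "0 \<le> C" "\<And>\<beta>. norm (mpow x0 \<beta> *\<^sub>C a \<beta>) \<le> C" by (rule converges_on_bounded_terms) blast
  have "norm (a \<beta>) \<le> C * max 1 (2 / r) ^ mdeg \<beta>" for \<beta>
  proof -
    have "(r / 2) ^ mdeg \<beta> * norm (a \<beta>) \<le> C"
      using C(2)[of \<beta>] r by (simp add: norm_scaleC norm_mpow x0_def rpow_const)
    then have "norm (a \<beta>) \<le> C * (2 / r) ^ mdeg \<beta>" using r by (simp add: power_divide field_simps)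
    also have "\<dots> \<le> C * max 1 (2 / r) ^ mdeg \<beta>" using C r by (intro mult_left_mono power_mono) auto
    finally show ?thesis .
  qed
  then show thesis using that[of C "max 1 (2 / r)"] C by (simp add: exp_bounded_def)
qed

lemma exp_bounded_imp_convergent:
  assumes "exp_bounded a C A"
  shows "a \<in> convergent_series"
proof -
  have "1 \<le> A" using assms by (simp add: exp_bounded_def)
  then show ?thesis
    using exp_boundedD(1)[OF assms] unfolding convergent_series_def bounded_holo_series_def
    by (auto intro!: exI[of _ "1 / (4 * A)"])
qed

text \<open>A slice contains no power of x_j, so the radius for that variable may be taken as large
  as the given point demands; the other radii are 1/A.\<close>

lemma exp_bounded_imp_Ohat':
  fixes a :: "('d::finite, 'e::complex_banach) mfps"
  assumes "exp_bounded a C A"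
  shows "a \<in> Ohat'"
proof -
  have A: "0 \<le> C" "1 \<le> A" "\<And>\<beta>. norm (a \<beta>) \<le> C * A ^ mdeg \<beta>" using assms by (auto simp: exp_bounded_def)
  have "slice j m a \<in> bounded_holo_series {x. \<forall>i. i \<noteq> j \<longrightarrow> cmod (x $ i) < 1 / (4 * A)}" for j m
  proof (rule in_bounded_holo_series(1))
    show "0 \<le> C * A ^ m" using A by simp
    fix x :: "complex^'d" assume x: "x \<in> {x. \<forall>i. i \<noteq> j \<longrightarrow> cmod (x $ i) < 1 / (4 * A)}"
    define \<rho> where "\<rho> i = (if i = j then 4 * cmod (x $ j) + 1 else 1 / A)" for i
    show "\<exists>\<rho>. (\<forall>i. 4 * cmod (x $ i) < \<rho> i) \<and> (\<forall>\<beta>. norm (slice j m a \<beta>) * rpow \<rho> \<beta> \<le> C * A ^ m)"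
    proof (intro exI[of _ \<rho>] conjI allI)
      show "4 * cmod (x $ i) < \<rho> i" for i using x A by (auto simp: \<rho>_def field_simps)
      fix \<beta>
      show "norm (slice j m a \<beta>) * rpow \<rho> \<beta> \<le> C * A ^ m"
      proof (cases "\<beta> $ j = 0")
        case True
        have "rpow \<rho> \<beta> = rpow (\<lambda>_. 1 / A) \<beta>"
          unfolding rpow_def by (intro prod.cong refl) (use True in \<open>auto simp: \<rho>_def\<close>)
        then have "rpow \<rho> \<beta> = 1 / A ^ mdeg \<beta>" by (simp add: rpow_const power_divide)
        moreover have "norm (a (\<beta> + axis j m)) \<le> C * A ^ (mdeg \<beta> + m)"
        proof -
          have "mdeg (axis j m :: nat^'d) = (\<Sum>i\<in>UNIV. if i = j then m else 0)"
            unfolding mdeg_def by (intro sum.cong) (auto simp: axis_def)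
          then show ?thesis using A(3)[of "\<beta> + axis j m"] by (simp add: mdeg_add)
        qed
        moreover have "C * A ^ (mdeg \<beta> + m) * (1 / A ^ mdeg \<beta>) = C * A ^ m"
          using A(2) by (simp add: power_add)
        moreover have "norm (a (\<beta> + axis j m)) * (1 / A ^ mdeg \<beta>) \<le> C * A ^ (mdeg \<beta> + m) * (1 / A ^ mdeg \<beta>)"
          using calculation(2) A(2) by (intro mult_right_mono) auto
        ultimately show ?thesis using True by (simp add: slice_def)
      qed (use A in \<open>simp add: slice_def\<close>)
    qed
  qed
  then show ?thesis using A unfolding Ohat'_def by (auto intro!: exI[of _ "1 / (4 * A)"])
qed

lemma exp_bounded_imp_growth:
  assumes "exp_bounded a C A" "0 \<le> s"
  shows "coeff_growth \<alpha> s a"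
proof -
  have "coeff_growth \<alpha> 0 a" using assms(1) unfolding coeff_growth_def exp_bounded_def by auto
  then show ?thesis using assms(2) by (rule coeff_growth_mono)
qed

lemma coeff_growth_imp_gevrey:
  fixes a :: "('d::finite, 'e::complex_banach) mfps"
  assumes "coeff_growth \<alpha> s a" "0 \<le> s"
  shows "gevrey_series s (mono_coeff \<alpha> a)"
proof -
  obtain C A where *: "0 \<le> C" "1 \<le> A" "\<And>n \<beta>. \<not> Suc n *s \<alpha> \<le> \<beta> \<Longrightarrow> norm (a \<beta>) \<le> C * A ^ mdeg \<beta> * fact n powr s"
    using assms(1) unfolding coeff_growth_def by blast
  have "exp_bounded (mono_coeff \<alpha> a n) (C * (A ^ mdeg \<alpha>) ^ n * fact n powr s) A" for n
    by (rule coeff_growth_exp_bounded(1)[OF *(1,2) assms(2) *(3)])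
  note eb = exp_boundedD[OF this]
  define D where "D = C * 2 ^ CARD('d) + 1"
  have "norm (mfps_sum (mono_coeff \<alpha> a n) x) \<le> D * (A ^ mdeg \<alpha>) ^ n * fact n powr s"
    if "x \<in> polydisc (1 / (4 * A))" for n x
  proof -
    have "norm (mfps_sum (mono_coeff \<alpha> a n) x) \<le> C * (A ^ mdeg \<alpha>) ^ n * fact n powr s * 2 ^ CARD('d)"
      by (rule eb(2)[OF that])
    also have "\<dots> = (C * 2 ^ CARD('d)) * ((A ^ mdeg \<alpha>) ^ n * fact n powr s)" by simp
    also have "\<dots> \<le> D * ((A ^ mdeg \<alpha>) ^ n * fact n powr s)"
      using * by (intro mult_right_mono) (auto simp: D_def)
    finally show ?thesis by (simp add: mult_ac)
  qed
  moreover have "0 < D" using * by (simp add: D_def add_nonneg_pos)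
  moreover have "0 < 1 / (4 * A)" "0 < A ^ mdeg \<alpha>" using *(2) by auto
  ultimately show ?thesis
    unfolding gevrey_series_def using eb(1) \<open>0 < 1 / (4 * A)\<close> \<open>0 < A ^ mdeg \<alpha>\<close> by blast
qed

lemma has_sum_shift:
  fixes a :: "('d::finite, 'e::complex_banach) mfps"
  assumes a: "\<And>\<beta>. \<not> \<alpha> \<le> \<beta> \<Longrightarrow> a \<beta> = 0"
    and s: "((\<lambda>\<gamma>. mpow x \<gamma> *\<^sub>C a (\<alpha> + \<gamma>)) has_sum s) UNIV"
  shows "((\<lambda>\<beta>. mpow x \<beta> *\<^sub>C a \<beta>) has_sum mpow x \<alpha> *\<^sub>C s) UNIV"
proof -
  let ?g = "\<lambda>\<beta>. mpow x \<beta> *\<^sub>C a \<beta>"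
  have "((\<lambda>\<gamma>. mpow x \<alpha> *\<^sub>C (mpow x \<gamma> *\<^sub>C a (\<alpha> + \<gamma>))) has_sum mpow x \<alpha> *\<^sub>C s) UNIV"
    by (rule has_sum_bounded_linear[OF bounded_linear_scaleC_right s, unfolded o_def])
  then have "((?g \<circ> (\<lambda>\<gamma>. \<alpha> + \<gamma>)) has_sum mpow x \<alpha> *\<^sub>C s) UNIV"
    by (simp add: o_def mpow_add scaleC_scaleC)
  then have "(?g has_sum mpow x \<alpha> *\<^sub>C s) (range (\<lambda>\<gamma>. \<alpha> + \<gamma>))"
    by (subst has_sum_reindex) (auto simp: inj_on_def)
  moreover have "\<beta> \<in> range (\<lambda>\<gamma>. \<alpha> + \<gamma>)" if "a \<beta> \<noteq> 0" for \<beta>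
  proof -
    have "\<alpha> \<le> \<beta>" using a that by blast
    then have "\<beta> = \<alpha> + (\<chi> j. \<beta> $ j - \<alpha> $ j)" by (auto simp: less_eq_vec_def vec_eq_iff)
    then show ?thesis by blast
  qed
  then have "?g \<beta> = 0" if "\<beta> \<notin> range (\<lambda>\<gamma>. \<alpha> + \<gamma>)" for \<beta>
    using that by force
  ultimately show ?thesis
    by (subst has_sum_cong_neutral[of "range (\<lambda>\<gamma>. \<alpha> + \<gamma>)" UNIV ?g ?g]) auto
qed

text \<open>Every monomial present is divisible by x^\<alpha>; after factoring it out, the remaining
  series has the same rate A and the constant C A^|\<alpha>|.\<close>

lemma mfps_sum_tail_bound:
  fixes a :: "('d::finite, 'e::complex_banach) mfps"
  assumes ab: "exp_bounded a C A" and x: "x \<in> polydisc (1 / (4 * A))" and zero: "\<And>\<beta>. \<not> \<alpha> \<le> \<beta> \<Longrightarrow> a \<beta> = 0"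
  shows "norm (mfps_sum a x) \<le> C * A ^ mdeg \<alpha> * 2 ^ CARD('d) * cmod (mpow x \<alpha>)"
proof -
  have A: "0 \<le> C" "1 \<le> A" "\<And>\<beta>. norm (a \<beta>) \<le> C * A ^ mdeg \<beta>" using ab by (auto simp: exp_bounded_def)
  define b where "b \<gamma> = a (\<alpha> + \<gamma>)" for \<gamma>
  have "exp_bounded b (C * A ^ mdeg \<alpha>) A"
    using A A(3)[of "\<alpha> + \<gamma>" for \<gamma>] unfolding exp_bounded_def b_def by (simp add: mdeg_add power_add mult_ac)
  note b = exp_boundedD[OF this]
  have "((\<lambda>\<gamma>. mpow x \<gamma> *\<^sub>C b \<gamma>) has_sum mfps_sum b x) UNIV"
    unfolding mfps_sum_def using b(1) x by (intro has_sum_infsum) (auto simp: bounded_holo_series_def converges_on_def)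
  then have "((\<lambda>\<beta>. mpow x \<beta> *\<^sub>C a \<beta>) has_sum mpow x \<alpha> *\<^sub>C mfps_sum b x) UNIV"
    unfolding b_def by (intro has_sum_shift zero)
  then have "mfps_sum a x = mpow x \<alpha> *\<^sub>C mfps_sum b x" unfolding mfps_sum_def by (rule infsumI)
  then show ?thesis using mult_left_mono[OF b(2)[OF x], of "cmod (mpow x \<alpha>)"] by (simp add: norm_scaleC mult_ac)
qed

lemma mfps_sum_diff:
  fixes a b :: "('d::finite, 'e::complex_banach) mfps"
  assumes "a \<in> bounded_holo_series U" "b \<in> bounded_holo_series U" "x \<in> U"
  shows "mfps_sum (\<lambda>\<beta>. a \<beta> - b \<beta>) x = mfps_sum a x - mfps_sum b x"
proof -
  have "((\<lambda>\<beta>. mpow x \<beta> *\<^sub>C a \<beta> + - (mpow x \<beta> *\<^sub>C b \<beta>)) has_sum (mfps_sum a x + - mfps_sum b x)) UNIV"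
    unfolding mfps_sum_def using assms
    by (intro has_sum_add has_sum_infsum, unfold has_sum_uminus) (auto intro!: has_sum_infsum simp: bounded_holo_series_def converges_on_def)
  then show ?thesis
    unfolding mfps_sum_def by (intro infsumI) (simp add: scaleC_diff_right)
qed

text \<open>The convergent sum itself serves in every direction, with any opening, and the set of
  singular directions is empty.\<close>

lemma exp_bounded_imp_summable:
  fixes a :: "('d::finite, 'e::complex_banach) mfps"
  assumes ab: "exp_bounded a C A" and k: "0 < k"
  shows "a \<in> mono_summable \<alpha> k"
proof -
  have A: "0 \<le> C" "1 \<le> A" "\<And>\<beta>. norm (a \<beta>) \<le> C * A ^ mdeg \<beta>" using ab by (auto simp: exp_bounded_def)
  define R where "R = 1 / (4 * A)"
  have R: "0 < R" "R \<le> 1" using A by (auto simp: R_def)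
  define \<rho> where "\<rho> = R ^ mdeg \<alpha>"
  have sub: "sector_dom \<alpha> \<rho> \<subseteq> polydisc R" unfolding \<rho>_def by (rule sector_dom_subset_polydisc[OF R])
  have dir: "dir_sum \<alpha> k a \<rho> (C * 2 ^ CARD('d)) (A ^ mdeg \<alpha>) \<theta>" for \<theta>
    unfolding dir_sum_def
  proof (intro conjI allI exI[of _ "pi / k + 1"] exI[of _ "\<lambda>(x, _). mfps_sum a x"] ballI)
    have "exp_bounded (mono_coeff \<alpha> a n) (C * (A ^ mdeg \<alpha>) ^ n * fact n powr 0) A" for n
      by (rule coeff_growth_exp_bounded(1)) (use A in auto)
    from exp_boundedD(1)[OF this] show "mono_coeff \<alpha> a n \<in> bounded_holo_series (sector_dom \<alpha> \<rho>)" for n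
      by (rule bounded_holo_series_mono[OF sub[unfolded R_def]])
    have "complex_differentiable_at (mfps_sum a) x" if "x \<in> sector_dom \<alpha> \<rho>" for x
      using exp_boundedD(1)[OF ab] sub that by (auto simp: R_def bounded_holo_series_def bounded_holo_def)
    then show "holo_on_sector \<alpha> (\<lambda>(x, _). mfps_sum a x) (mono_sector \<alpha> (\<theta> - (pi / k + 1) / 2) (\<theta> + (pi / k + 1) / 2) \<rho>)"
      using mono_sector_dom by (fastforce simp: holo_on_sector_def)
    fix z assume z: "z \<in> mono_sector \<alpha> (\<theta> - (pi / k + 1) / 2) (\<theta> + (pi / k + 1) / 2) \<rho>"
    obtain x \<phi> where x: "z = (x, \<phi>)" by (cases z)
    have xR: "x \<in> polydisc R" using z sub mono_sector_dom unfolding x by blast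
    have "norm (mfps_sum a x - mfps_sum (trunc \<alpha> N a) x) \<le> C * 2 ^ CARD('d) * (A ^ mdeg \<alpha>) ^ N * fact N powr (1 / k) * cmod (mpow x \<alpha>) ^ N" for N
    proof -
      have tb: "exp_bounded (trunc \<alpha> N a) C A" using A by (auto simp: exp_bounded_def trunc_def)
      have db: "exp_bounded (\<lambda>\<beta>. a \<beta> - trunc \<alpha> N a \<beta>) C A" using A by (auto simp: exp_bounded_def trunc_def)
      have "norm (mfps_sum a x - mfps_sum (trunc \<alpha> N a) x) = norm (mfps_sum (\<lambda>\<beta>. a \<beta> - trunc \<alpha> N a \<beta>) x)"
        using mfps_sum_diff[OF exp_boundedD(1)[OF ab] exp_boundedD(1)[OF tb]] xR by (simp add: R_def)
      also have "\<dots> \<le> C * A ^ mdeg (N *s \<alpha>) * 2 ^ CARD('d) * cmod (mpow x (N *s \<alpha>))"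
        by (rule mfps_sum_tail_bound[OF db]) (use xR in \<open>auto simp: R_def trunc_def\<close>)
      also have "\<dots> = C * 2 ^ CARD('d) * (A ^ mdeg \<alpha>) ^ N * 1 * cmod (mpow x \<alpha>) ^ N"
      proof -
        have "A ^ mdeg (N *s \<alpha>) = (A ^ mdeg \<alpha>) ^ N" by (metis mdeg_mult power_mult mult.commute)
        then show ?thesis by (simp add: mpow_mult norm_power)
      qed
      also have "\<dots> \<le> C * 2 ^ CARD('d) * (A ^ mdeg \<alpha>) ^ N * fact N powr (1 / k) * cmod (mpow x \<alpha>) ^ N"
        using A k by (intro mult_right_mono mult_left_mono fact_powr_ge_one) auto
      finally show ?thesis .
    qed
    then show "case z of (x, \<phi>) \<Rightarrow> \<forall>N. norm ((case (x, \<phi>) of (x, _) \<Rightarrow> mfps_sum a x) - mfps_sum (trunc \<alpha> N a) x)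
        \<le> C * 2 ^ CARD('d) * (A ^ mdeg \<alpha>) ^ N * fact N powr (1 / k) * cmod (mpow x \<alpha>) ^ N"
      by (simp add: x)
  qed simp
  have "mono_summable_dir \<alpha> k a \<theta>" for \<theta>
    by (rule summable_of_dir_sum[OF dir exp_bounded_imp_Ohat'[OF ab]]) (use R A in \<open>auto simp: \<rho>_def\<close>)
  then show ?thesis
    unfolding mono_summable_def using exp_bounded_imp_Ohat'[OF ab] by (auto intro!: exI[of _ "{}"])
qed

section \<open>Proportional exponents\<close>

text \<open>All components share one polydisc, with no control of their growth in n. Unlike the
  Gevrey condition this is unchanged when \<alpha> is replaced by a multiple, so it transfers the
  holomorphy requirement between x^\<gamma> and its powers.\<close>

definition common_radius :: "nat^'d::finite \<Rightarrow> ('d, 'e::complex_banach) mfps \<Rightarrow> bool" where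
  "common_radius \<alpha> a \<longleftrightarrow> (\<exists>A\<ge>1. \<forall>n. \<exists>C\<ge>0. \<forall>\<beta>. \<not> n *s \<alpha> \<le> \<beta> \<longrightarrow> norm (a \<beta>) \<le> C * A ^ mdeg \<beta>)"

lemma coeff_growth_common_radius:
  assumes "coeff_growth \<alpha> s a"
  shows "common_radius \<alpha> a"
proof -
  obtain C A where *: "0 \<le> C" "1 \<le> A" "\<And>n \<beta>. \<not> Suc n *s \<alpha> \<le> \<beta> \<Longrightarrow> norm (a \<beta>) \<le> C * A ^ mdeg \<beta> * fact n powr s"
    using assms(1) unfolding coeff_growth_def by blast
  have "\<exists>C\<ge>0. \<forall>\<beta>. \<not> n *s \<alpha> \<le> \<beta> \<longrightarrow> norm (a \<beta>) \<le> C * A ^ mdeg \<beta>" for n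
  proof (cases n)
    case 0
    then show ?thesis by (auto simp: less_eq_vec_def)
  next
    case (Suc m)
    then show ?thesis using * by (intro exI[of _ "C * fact m powr s"]) (auto simp: mult_ac)
  qed
  then show ?thesis unfolding common_radius_def using *(2) by blast
qed

lemma mult_mult_vec: "n *s (p *s (\<gamma> :: nat^'d::finite)) = (n * p) *s \<gamma>"
  by (simp add: vec_eq_iff)

lemma trunc_mult: "trunc (p *s \<gamma>) n a = trunc \<gamma> (n * p) a"
  by (simp add: trunc_def mult_mult_vec)

text \<open>Truncations of order n for p \<gamma> are those of order n p for \<gamma>, and these are
  cofinal among all truncations.\<close>

lemma common_radius_mult:
  fixes \<gamma> :: "nat^'d::finite"
  assumes "0 < p"
  shows "common_radius (p *s \<gamma>) a \<longleftrightarrow> common_radius \<gamma> a"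
proof
  assume "common_radius (p *s \<gamma>) a"
  then obtain A where A: "1 \<le> A" "\<And>n. \<exists>C\<ge>0. \<forall>\<beta>. \<not> (n * p) *s \<gamma> \<le> \<beta> \<longrightarrow> norm (a \<beta>) \<le> C * A ^ mdeg \<beta>"
    unfolding common_radius_def mult_mult_vec by blast
  have "\<not> (n * p) *s \<gamma> \<le> \<beta>" if "\<not> n *s \<gamma> \<le> \<beta>" for n \<beta>
    using that mult_vec_le_mono[of n "n * p" \<gamma>] assms by (auto dest: order_trans)
  then show "common_radius \<gamma> a" unfolding common_radius_def using A by meson
next
  assume "common_radius \<gamma> a"
  then show "common_radius (p *s \<gamma>) a" unfolding common_radius_def mult_mult_vec by blast
qed

lemma common_radius_components:
  fixes a :: "('d::finite, 'e::complex_banach) mfps"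
  assumes "common_radius \<alpha> a"
  obtains R where "0 < R" "R \<le> 1" "\<And>n. mono_coeff \<alpha> a n \<in> bounded_holo_series (polydisc R)"
proof -
  obtain A where A: "1 \<le> A" "\<And>n. \<exists>C\<ge>0. \<forall>\<beta>. \<not> n *s \<alpha> \<le> \<beta> \<longrightarrow> norm (a \<beta>) \<le> C * A ^ mdeg \<beta>"
    using assms unfolding common_radius_def by blast
  have "mono_coeff \<alpha> a n \<in> bounded_holo_series (polydisc (1 / (4 * A)))" for n
  proof -
    obtain C where C: "0 \<le> C" "\<And>\<beta>. \<not> Suc n *s \<alpha> \<le> \<beta> \<Longrightarrow> norm (a \<beta>) \<le> C * A ^ mdeg \<beta>" using A(2)[of "Suc n"] by blast
    have "norm (mono_coeff \<alpha> a n \<beta>) \<le> C * A ^ mdeg (n *s \<alpha>) * A ^ mdeg \<beta>" for \<beta>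
    proof (cases "\<alpha> \<le> \<beta>")
      case False
      then have "\<not> Suc n *s \<alpha> \<le> n *s \<alpha> + \<beta>" by (simp add: less_eq_vec_def)
      from C(2)[OF this] show ?thesis using False
        by (simp add: mono_coeff_def mdeg_add power_add mult.assoc)
    qed (use A C in \<open>auto simp: mono_coeff_def\<close>)
    then have "exp_bounded (mono_coeff \<alpha> a n) (C * A ^ mdeg (n *s \<alpha>)) A"
      using A C by (simp add: exp_bounded_def)
    then show ?thesis by (rule exp_boundedD(1))
  qed
  then show thesis using that[of "1 / (4 * A)"] A(1) by simp
qed

lemma complex_differentiable_at_transform:
  assumes "complex_differentiable_at F x0" "eventually (\<lambda>x. F x = G x) (nhds x0)"
  shows "complex_differentiable_at G x0"
proof -
  obtain S where S: "open S" "x0 \<in> S" "\<And>x. x \<in> S \<Longrightarrow> F x = G x" using assms(2) by (auto simp: eventually_nhds)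
  then show ?thesis
    using assms(1) has_derivative_transform_within_open[of F _ x0 UNIV S G]
    unfolding complex_differentiable_at_def by blast
qed

text \<open>Near x0 the ratio is close to 1, its argument stays below \<pi>/p, and multiplication by
  p remains in the principal range. Hence the charts for \<gamma> and p \<gamma> match
  locally.\<close>

lemma eventually_Arg_ratio_power:
  fixes x0 :: "complex^'d::finite"
  assumes "mpow x0 \<gamma> \<noteq> 0" "0 < p"
  shows "eventually (\<lambda>x. mpow x \<gamma> / mpow x0 \<gamma> \<noteq> 0 \<and>
    Arg ((mpow x \<gamma> / mpow x0 \<gamma>) ^ p) = real p * Arg (mpow x \<gamma> / mpow x0 \<gamma>)) (nhds x0)"
proof -
  define q where "q x = mpow x \<gamma> / mpow x0 \<gamma>" for x
  have "isCont (\<lambda>x. mpow x \<gamma>) x0" by (rule has_derivative_continuous[OF has_derivative_mpow])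
  then have q: "isCont q x0" unfolding q_def using assms by (intro continuous_intros) auto
  have q1: "q x0 = 1" using assms by (simp add: q_def)
  have "isCont (\<lambda>x. Arg (q x)) x0"
    using q q1 by (intro isCont_o2[OF q] continuous_at_Arg) auto
  then have "((\<lambda>x. Arg (q x)) \<longlongrightarrow> Arg (q x0)) (nhds x0)" by (simp add: isCont_def continuous_within tendsto_nhds_iff)
  then have "eventually (\<lambda>x. dist (Arg (q x)) (Arg (q x0)) < pi / p) (nhds x0)"
    using assms(2) by (intro tendstoD) auto
  moreover have "eventually (\<lambda>x. q x \<noteq> 0) (nhds x0)"
  proof -
    have "(q \<longlongrightarrow> q x0) (nhds x0)" using q by (simp add: isCont_def tendsto_nhds_iff)
    then show ?thesis by (rule tendsto_imp_eventually_ne) (simp add: q1)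
  qed
  ultimately show ?thesis unfolding q_def[symmetric]
  proof eventually_elim
    case (elim x)
    have t: "\<bar>real p * Arg (q x)\<bar> < pi" using elim(1) assms(2) by (simp add: q1 dist_real_def field_simps abs_mult)
    have "q x = rcis (cmod (q x)) (Arg (q x))" by (simp add: rcis_cmod_Arg)
    then have "q x ^ p = rcis (cmod (q x) ^ p) (real p * Arg (q x))" by (metis DeMoivre2)
    then show ?case using t elim(2) by (simp add: Arg_rcis abs_less_iff)
  qed
qed

section \<open>Factorial comparisons between orders 1/k and 1/(pk)\<close>

lemma fact_add_le: "fact (a + b) \<le> (fact a * (real (a + b)) ^ b :: real)"
proof (induction b)
  case (Suc b)
  have "fact (a + Suc b) = (fact (a + b) * real (a + Suc b) :: real)" by simp
  also have "\<dots> \<le> fact a * real (a + b) ^ b * real (a + Suc b)" using Suc by (intro mult_right_mono) auto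
  also have "\<dots> \<le> fact a * real (a + Suc b) ^ b * real (a + Suc b)"
    by (intro mult_right_mono mult_left_mono power_mono) auto
  finally show ?case by simp
qed simp

lemma fact_mult_le: "fact (N * p) \<le> ((real p ^ p) ^ N * fact N ^ p :: real)"
proof (induction N)
  case (Suc N)
  have "fact (Suc N * p) = (fact (N * p + p) :: real)" by (simp add: add.commute)
  also have "\<dots> \<le> fact (N * p) * real (N * p + p) ^ p" by (rule fact_add_le)
  also have "\<dots> \<le> ((real p ^ p) ^ N * fact N ^ p) * real (N * p + p) ^ p" using Suc by (intro mult_right_mono) auto
  also have "real (N * p + p) = real p * real (Suc N)" by (simp add: algebra_simps)
  finally show ?case by (simp add: power_mult_distrib mult_ac)
qed simp

text \<open>The quotient is a multinomial coefficient; the induction splits off one block of size n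
  at a time.\<close>

lemma fact_power_le_fact_mult: "fact n ^ p \<le> (fact (n * p) :: real)"
proof (induction p)
  case (Suc p)
  have "fact n * fact (n * p) dvd (fact (n + n * p) :: nat)" by (rule fact_fact_dvd_fact)
  then have "fact n * fact (n * p) \<le> (fact (n + n * p) :: nat)" by (intro dvd_imp_le) auto
  then have "real (fact n * fact (n * p)) \<le> real (fact (n + n * p))" by (rule of_nat_mono)
  then have "fact n * (fact (n * p) :: real) \<le> fact (n + n * p)" by (simp only: of_nat_mult of_nat_fact)
  moreover have "fact n ^ Suc p \<le> fact n * (fact (n * p) :: real)" using Suc by simp
  ultimately have "fact n ^ Suc p \<le> (fact (n + n * p) :: real)" by (rule order_trans[rotated])
  then show ?case by simp
qed simp

lemma power_powr_commute: "0 < (b :: real) \<Longrightarrow> (b ^ n) powr s = (b powr s) ^ n"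
  by (simp add: powr_realpow[symmetric] powr_powr mult.commute)

lemma fact_mult_powr_le:
  assumes "0 < p" "0 < k"
  shows "(fact (N * p) :: real) powr (1 / (real p * k)) \<le> ((real p ^ p) powr (1 / (real p * k))) ^ N * fact N powr (1 / k)"
proof -
  let ?s = "1 / (real p * k)"
  have "(fact (N * p) :: real) powr ?s \<le> ((real p ^ p) ^ N * fact N ^ p) powr ?s"
    using assms fact_mult_le[of N p] by (intro powr_mono2) auto
  also have "\<dots> = ((real p ^ p) ^ N) powr ?s * (fact N ^ p) powr ?s" by (rule powr_mult)
  also have "((real p ^ p) ^ N) powr ?s = ((real p ^ p) powr ?s) ^ N"
    using assms by (simp add: powr_realpow[symmetric] powr_powr mult.commute)
  also have "((fact N :: real) ^ p) powr ?s = fact N powr (1 / k)"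
    using assms by (simp add: powr_realpow[symmetric] powr_powr)
  finally show ?thesis .
qed

text \<open>Here n stands for N/p rounded up: order 1/k in n is order 1/(pk) in N up to geometric
  factors, the rounding costing at most p further factors.\<close>

lemma fact_powr_le_of_mult_le:
  assumes "0 < p" "0 < k" "n * p \<le> N + p"
  shows "(fact n :: real) powr (1 / k) \<le>
    (2 ^ (p * p)) powr (1 / (real p * k)) * ((2 ^ p) powr (1 / (real p * k))) ^ N * fact N powr (1 / (real p * k))"
proof -
  let ?s = "1 / (real p * k)"
  have "(fact n ^ p :: real) \<le> fact (n * p)" by (rule fact_power_le_fact_mult)
  also have "\<dots> \<le> fact (N + p)" using assms by (intro fact_mono) auto
  also have "\<dots> \<le> fact N * real (N + p) ^ p" by (rule fact_add_le)
  also have "\<dots> \<le> fact N * (2 ^ (N + p)) ^ p"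
    using of_nat_less_two_power[of "N + p", where 'a = real] by (intro mult_left_mono power_mono) auto
  also have "(2 ^ (N + p)) ^ p = (2 ^ (p * p) * (2 ^ p) ^ N :: real)"
    by (simp add: power_add power_mult[symmetric] power_mult_distrib mult.commute)
  finally have "(fact n ^ p :: real) powr ?s \<le> (fact N * (2 ^ (p * p) * (2 ^ p) ^ N)) powr ?s"
    using assms by (intro powr_mono2) auto
  also have "\<dots> = fact N powr ?s * ((2 ^ (p * p)) powr ?s * ((2 ^ p) ^ N) powr ?s)"
    by (simp add: powr_mult)
  also have "((2 ^ p) ^ N :: real) powr ?s = ((2 ^ p) powr ?s) ^ N"
    by (rule power_powr_commute) simp
  also have "(fact n ^ p :: real) powr ?s = fact n powr (1 / k)"
    using assms by (simp add: powr_realpow[symmetric] powr_powr)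
  finally show ?thesis by (simp add: mult_ac)
qed

lemma mono_sector_power:
  assumes s: "(x, \<phi>) \<in> mono_sector \<gamma> (\<psi> - \<delta> / 2) (\<psi> + \<delta> / 2) \<rho>" and "0 < p" "\<rho> ^ p \<le> \<rho>'"
  shows "(x, real p * \<phi>) \<in> mono_sector (p *s \<gamma>) (real p * \<psi> - real p * \<delta> / 2) (real p * \<psi> + real p * \<delta> / 2) \<rho>'"
proof -
  have x: "mpow x \<gamma> = of_real (cmod (mpow x \<gamma>)) * cis \<phi>" "\<And>j. 0 < cmod (x $ j) ^ (\<gamma> $ j)" "\<And>j. cmod (x $ j) ^ (\<gamma> $ j) < \<rho>"
    and \<phi>: "\<psi> - \<delta> / 2 < \<phi>" "\<phi> < \<psi> + \<delta> / 2" using s by (auto simp: mono_sector_def)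
  have "mpow x (p *s \<gamma>) = (of_real (cmod (mpow x \<gamma>)) * cis \<phi>) ^ p"
    unfolding mpow_mult by (subst x(1)) simp
  also have "\<dots> = of_real (cmod (mpow x (p *s \<gamma>))) * cis (real p * \<phi>)"
    by (simp add: power_mult_distrib Complex.DeMoivre mpow_mult norm_power)
  finally have 1: "mpow x (p *s \<gamma>) = of_real (cmod (mpow x (p *s \<gamma>))) * cis (real p * \<phi>)" .
  have pw: "cmod (x $ j) ^ ((p *s \<gamma>) $ j) = (cmod (x $ j) ^ (\<gamma> $ j)) ^ p" for j
    by (simp add: power_mult[symmetric] mult.commute)
  have "(cmod (x $ j) ^ (\<gamma> $ j)) ^ p < \<rho> ^ p" for j
    using x(2,3)[of j] assms(2) by (intro power_strict_mono) auto
  then have 2: "cmod (x $ j) ^ ((p *s \<gamma>) $ j) < \<rho>'" for j using assms(3) unfolding pw by (meson less_le_trans)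
  have 3: "0 < cmod (x $ j) ^ ((p *s \<gamma>) $ j)" for j unfolding pw using x(2)[of j] by simp
  have "real p * (\<psi> - \<delta> / 2) < real p * \<phi>" "real p * \<phi> < real p * (\<psi> + \<delta> / 2)" using \<phi> assms(2) by auto
  then show ?thesis using 1 2 3 unfolding mono_sector_def by (auto simp: algebra_simps)
qed

lemma mono_sector_nonzero: "(x, \<phi>) \<in> mono_sector \<alpha> a b r \<Longrightarrow> mpow x \<alpha> \<noteq> 0"
proof -
  assume "(x, \<phi>) \<in> mono_sector \<alpha> a b r"
  then have "0 < cmod (mpow x \<alpha>)" unfolding norm_mpow rpow_def by (intro prod_pos) (auto simp: mono_sector_def)
  then show ?thesis by auto
qed

text \<open>The sum for x^\<gamma> is f at the argument p times as large. A truncation order N that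
  is not a multiple of p is rounded up to n p, and the coefficient growth controls the difference of
  the two truncations.\<close>

lemma dir_sum_divide:
  fixes a :: "('d::finite, 'e::complex_banach) mfps"
  assumes ds: "dir_sum (p *s \<gamma>) k a \<rho> C A (real p * \<psi>)" and gr: "coeff_growth (p *s \<gamma>) (1 / k) a"
    and pos: "0 < p" "0 < k" "0 < \<rho>" "0 \<le> C" "1 \<le> A"
  obtains \<rho>' C' A' where "0 < \<rho>'" "0 \<le> C'" "0 \<le> A'" "dir_sum \<gamma> (real p * k) a \<rho>' C' A' \<psi>"
proof -
  let ?s = "1 / (real p * k)"
  obtain \<delta> f where f: "pi / k < \<delta>"
    "holo_on_sector (p *s \<gamma>) f (mono_sector (p *s \<gamma>) (real p * \<psi> - \<delta> / 2) (real p * \<psi> + \<delta> / 2) \<rho>)"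
    "\<And>x \<phi> N. (x, \<phi>) \<in> mono_sector (p *s \<gamma>) (real p * \<psi> - \<delta> / 2) (real p * \<psi> + \<delta> / 2) \<rho> \<Longrightarrow>
       norm (f (x, \<phi>) - mfps_sum (trunc (p *s \<gamma>) N a) x) \<le> C * A ^ N * fact N powr (1 / k) * cmod (mpow x (p *s \<gamma>)) ^ N"
    using ds unfolding dir_sum_def by blast
  obtain C1 A1 where C1: "0 \<le> C1" "1 \<le> A1"
    "\<And>n \<beta>. \<not> Suc n *s (p *s \<gamma>) \<le> \<beta> \<Longrightarrow> norm (a \<beta>) \<le> C1 * A1 ^ mdeg \<beta> * fact n powr (1 / k)"
    using gr unfolding coeff_growth_def by blast
  have tb: "exp_bounded (trunc \<gamma> (n * p) a) (C1 * fact n powr (1 / k)) A1" for n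
    unfolding trunc_mult[symmetric] by (rule coeff_growth_exp_bounded(2)[OF C1(1,2) _ C1(3)]) (use pos in auto)
  obtain R0 where R0: "0 < R0" "R0 \<le> 1" "\<And>n. mono_coeff \<gamma> a n \<in> bounded_holo_series (polydisc R0)"
    using common_radius_components coeff_growth_common_radius[OF gr] common_radius_mult[OF pos(1)] by blast
  define R where "R = min R0 (1 / (4 * A1))"
  have R: "0 < R" "R \<le> 1" "R \<le> R0" "R \<le> 1 / (4 * A1)" using R0 C1 by (auto simp: R_def)
  \<comment> \<open>Small enough for the polydisc on which all truncations are controlled, and for
    p-th powers of points to stay in the given sector.\<close>
  define \<rho>' where "\<rho>' = min (R ^ mdeg \<gamma>) (min \<rho> 1)"
  have \<rho>': "0 < \<rho>'" "\<rho>' \<le> 1" "\<rho>' \<le> \<rho>" "\<rho>' \<le> R ^ mdeg \<gamma>" using R pos by (auto simp: \<rho>'_def)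
  have "\<rho>' ^ p \<le> \<rho>' ^ 1" using \<rho>' pos by (intro power_decreasing) auto
  then have \<rho>'p: "\<rho>' ^ p \<le> \<rho>" using \<rho>' by simp
  have dom: "sector_dom \<gamma> \<rho>' \<subseteq> polydisc R"
    using sector_dom_mono[OF \<rho>'(4)] sector_dom_subset_polydisc[OF R(1,2)] by blast
  define \<delta>' where "\<delta>' = \<delta> / real p"
  have \<delta>': "real p * \<delta>' = \<delta>" "pi / (real p * k) < \<delta>'"
    using f(1) pos by (auto simp: \<delta>'_def field_simps)
  let ?S = "mono_sector \<gamma> (\<psi> - \<delta>' / 2) (\<psi> + \<delta>' / 2) \<rho>'"
  let ?T = "mono_sector (p *s \<gamma>) (real p * \<psi> - \<delta> / 2) (real p * \<psi> + \<delta> / 2) \<rho>"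
  have ST: "(x, real p * \<phi>) \<in> ?T" if "(x, \<phi>) \<in> ?S" for x \<phi>
    using mono_sector_power[OF that pos(1) \<rho>'p] unfolding \<delta>'(1) .
  define F where "F = (\<lambda>(x, \<phi>). f (x, real p * \<phi>))"
  have holo: "holo_on_sector \<gamma> F ?S"
    unfolding holo_on_sector_def
  proof (intro ballI, clarify)
    fix x0 \<phi>0 assume s: "(x0, \<phi>0) \<in> ?S"
    have "complex_differentiable_at (\<lambda>x. f (x, real p * \<phi>0 + Arg (mpow x (p *s \<gamma>) / mpow x0 (p *s \<gamma>)))) x0"
      using f(2) ST[OF s] unfolding holo_on_sector_def by fast
    then show "complex_differentiable_at (\<lambda>x. F (x, \<phi>0 + Arg (mpow x \<gamma> / mpow x0 \<gamma>))) x0"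
    proof (rule complex_differentiable_at_transform)
      show "\<forall>\<^sub>F x in nhds x0. f (x, real p * \<phi>0 + Arg (mpow x (p *s \<gamma>) / mpow x0 (p *s \<gamma>))) = F (x, \<phi>0 + Arg (mpow x \<gamma> / mpow x0 \<gamma>))"
        using eventually_Arg_ratio_power[OF mono_sector_nonzero[OF s] pos(1)]
      proof eventually_elim
        case (elim x)
        then show ?case by (simp add: F_def mpow_mult power_divide[symmetric] distrib_left)
      qed
    qed
  qed
  define C' where "C' = (C + C1 * 2 ^ CARD('d)) * (2 ^ (p * p)) powr ?s"
  define A' where "A' = (A * A1 ^ mdeg \<gamma>) * (2 ^ p) powr ?s"
  have est: "norm (F (x, \<phi>) - mfps_sum (trunc \<gamma> N a) x) \<le> C' * A' ^ N * fact N powr ?s * cmod (mpow x \<gamma>) ^ N"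
    if s: "(x, \<phi>) \<in> ?S" for x \<phi> N
  proof -
    \<comment> \<open>This is N/p rounded up.\<close>
    define n where "n = (N + p - 1) div p"
    have "(N + p - 1) mod p + n * p = N + p - 1" unfolding n_def by (simp add: mod_div_mult_eq)
    moreover have "(N + p - 1) mod p < p" using pos by simp
    ultimately have n: "N \<le> n * p" "n * p \<le> N + p" by linarith+
    have nN: "n \<le> N"
    proof (cases N)
      case (Suc m)
      have "n * p \<le> N + p - 1" unfolding n_def by (rule div_times_less_eq_dividend)
      also have "\<dots> = m + p" using Suc by simp
      also have "\<dots> \<le> m * p + p" using pos by simp
      also have "\<dots> = N * p" using Suc by simp
      finally show ?thesis using pos by simp
    qed (use pos in \<open>simp add: n_def\<close>)
    have xd: "x \<in> sector_dom \<gamma> \<rho>'" by (rule mono_sector_dom[OF s])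
    have xR: "x \<in> polydisc (1 / (4 * A1))" using dom xd R by (auto simp: polydisc_def intro: less_le_trans)
    let ?t = "cmod (mpow x \<gamma>)"
    have t: "?t \<le> 1" by (rule norm_mpow_le_one[OF xd \<rho>'(2)])
    let ?Q = "A * A1 ^ mdeg \<gamma>"
    have Q: "A \<le> ?Q" "A1 ^ mdeg \<gamma> \<le> ?Q" using pos C1 by (auto simp: mult_le_cancel_left1 mult_le_cancel_right1)
    have 1: "norm (F (x, \<phi>) - mfps_sum (trunc \<gamma> (n * p) a) x) \<le> C * fact n powr (1 / k) * (?Q ^ N * ?t ^ N)"
    proof -
      have "norm (F (x, \<phi>) - mfps_sum (trunc \<gamma> (n * p) a) x) \<le> C * A ^ n * fact n powr (1 / k) * cmod (mpow x (p *s \<gamma>)) ^ n"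
        using f(3)[OF ST[OF s], of n] by (simp add: F_def trunc_mult)
      also have "cmod (mpow x (p *s \<gamma>)) ^ n = ?t ^ (n * p)" by (simp add: mpow_mult norm_power power_mult[symmetric] mult.commute)
      also have "C * A ^ n * fact n powr (1 / k) * ?t ^ (n * p) = C * fact n powr (1 / k) * (A ^ n * ?t ^ (n * p))" by simp
      also have "\<dots> \<le> C * fact n powr (1 / k) * (?Q ^ N * ?t ^ N)"
      proof (intro mult_left_mono mult_mono)
        have "A ^ n \<le> A ^ N" using nN pos by (intro power_increasing) auto
        also have "\<dots> \<le> ?Q ^ N" using Q pos by (intro power_mono) auto
        finally show "A ^ n \<le> ?Q ^ N" .
        show "?t ^ (n * p) \<le> ?t ^ N" using n t by (intro power_decreasing) auto
      qed (use pos C1 in auto)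
      finally show ?thesis .
    qed
    have 2: "norm (mfps_sum (trunc \<gamma> (n * p) a) x - mfps_sum (trunc \<gamma> N a) x) \<le> C1 * 2 ^ CARD('d) * fact n powr (1 / k) * (?Q ^ N * ?t ^ N)"
    proof -
      let ?D = "\<lambda>\<beta>. trunc \<gamma> (n * p) a \<beta> - trunc \<gamma> N a \<beta>"
      have sub: "N *s \<gamma> \<le> \<beta>" if "(n * p) *s \<gamma> \<le> \<beta>" for \<beta> using order_trans[OF mult_vec_le_mono[OF n(1)] that] .
      have Nb: "exp_bounded (trunc \<gamma> N a) (C1 * fact n powr (1 / k)) A1"
        using tb[of n] sub unfolding exp_bounded_def trunc_def by (auto split: if_splits)
      have Db: "exp_bounded ?D (C1 * fact n powr (1 / k)) A1"
        using tb[of n] sub unfolding exp_bounded_def trunc_def by (auto split: if_splits)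
      have "norm (mfps_sum (trunc \<gamma> (n * p) a) x - mfps_sum (trunc \<gamma> N a) x) = norm (mfps_sum ?D x)"
        using mfps_sum_diff[OF exp_boundedD(1)[OF tb] exp_boundedD(1)[OF Nb] xR] by simp
      also have "\<dots> \<le> C1 * fact n powr (1 / k) * A1 ^ mdeg (N *s \<gamma>) * 2 ^ CARD('d) * cmod (mpow x (N *s \<gamma>))"
        by (rule mfps_sum_tail_bound[OF Db xR]) (use sub in \<open>auto simp: trunc_def\<close>)
      also have "\<dots> = C1 * 2 ^ CARD('d) * fact n powr (1 / k) * ((A1 ^ mdeg \<gamma>) ^ N * ?t ^ N)"
      proof -
        have "A1 ^ mdeg (N *s \<gamma>) = (A1 ^ mdeg \<gamma>) ^ N" by (metis mdeg_mult power_mult mult.commute)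
        then show ?thesis by (simp add: mpow_mult norm_power)
      qed
      also have "\<dots> \<le> C1 * 2 ^ CARD('d) * fact n powr (1 / k) * (?Q ^ N * ?t ^ N)"
        using C1 Q by (intro mult_left_mono mult_right_mono power_mono) auto
      finally show ?thesis .
    qed
    have "F (x, \<phi>) - mfps_sum (trunc \<gamma> N a) x = (F (x, \<phi>) - mfps_sum (trunc \<gamma> (n * p) a) x) +
        (mfps_sum (trunc \<gamma> (n * p) a) x - mfps_sum (trunc \<gamma> N a) x)" by simp
    then have "norm (F (x, \<phi>) - mfps_sum (trunc \<gamma> N a) x) \<le> norm (F (x, \<phi>) - mfps_sum (trunc \<gamma> (n * p) a) x) +
        norm (mfps_sum (trunc \<gamma> (n * p) a) x - mfps_sum (trunc \<gamma> N a) x)" by (metis norm_triangle_ineq)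
    also have "\<dots> \<le> (C + C1 * 2 ^ CARD('d)) * (?Q ^ N * ?t ^ N) * fact n powr (1 / k)"
      using 1 2 by (simp add: algebra_simps)
    also have "\<dots> \<le> (C + C1 * 2 ^ CARD('d)) * (?Q ^ N * ?t ^ N) * ((2 ^ (p * p)) powr ?s * ((2 ^ p) powr ?s) ^ N * fact N powr ?s)"
      using pos C1 n by (intro mult_left_mono fact_powr_le_of_mult_le) auto
    also have "\<dots> = C' * A' ^ N * fact N powr ?s * ?t ^ N" by (simp only: C'_def A'_def power_mult_distrib mult_ac)
    finally show ?thesis .
  qed
  have "dir_sum \<gamma> (real p * k) a \<rho>' C' A' \<psi>"
    unfolding dir_sum_def
  proof (intro conjI allI)
    have "polydisc R \<subseteq> (polydisc R0 :: (complex^'d) set)" using R(3) by (auto simp: polydisc_def intro: less_le_trans)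
    then have "sector_dom \<gamma> \<rho>' \<subseteq> polydisc R0" using dom by blast
    then show "mono_coeff \<gamma> a n \<in> bounded_holo_series (sector_dom \<gamma> \<rho>')" for n
      using R0(3) by (rule bounded_holo_series_mono)
    show "\<exists>\<delta>>pi / (real p * k). \<exists>f. holo_on_sector \<gamma> f (mono_sector \<gamma> (\<psi> - \<delta> / 2) (\<psi> + \<delta> / 2) \<rho>') \<and>
       (\<forall>(x, \<phi>)\<in>mono_sector \<gamma> (\<psi> - \<delta> / 2) (\<psi> + \<delta> / 2) \<rho>'. \<forall>N.
          norm (f (x, \<phi>) - mfps_sum (trunc \<gamma> N a) x) \<le> C' * A' ^ N * fact N powr ?s * cmod (mpow x \<gamma>) ^ N)"
      using \<delta>'(2) holo est by blast
  qed
  moreover have "0 \<le> C'" "0 \<le> A'" using pos C1 by (auto simp: C'_def A'_def)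
  ultimately show thesis using that \<rho>'(1) by blast
qed

definition root_match :: "nat^'d::finite \<Rightarrow> nat \<Rightarrow> complex^'d \<Rightarrow> real \<Rightarrow> nat \<Rightarrow> bool" where
  "root_match \<gamma> p x \<phi> j \<longleftrightarrow> j < p \<and> mpow x \<gamma> = of_real (cmod (mpow x \<gamma>)) * cis ((\<phi> + 2 * pi * real j) / real p)"

text \<open>The \<open>p\<close> arguments of \<open>x\<^sup>\<gamma>\<close> modulo \<open>2\<pi>\<close> that are compatible with the argument \<open>\<phi>\<close>
  of \<open>x\<^bsup>p\<gamma>\<^esup>\<close>: exactly one of them is an argument of \<open>x\<^sup>\<gamma>\<close>.\<close>

lemma root_match_ex:
  assumes "mpow x (p *s \<gamma>) = of_real (cmod (mpow x (p *s \<gamma>))) * cis \<phi>" "mpow x \<gamma> \<noteq> 0" "0 < p"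
  obtains j where "root_match \<gamma> p x \<phi> j"
proof -
  define t where "t = Arg (mpow x \<gamma>)"
  have xt: "mpow x \<gamma> = of_real (cmod (mpow x \<gamma>)) * cis t" unfolding t_def by (metis rcis_cmod_Arg rcis_def)
  have "of_real (cmod (mpow x \<gamma>) ^ p) * cis (real p * t) = mpow x \<gamma> ^ p"
    by (subst (2) xt) (simp add: power_mult_distrib Complex.DeMoivre)
  also have "\<dots> = of_real (cmod (mpow x \<gamma>) ^ p) * cis \<phi>"
    using assms(1) by (simp add: mpow_mult norm_power)
  finally have "cis (real p * t) = cis \<phi>" using assms(2) by simp
  then have "exp (\<i> * of_real (real p * t)) = exp (\<i> * of_real \<phi>)" by (simp add: cis_conv_exp)
  then obtain m :: int where "\<i> * of_real (real p * t) = \<i> * of_real \<phi> + complex_of_real (real_of_int (2 * m) * pi) * \<i>"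
    unfolding exp_eq by blast
  then have "Im (\<i> * of_real (real p * t)) = Im (\<i> * of_real \<phi> + complex_of_real (real_of_int (2 * m) * pi) * \<i>)" by simp
  then have pt: "real p * t = \<phi> + 2 * pi * of_int m" by simp
  define j where "j = nat (m mod int p)"
  have j: "j < p" "of_int m = real j + real p * of_int (m div int p)"
  proof -
    have "0 \<le> m mod int p" "m mod int p < int p" using assms(3) by auto
    then show "j < p" by (simp add: j_def nat_less_iff)
    have "m = int j + int p * (m div int p)" using \<open>0 \<le> m mod int p\<close> by (simp add: j_def)
    then have "real_of_int m = of_int (int j + int p * (m div int p))" by simp
    then show "of_int m = real j + real p * of_int (m div int p)" by simp
  qed
  have "(\<phi> + 2 * pi * real j) / real p = t - 2 * pi * of_int (m div int p)"
    using pt assms(3) unfolding j(2) by (simp add: field_simps)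
  then have "cis ((\<phi> + 2 * pi * real j) / real p) = cis t" by (simp add: cis_shift)
  then show thesis using that[of j] j(1) xt by (simp add: root_match_def)
qed

text \<open>Equal values of the root make the indices congruent modulo p, and both lie below
  p.\<close>

lemma root_match_unique:
  assumes "root_match \<gamma> p x \<phi> i" "root_match \<gamma> p x \<phi> j" "mpow x \<gamma> \<noteq> 0"
  shows "i = j"
proof -
  have p: "0 < p" using assms(1) by (auto simp: root_match_def)
  have "of_real (cmod (mpow x \<gamma>)) * cis ((\<phi> + 2 * pi * real i) / real p) = of_real (cmod (mpow x \<gamma>)) * cis ((\<phi> + 2 * pi * real j) / real p)"
    using assms(1,2) by (metis root_match_def)
  then have "cis ((\<phi> + 2 * pi * real i) / real p) = cis ((\<phi> + 2 * pi * real j) / real p)" using assms(3) by simp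
  then have "exp (\<i> * of_real ((\<phi> + 2 * pi * real i) / real p)) = exp (\<i> * of_real ((\<phi> + 2 * pi * real j) / real p))" by (simp add: cis_conv_exp)
  then obtain m :: int where "\<i> * of_real ((\<phi> + 2 * pi * real i) / real p) = \<i> * of_real ((\<phi> + 2 * pi * real j) / real p) + complex_of_real (real_of_int (2 * m) * pi) * \<i>"
    unfolding exp_eq by blast
  then have "Im (\<i> * of_real ((\<phi> + 2 * pi * real i) / real p)) = Im (\<i> * of_real ((\<phi> + 2 * pi * real j) / real p) + complex_of_real (real_of_int (2 * m) * pi) * \<i>)" by simp
  then have "(\<phi> + 2 * pi * real i) / real p = (\<phi> + 2 * pi * real j) / real p + 2 * pi * of_int m" by simp
  then have "2 * pi * real i = 2 * pi * (real j + real p * of_int m)" using p by (simp add: field_simps)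
  then have "real_of_int (int i) = real_of_int (int j + int p * m)" by simp
  then have "int i = int j + int p * m" unfolding of_int_eq_iff .
  then have "int i mod int p = int j mod int p" by simp
  then show ?thesis using assms(1,2) by (simp add: root_match_def)
qed

text \<open>The argument \<phi> of x^(p\<gamma>) leaves p candidate directions for x^\<gamma>, and
  which of them occurs depends on x. Summability in all p directions is therefore needed, and the
  sum is defined piece by piece according to the matching root.\<close>

lemma dir_sum_multiply:
  fixes a :: "('d::finite, 'e::complex_banach) mfps"
  assumes cr: "common_radius (p *s \<gamma>) a" and pos: "0 < p" "0 < k"
    and summ: "\<And>j. j < p \<Longrightarrow> mono_summable_dir \<gamma> (real p * k) a ((\<theta> + 2 * pi * real j) / real p)"
  obtains \<rho> C A where "0 < \<rho>" "0 \<le> C" "0 \<le> A" "dir_sum (p *s \<gamma>) k a \<rho> C A \<theta>"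
proof -
  let ?s = "1 / (real p * k)"
  define \<psi> where "\<psi> j = (\<theta> + 2 * pi * real j) / real p" for j
  obtain \<rho>0 C A where c: "0 < \<rho>0" "\<rho>0 \<le> 1" "0 \<le> C" "1 \<le> A" and ds: "\<And>j. j < p \<Longrightarrow> dir_sum \<gamma> (real p * k) a \<rho>0 C A (\<psi> j)"
  proof -
    have "\<exists>\<rho> C A. 0 < \<rho> \<and> \<rho> \<le> 1 \<and> 0 \<le> C \<and> 1 \<le> A \<and> (\<forall>\<phi>\<in>\<psi> ` {..<p}. dir_sum \<gamma> (real p * k) a \<rho> C A \<phi>)"
      by (rule dir_sum_uniform) (use summ pos in \<open>auto simp: \<psi>_def\<close>)
    then show thesis using that by blast
  qed
  have "\<exists>\<delta> f. pi / (real p * k) < \<delta> \<and> holo_on_sector \<gamma> f (mono_sector \<gamma> (\<psi> j - \<delta> / 2) (\<psi> j + \<delta> / 2) \<rho>0) \<and>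
       (\<forall>(x, \<phi>)\<in>mono_sector \<gamma> (\<psi> j - \<delta> / 2) (\<psi> j + \<delta> / 2) \<rho>0. \<forall>N.
          norm (f (x, \<phi>) - mfps_sum (trunc \<gamma> N a) x) \<le> C * A ^ N * fact N powr ?s * cmod (mpow x \<gamma>) ^ N)" if "j < p" for j
    using ds[OF that] unfolding dir_sum_def by blast
  then obtain \<delta> f where \<delta>: "\<And>j. j < p \<Longrightarrow> pi / (real p * k) < \<delta> j"
    and hf: "\<And>j. j < p \<Longrightarrow> holo_on_sector \<gamma> (f j) (mono_sector \<gamma> (\<psi> j - \<delta> j / 2) (\<psi> j + \<delta> j / 2) \<rho>0)"
    and est: "\<And>j x \<phi> N. j < p \<Longrightarrow> (x, \<phi>) \<in> mono_sector \<gamma> (\<psi> j - \<delta> j / 2) (\<psi> j + \<delta> j / 2) \<rho>0 \<Longrightarrow>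
          norm (f j (x, \<phi>) - mfps_sum (trunc \<gamma> N a) x) \<le> C * A ^ N * fact N powr ?s * cmod (mpow x \<gamma>) ^ N"
    by (metis (mono_tags, lifting) case_prodD)
  \<comment> \<open>The p sums may have different openings; the least one is used for all and is
    still larger than \<pi>/(pk).\<close>
  define \<delta>0 where "\<delta>0 = Min (\<delta> ` {..<p})"
  have \<delta>0: "\<delta>0 \<le> \<delta> j" if "j < p" for j unfolding \<delta>0_def using that by (intro Min_le) auto
  have "\<delta>0 \<in> \<delta> ` {..<p}" unfolding \<delta>0_def using pos by (intro Min_in) auto
  then have "pi / (real p * k) < \<delta>0" using \<delta> by auto
  then have wide: "pi / k < real p * \<delta>0" using pos by (simp add: field_simps)
  obtain R where R: "0 < R" "R \<le> 1" "\<And>n. mono_coeff (p *s \<gamma>) a n \<in> bounded_holo_series (polydisc R)"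
    by (rule common_radius_components[OF cr]) (rule that)
  define \<rho> where "\<rho> = min (\<rho>0 ^ p) (R ^ mdeg (p *s \<gamma>))"
  have \<rho>: "0 < \<rho>" "\<rho> \<le> \<rho>0 ^ p" "\<rho> \<le> R ^ mdeg (p *s \<gamma>)" using c R by (auto simp: \<rho>_def)
  let ?S = "mono_sector (p *s \<gamma>) (\<theta> - real p * \<delta>0 / 2) (\<theta> + real p * \<delta>0 / 2) \<rho>"
  have nz: "mpow x \<gamma> \<noteq> 0" if "(x, \<phi>) \<in> ?S" for x \<phi>
    using mono_sector_nonzero[OF that] pos by (simp add: mpow_mult)
  have sec: "(x, (\<phi> + 2 * pi * real j) / real p) \<in> mono_sector \<gamma> (\<psi> j - \<delta> j / 2) (\<psi> j + \<delta> j / 2) \<rho>0"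
    if s: "(x, \<phi>) \<in> ?S" and j: "root_match \<gamma> p x \<phi> j" for x \<phi> j
  proof -
    have jp: "j < p" and xj: "mpow x \<gamma> = of_real (cmod (mpow x \<gamma>)) * cis ((\<phi> + 2 * pi * real j) / real p)"
      using j by (auto simp: root_match_def)
    have \<phi>: "\<theta> - real p * \<delta>0 / 2 < \<phi>" "\<phi> < \<theta> + real p * \<delta>0 / 2"
      and x: "\<And>i. 0 < cmod (x $ i) ^ ((p *s \<gamma>) $ i)" "\<And>i. cmod (x $ i) ^ ((p *s \<gamma>) $ i) < \<rho>"
      using s by (auto simp: mono_sector_def)
    have pw: "cmod (x $ i) ^ ((p *s \<gamma>) $ i) = (cmod (x $ i) ^ (\<gamma> $ i)) ^ p" for i
      by (simp add: power_mult[symmetric] mult.commute)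
    have 1: "0 < cmod (x $ i) ^ (\<gamma> $ i)" for i
    proof (rule ccontr)
      assume "\<not> 0 < cmod (x $ i) ^ (\<gamma> $ i)"
      moreover have "0 \<le> cmod (x $ i) ^ (\<gamma> $ i)" by simp
      ultimately have "cmod (x $ i) ^ (\<gamma> $ i) = 0" by linarith
      then have "(cmod (x $ i) ^ (\<gamma> $ i)) ^ p = 0" using pos by (simp only: zero_power)
      then show False using x(1)[of i] unfolding pw by linarith
    qed
    have "(cmod (x $ i) ^ (\<gamma> $ i)) ^ p < \<rho>0 ^ p" for i using x(2)[of i] \<rho>(2) unfolding pw by linarith
    then have 2: "cmod (x $ i) ^ (\<gamma> $ i) < \<rho>0" for i
      using c by (intro power_less_imp_less_base[of _ p \<rho>0]) auto
    have "real p * \<delta>0 \<le> real p * \<delta> j" using \<delta>0[OF jp] by (intro mult_left_mono) auto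
    then have "\<theta> - real p * \<delta> j / 2 < \<phi>" "\<phi> < \<theta> + real p * \<delta> j / 2" using \<phi> by linarith+
    then have "real p * (\<psi> j - \<delta> j / 2) < \<phi> + 2 * pi * real j" "\<phi> + 2 * pi * real j < real p * (\<psi> j + \<delta> j / 2)"
      unfolding right_diff_distrib distrib_left using pos by (simp_all add: \<psi>_def)
    then have "\<psi> j - \<delta> j / 2 < (\<phi> + 2 * pi * real j) / real p" "(\<phi> + 2 * pi * real j) / real p < \<psi> j + \<delta> j / 2"
      using pos by (simp_all only: pos_less_divide_eq pos_divide_less_eq of_nat_0_less_iff mult.commute)
    then show ?thesis using 1 2 xj unfolding mono_sector_def by auto
  qed
  define idx where "idx x \<phi> = (SOME j. root_match \<gamma> p x \<phi> j)" for x \<phi>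
  have idx: "root_match \<gamma> p x \<phi> (idx x \<phi>)" if s: "(x, \<phi>) \<in> ?S" for x \<phi>
  proof -
    have "mpow x (p *s \<gamma>) = of_real (cmod (mpow x (p *s \<gamma>))) * cis \<phi>" using s by (simp add: mono_sector_def)
    then obtain j where "root_match \<gamma> p x \<phi> j" using root_match_ex nz[OF s] pos(1) by blast
    then show ?thesis unfolding idx_def by (rule someI)
  qed
  define F where "F = (\<lambda>(x, \<phi>). f (idx x \<phi>) (x, (\<phi> + 2 * pi * real (idx x \<phi>)) / real p))"
  have holo: "holo_on_sector (p *s \<gamma>) F ?S"
    unfolding holo_on_sector_def
  proof (intro ballI, clarify)
    fix x0 \<phi>0 assume s: "(x0, \<phi>0) \<in> ?S"
    define j where "j = idx x0 \<phi>0"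
    have m0: "root_match \<gamma> p x0 \<phi>0 j" unfolding j_def by (rule idx[OF s])
    then have jp: "j < p" by (simp add: root_match_def)
    have "complex_differentiable_at (\<lambda>x. f j (x, (\<phi>0 + 2 * pi * real j) / real p + Arg (mpow x \<gamma> / mpow x0 \<gamma>))) x0"
      using hf[OF jp] sec[OF s m0] unfolding holo_on_sector_def by fast
    then show "complex_differentiable_at (\<lambda>x. F (x, \<phi>0 + Arg (mpow x (p *s \<gamma>) / mpow x0 (p *s \<gamma>)))) x0"
    proof (rule complex_differentiable_at_transform)
      show "\<forall>\<^sub>F x in nhds x0. f j (x, (\<phi>0 + 2 * pi * real j) / real p + Arg (mpow x \<gamma> / mpow x0 \<gamma>)) =
          F (x, \<phi>0 + Arg (mpow x (p *s \<gamma>) / mpow x0 (p *s \<gamma>)))"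
        using eventually_Arg_ratio_power[OF nz[OF s] pos(1)]
      proof eventually_elim
        case (elim x)
        define t where "t = Arg (mpow x \<gamma> / mpow x0 \<gamma>)"
        define \<phi> where "\<phi> = \<phi>0 + Arg (mpow x (p *s \<gamma>) / mpow x0 (p *s \<gamma>))"
        \<comment> \<open>When the argument of x^\<gamma> moves by t, that of x^(p\<gamma>) moves by
          p t. The index j thus continues to match, so \<open>idx\<close> is locally constant and F
          coincides with one f j near x0.\<close>
        have \<phi>: "\<phi> = \<phi>0 + real p * t" using elim by (simp add: \<phi>_def t_def mpow_mult power_divide[symmetric])
        have xnz: "mpow x \<gamma> \<noteq> 0" using elim by auto
        have ang: "(\<phi> + 2 * pi * real j) / real p = (\<phi>0 + 2 * pi * real j) / real p + t"
          using pos by (simp add: \<phi> field_simps)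
        define r c where "r = cmod (mpow x \<gamma> / mpow x0 \<gamma>)" and "c = cmod (mpow x0 \<gamma>)"
        have rt: "mpow x \<gamma> / mpow x0 \<gamma> = of_real r * cis t"
          unfolding t_def r_def by (metis rcis_cmod_Arg rcis_def)
        have x0c: "mpow x0 \<gamma> = of_real c * cis ((\<phi>0 + 2 * pi * real j) / real p)"
          using m0 unfolding root_match_def c_def by blast
        have "mpow x \<gamma> = mpow x0 \<gamma> * (of_real r * cis t)"
          unfolding rt[symmetric] using nz[OF s] by simp
        also have "\<dots> = (of_real c * cis ((\<phi>0 + 2 * pi * real j) / real p)) * (of_real r * cis t)"
          by (subst x0c) (rule refl)
        also have "\<dots> = of_real (c * r) * (cis ((\<phi>0 + 2 * pi * real j) / real p) * cis t)"
          by (simp only: of_real_mult mult_ac)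
        also have "cis ((\<phi>0 + 2 * pi * real j) / real p) * cis t = cis ((\<phi> + 2 * pi * real j) / real p)"
          unfolding ang by (rule cis_mult)
        also have "c * r = cmod (mpow x \<gamma>)"
          unfolding c_def r_def using nz[OF s] by (simp add: norm_divide)
        finally have "root_match \<gamma> p x \<phi> j" using jp by (simp add: root_match_def)
        moreover from this have "root_match \<gamma> p x \<phi> (idx x \<phi>)" unfolding idx_def by (rule someI)
        ultimately have "idx x \<phi> = j" using root_match_unique xnz by blast
        then show ?case unfolding \<phi>_def[symmetric] t_def[symmetric] by (simp add: F_def ang)
      qed
    qed
  qed
  define A' where "A' = A ^ p * (real p ^ p) powr ?s"
  have bound: "norm (F (x, \<phi>) - mfps_sum (trunc (p *s \<gamma>) N a) x) \<le> C * A' ^ N * fact N powr (1 / k) * cmod (mpow x (p *s \<gamma>)) ^ N"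
    if s: "(x, \<phi>) \<in> ?S" for x \<phi> N
  proof -
    note m = idx[OF s]
    then have jp: "idx x \<phi> < p" by (simp add: root_match_def)
    have "norm (F (x, \<phi>) - mfps_sum (trunc (p *s \<gamma>) N a) x) \<le> C * A ^ (N * p) * fact (N * p) powr ?s * cmod (mpow x \<gamma>) ^ (N * p)"
      using est[OF jp sec[OF s m], of "N * p"] by (simp add: F_def trunc_mult)
    also have "\<dots> \<le> C * A ^ (N * p) * (((real p ^ p) powr ?s) ^ N * fact N powr (1 / k)) * cmod (mpow x \<gamma>) ^ (N * p)"
      using c pos by (intro mult_right_mono mult_left_mono fact_mult_powr_le) auto
    also have "\<dots> = C * A' ^ N * fact N powr (1 / k) * cmod (mpow x (p *s \<gamma>)) ^ N"
    proof -
      have "A ^ (N * p) = (A ^ p) ^ N" "cmod (mpow x \<gamma>) ^ (N * p) = (cmod (mpow x \<gamma>) ^ p) ^ N"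
        by (simp_all add: mult.commute[of N] power_mult)
      then show ?thesis by (simp only: A'_def power_mult_distrib mpow_mult norm_power mult_ac)
    qed
    finally show ?thesis .
  qed
  have "dir_sum (p *s \<gamma>) k a \<rho> C A' \<theta>"
    unfolding dir_sum_def
  proof (intro conjI allI)
    have "sector_dom (p *s \<gamma>) \<rho> \<subseteq> polydisc R"
      using sector_dom_mono[OF \<rho>(3)] sector_dom_subset_polydisc[OF R(1,2)] by blast
    then show "mono_coeff (p *s \<gamma>) a n \<in> bounded_holo_series (sector_dom (p *s \<gamma>) \<rho>)" for n
      using R(3) by (rule bounded_holo_series_mono)
    show "\<exists>\<delta>>pi / k. \<exists>f. holo_on_sector (p *s \<gamma>) f (mono_sector (p *s \<gamma>) (\<theta> - \<delta> / 2) (\<theta> + \<delta> / 2) \<rho>) \<and>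
       (\<forall>(x, \<phi>)\<in>mono_sector (p *s \<gamma>) (\<theta> - \<delta> / 2) (\<theta> + \<delta> / 2) \<rho>. \<forall>N.
          norm (f (x, \<phi>) - mfps_sum (trunc (p *s \<gamma>) N a) x) \<le> C * A' ^ N * fact N powr (1 / k) * cmod (mpow x (p *s \<gamma>)) ^ N)"
      using wide holo bound by blast
  qed
  moreover have "0 \<le> A'" using c by (simp add: A'_def)
  ultimately show thesis using that \<rho>(1) c(3) by blast
qed

text \<open>A direction \<psi> for x^\<gamma> corresponds to p \<psi> for x^(p\<gamma>), so finite
  sets of singular directions are carried over in both senses.\<close>

lemma mono_summable_mult:
  fixes \<gamma> :: "nat^'d::finite"
  assumes \<gamma>: "\<forall>j. 0 < \<gamma> $ j" and pos: "0 < p" "0 < k"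
  shows "mono_summable (p *s \<gamma>) k = (mono_summable \<gamma> (real p * k) :: ('d, 'e::complex_banach) mfps set)"
proof (intro equalityI subsetI)
  fix a :: "('d, 'e) mfps" assume a: "a \<in> mono_summable (p *s \<gamma>) k"
  then have O: "a \<in> Ohat'" by (simp add: mono_summable_def)
  obtain \<Theta> where \<Theta>: "finite \<Theta>" "\<forall>\<theta>. (\<forall>\<tau>\<in>\<Theta>. \<forall>m::int. \<theta> \<noteq> \<tau> + 2 * pi * of_int m) \<longrightarrow> mono_summable_dir (p *s \<gamma>) k a \<theta>"
    using a unfolding mono_summable_def mem_Collect_eq by blast
  have gr: "coeff_growth (p *s \<gamma>) (1 / k) a"
    by (rule mono_summable_coeff_growth[OF a]) (use \<gamma> pos in auto)
  \<comment> \<open>Each singular direction modulo 2\<pi> has p preimages modulo 2\<pi> under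
    multiplication by p.\<close>
  define \<Theta>' where "\<Theta>' = (\<lambda>(\<tau>, j). (\<tau> + 2 * pi * real j) / real p) ` (\<Theta> \<times> {..<p})"
  have "mono_summable_dir \<gamma> (real p * k) a \<psi>" if \<psi>: "\<forall>\<tau>\<in>\<Theta>'. \<forall>m::int. \<psi> \<noteq> \<tau> + 2 * pi * of_int m" for \<psi>
  proof -
    have "real p * \<psi> \<noteq> \<tau> + 2 * pi * of_int m" if "\<tau> \<in> \<Theta>" for \<tau> and m :: int
    proof
      assume eq: "real p * \<psi> = \<tau> + 2 * pi * of_int m"
      define j where "j = nat (m mod int p)"
      have m: "0 \<le> m mod int p" "m mod int p < int p" using pos by auto
      then have "j < p" by (simp add: j_def nat_less_iff)
      have "m = int j + int p * (m div int p)" using m by (simp add: j_def)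
      then have "real_of_int m = of_int (int j + int p * (m div int p))" by simp
      then have "real_of_int m = real j + real p * of_int (m div int p)" by simp
      then have "\<psi> = (\<tau> + 2 * pi * real j) / real p + 2 * pi * of_int (m div int p)"
        using eq pos by (simp add: field_simps)
      moreover have "(\<tau> + 2 * pi * real j) / real p \<in> \<Theta>'"
        unfolding \<Theta>'_def using that \<open>j < p\<close> by (intro image_eqI[of _ _ "(\<tau>, j)"]) auto
      ultimately show False using \<psi> by blast
    qed
    then have "mono_summable_dir (p *s \<gamma>) k a (real p * \<psi>)" using \<Theta>(2)[rule_format, of "real p * \<psi>"] by simp
    then obtain \<rho> C A where d: "0 < \<rho>" "0 \<le> C" "0 \<le> A" "dir_sum (p *s \<gamma>) k a \<rho> C A (real p * \<psi>)"
      by (rule dir_sum_of_summable[OF _ pos(2)]) (rule that)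
    have "dir_sum (p *s \<gamma>) k a \<rho> C (A + 1) (real p * \<psi>)" by (rule dir_sum_mono[OF d(4)]) (use d in auto)
    then obtain \<rho>' C' A' where "0 < \<rho>'" "0 \<le> C'" "0 \<le> A'" "dir_sum \<gamma> (real p * k) a \<rho>' C' A' \<psi>"
      by (rule dir_sum_divide[OF _ gr pos d(1,2)]) (use d in simp, rule that)
    then show ?thesis using summable_of_dir_sum O by blast
  qed
  moreover have "finite \<Theta>'" unfolding \<Theta>'_def using \<Theta>(1) by simp
  ultimately show "a \<in> mono_summable \<gamma> (real p * k)" unfolding mono_summable_def using O by blast
next
  fix a :: "('d, 'e) mfps" assume a: "a \<in> mono_summable \<gamma> (real p * k)"
  then have O: "a \<in> Ohat'" by (simp add: mono_summable_def)
  obtain \<Theta> where \<Theta>: "finite \<Theta>" "\<forall>\<theta>. (\<forall>\<tau>\<in>\<Theta>. \<forall>m::int. \<theta> \<noteq> \<tau> + 2 * pi * of_int m) \<longrightarrow> mono_summable_dir \<gamma> (real p * k) a \<theta>"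
    using a unfolding mono_summable_def mem_Collect_eq by blast
  have "coeff_growth \<gamma> (1 / (real p * k)) a"
    by (rule mono_summable_coeff_growth[OF a]) (use \<gamma> pos in auto)
  then have cr: "common_radius (p *s \<gamma>) a"
    unfolding common_radius_mult[OF pos(1)] by (rule coeff_growth_common_radius)
  have "mono_summable_dir (p *s \<gamma>) k a \<theta>" if \<theta>: "\<forall>\<tau>\<in>(*) (real p) ` \<Theta>. \<forall>m::int. \<theta> \<noteq> \<tau> + 2 * pi * of_int m" for \<theta>
  proof -
    have "mono_summable_dir \<gamma> (real p * k) a ((\<theta> + 2 * pi * real j) / real p)" for j
    proof -
      have "(\<theta> + 2 * pi * real j) / real p \<noteq> \<tau> + 2 * pi * of_int m" if "\<tau> \<in> \<Theta>" for \<tau> and m :: int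
      proof
        assume "(\<theta> + 2 * pi * real j) / real p = \<tau> + 2 * pi * of_int m"
        then have "\<theta> = real p * \<tau> + 2 * pi * of_int (int p * m - int j)" using pos by (simp add: field_simps)
        then show False using \<theta> that by blast
      qed
      then show ?thesis using \<Theta>(2)[rule_format, of "(\<theta> + 2 * pi * real j) / real p"] by simp
    qed
    then obtain \<rho> C A where "0 < \<rho>" "0 \<le> C" "0 \<le> A" "dir_sum (p *s \<gamma>) k a \<rho> C A \<theta>"
      by (rule dir_sum_multiply[OF cr pos]) (rule that)
    then show ?thesis using summable_of_dir_sum O by blast
  qed
  then show "a \<in> mono_summable (p *s \<gamma>) k"
    unfolding mono_summable_def using O \<Theta>(1) by blast
qed

text \<open>The quotient of exponents is the same in every component. In lowest terms p/q,
  coprimality makes p divide every component of \<alpha>, and both exponents are multiples of one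
  \<gamma> with k p = k' q.\<close>

lemma mono_summable_proportional:
  fixes \<alpha> \<alpha>' :: "nat^'d::finite"
  assumes \<alpha>: "\<forall>j. 0 < \<alpha> $ j" and \<alpha>': "\<forall>j. 0 < \<alpha>' $ j" and k: "0 < k" "0 < k'"
    and ratio: "\<forall>j. k * real (\<alpha> $ j) = k' * real (\<alpha>' $ j)"
  shows "mono_summable \<alpha> k = (mono_summable \<alpha>' k' :: ('d, 'e::complex_banach) mfps set)"
proof -
  obtain i :: 'd where True by blast
  define d where "d = gcd (\<alpha> $ i) (\<alpha>' $ i)"
  have d: "d \<noteq> 0" using \<alpha> by (simp add: d_def)
  define p q where "p = \<alpha> $ i div d" and "q = \<alpha>' $ i div d"
  have ip: "\<alpha> $ i = p * d" "\<alpha>' $ i = q * d" by (simp_all add: p_def q_def d_def)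
  have cop: "coprime p q" unfolding p_def q_def d_def using \<alpha> by (intro div_gcd_coprime) (auto simp: neq0_conv)
  have pq: "0 < p" "0 < q" using \<alpha> \<alpha>' ip by (metis mult_eq_0_iff neq0_conv)+
  have "k * real p * real d = k' * real q * real d" using ratio[rule_format, of i] by (simp add: ip)
  then have kpq: "k * real p = k' * real q" using d by simp
  have cross: "\<alpha> $ j * q = \<alpha>' $ j * p" for j
  proof -
    have "k' * (real (\<alpha> $ j) * real q) = real (\<alpha> $ j) * (k * real p)" by (simp add: kpq)
    also have "\<dots> = k' * (real (\<alpha>' $ j) * real p)" using ratio[rule_format, of j] by (simp add: mult_ac)
    finally have "real (\<alpha> $ j) * real q = real (\<alpha>' $ j) * real p" using k by simp
    then show ?thesis by (metis of_nat_eq_iff of_nat_mult)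
  qed
  have "p dvd \<alpha> $ j" for j
    using cross[of j] cop by (metis coprime_dvd_mult_left_iff dvd_triv_right)
  then have \<gamma>p: "\<alpha> $ j = p * (\<alpha> $ j div p)" for j by simp
  define \<gamma> where "\<gamma> = (\<chi> j. \<alpha> $ j div p)"
  have 1: "\<alpha> = p *s \<gamma>" using \<gamma>p by (simp add: \<gamma>_def vec_eq_iff)
  have "\<alpha>' $ j = q * (\<alpha> $ j div p)" for j
  proof -
    have "\<alpha>' $ j * p = (q * (\<alpha> $ j div p)) * p" using cross[of j] \<gamma>p[of j] by (metis mult.commute mult.left_commute)
    then show ?thesis using pq by simp
  qed
  then have 2: "\<alpha>' = q *s \<gamma>" by (simp add: \<gamma>_def vec_eq_iff)
  have \<gamma>: "\<forall>j. 0 < \<gamma> $ j" using \<alpha> unfolding 1 by simp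
  show ?thesis
    unfolding 1 2 mono_summable_mult[OF \<gamma> pq(1) k(1)] mono_summable_mult[OF \<gamma> pq(2) k(2)]
    using kpq by (simp add: mult.commute)
qed

text \<open>If the constant weight 1 gives a tie, raising the weight of a component where the
  exponents differ by one breaks it.\<close>

lemma exists_weight_distinguishing:
  fixes \<alpha> \<alpha>' :: "nat^'d::finite"
  assumes "\<not> (\<forall>j. k * real (\<alpha> $ j) = k' * real (\<alpha>' $ j))"
  obtains w where "\<forall>j. 0 < w $ j" "k * real (wdot w \<alpha>) \<noteq> k' * real (wdot w \<alpha>')"
proof -
  obtain i where i: "k * real (\<alpha> $ i) \<noteq> k' * real (\<alpha>' $ i)" using assms by blast
  define w1 where "w1 = ((\<chi> j. 1) :: nat^'d)"
  define w2 where "w2 = ((\<chi> j. if j = i then 2 else 1) :: nat^'d)"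
  have w2: "wdot w2 \<beta> = wdot w1 \<beta> + \<beta> $ i" for \<beta>
  proof -
    have "wdot w2 \<beta> = (\<Sum>j\<in>UNIV. \<beta> $ j + (if j = i then \<beta> $ j else 0))"
      unfolding wdot_def w2_def by (intro sum.cong) auto
    then show ?thesis by (simp add: wdot_def w1_def sum.distrib)
  qed
  show thesis
  proof (cases "k * real (wdot w1 \<alpha>) = k' * real (wdot w1 \<alpha>')")
    case True
    then have "k * real (wdot w2 \<alpha>) \<noteq> k' * real (wdot w2 \<alpha>')" using i by (simp add: w2 distrib_left)
    then show ?thesis using that[of w2] by (simp add: w2_def)
  next
    case False
    then show ?thesis using that[of w1] by (simp add: w1_def)
  qed
qed

section \<open>Assembling the four statements\<close>

lemma convergent_in_summable:
  assumes "0 < k" "a \<in> convergent_series"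
  shows "a \<in> mono_summable \<alpha> k"
proof -
  obtain C A where "exp_bounded a C A" using assms(2) by (rule convergent_imp_exp_bounded)
  then show ?thesis using assms(1) by (rule exp_bounded_imp_summable)
qed

lemma convergent_of_summable_growth:
  fixes f :: "('d::finite, 'e::complex_banach) mfps"
  assumes "\<forall>j. 0 < w $ j" "\<forall>j. 0 < \<alpha> $ j" "\<forall>j. 0 < \<alpha>' $ j" "0 < k" "0 < k'"
    "f \<in> mono_summable \<alpha> k" "coeff_growth \<alpha>' (1 / k') f"
    "k * real (wdot w \<alpha>) < k' * real (wdot w \<alpha>')"
  shows "f \<in> convergent_series"
proof -
  obtain C A where "exp_bounded f C A"
    by (rule exp_bounded_of_summable[of w \<alpha> \<alpha>' k "1 / k'" f]) (use assms in \<open>auto simp: mult.commute\<close>)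
  then show ?thesis by (rule exp_bounded_imp_convergent)
qed

theorem theorem5p5:
  fixes \<alpha> \<alpha>' :: "nat^'d" and k k' :: real
  assumes "\<forall>j. 0 < \<alpha> $ j" and "\<forall>j. 0 < \<alpha>' $ j" and "0 < k" and "0 < k'"
  shows
    "(\<forall>(f :: ('d, 'e::complex_banach) mfps) s.
        f \<in> mono_summable \<alpha> k \<and> 0 \<le> s \<and> s < 1 / k \<and> gevrey_series s (mono_coeff \<alpha> f)
          \<longrightarrow> f \<in> convergent_series)
     \<and>
     (Max (range (\<lambda>j. real (\<alpha> $ j) / real (\<alpha>' $ j))) < k' / k \<longrightarrow>
        mono_summable \<alpha> k \<inter> gevrey_space \<alpha>' (1 / k')
          = (convergent_series :: ('d, 'e) mfps set))
     \<and>
     (\<not> (\<forall>j. k * real (\<alpha> $ j) = k' * real (\<alpha>' $ j)) \<longrightarrow>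
        mono_summable \<alpha> k \<inter> mono_summable \<alpha>' k' = (convergent_series :: ('d, 'e) mfps set))
     \<and>
     ((\<forall>j. k * real (\<alpha> $ j) = k' * real (\<alpha>' $ j)) \<longrightarrow>
        mono_summable \<alpha> k = (mono_summable \<alpha>' k' :: ('d, 'e) mfps set))"
proof (intro conjI impI allI)
  fix f :: "('d, 'e) mfps" and s
  assume f: "f \<in> mono_summable \<alpha> k \<and> 0 \<le> s \<and> s < 1 / k \<and> gevrey_series s (mono_coeff \<alpha> f)"
  \<comment> \<open>The one-variable exponent \<langle>w,\<alpha>\<rangle>/s requires a positive
    order, while s = 0 is allowed; the midpoint is positive and still below 1/k.\<close>
  define s' where "s' = (s + 1 / k) / 2"
  have s': "0 < s'" "s \<le> s'" "s' < 1 / k" using f assms(3) by (auto simp: s'_def add_nonneg_pos)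
  define w where "w = ((\<chi> j. 1) :: nat^'d)"
  have w: "\<forall>j. 0 < w $ j" by (simp add: w_def)
  have "coeff_growth \<alpha> s' f"
    using coeff_growth_mono[OF coeff_growth_gevrey[OF assms(1)] s'(2)] f by blast
  moreover have "k * real (wdot w \<alpha>) < 1 / s' * real (wdot w \<alpha>)"
    using s' assms(3) wdot_pos[OF w assms(1)] by (simp add: field_simps)
  ultimately show "f \<in> convergent_series"
    using convergent_of_summable_growth[of w \<alpha> \<alpha> k "1 / s'" f] w assms f s'(1) by simp
next
  assume max: "Max (range (\<lambda>j. real (\<alpha> $ j) / real (\<alpha>' $ j))) < k' / k"
  \<comment> \<open>The bound on the maximum is a strict inequality in every component, so constant
    weights already separate the two exponents.\<close>
  define w where "w = ((\<chi> j. 1) :: nat^'d)"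
  have w: "\<forall>j. 0 < w $ j" by (simp add: w_def)
  have "real (\<alpha> $ j) / real (\<alpha>' $ j) < k' / k" for j
    using max by (rule le_less_trans[rotated]) (auto intro: Max_ge)
  then have "k * real (\<alpha> $ j) < k' * real (\<alpha>' $ j)" for j
    using assms by (simp add: field_simps)
  then have less: "k * real (wdot w \<alpha>) < k' * real (wdot w \<alpha>')"
    by (simp add: wdot_def w_def sum_distrib_left sum_strict_mono)
  show "mono_summable \<alpha> k \<inter> gevrey_space \<alpha>' (1 / k') = (convergent_series :: ('d, 'e) mfps set)"
  proof (intro equalityI subsetI)
    fix f :: "('d, 'e) mfps" assume f: "f \<in> mono_summable \<alpha> k \<inter> gevrey_space \<alpha>' (1 / k')"
    have "coeff_growth \<alpha>' (1 / k') f"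
      by (rule coeff_growth_gevrey[OF assms(2)]) (use f assms(4) in \<open>auto simp: gevrey_space_def\<close>)
    then show "f \<in> convergent_series"
      using convergent_of_summable_growth[OF w assms(1-4) _ _ less] f by blast
  next
    fix f :: "('d, 'e) mfps" assume f: "f \<in> convergent_series"
    then obtain C A where "exp_bounded f C A" by (rule convergent_imp_exp_bounded)
    then have "f \<in> Ohat'" "coeff_growth \<alpha>' (1 / k') f"
      using assms(4) by (simp_all add: exp_bounded_imp_Ohat' exp_bounded_imp_growth)
    then have "f \<in> gevrey_space \<alpha>' (1 / k')"
      unfolding gevrey_space_def using coeff_growth_imp_gevrey[of \<alpha>' "1 / k'" f] assms(4) by simp
    then show "f \<in> mono_summable \<alpha> k \<inter> gevrey_space \<alpha>' (1 / k')"
      using convergent_in_summable[OF assms(3) f] by simp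
  qed
next
  assume "\<not> (\<forall>j. k * real (\<alpha> $ j) = k' * real (\<alpha>' $ j))"
  then obtain w where w: "\<forall>j. 0 < w $ j" "k * real (wdot w \<alpha>) \<noteq> k' * real (wdot w \<alpha>')"
    by (rule exists_weight_distinguishing)
  show "mono_summable \<alpha> k \<inter> mono_summable \<alpha>' k' = (convergent_series :: ('d, 'e) mfps set)"
  proof (intro equalityI subsetI)
    fix f :: "('d, 'e) mfps" assume f: "f \<in> mono_summable \<alpha> k \<inter> mono_summable \<alpha>' k'"
    then have gr: "coeff_growth \<alpha> (1 / k) f" "coeff_growth \<alpha>' (1 / k') f"
      using mono_summable_coeff_growth assms by auto
    show "f \<in> convergent_series"
    \<comment> \<open>Either series of exponents may be the larger one. Each summability also
      supplies a growth condition, so the two roles can be exchanged.\<close>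
    proof (cases "k * real (wdot w \<alpha>) < k' * real (wdot w \<alpha>')")
      case True
      then show ?thesis using convergent_of_summable_growth[OF w(1) assms(1-4) _ gr(2)] f by blast
    next
      case False
      then have "k' * real (wdot w \<alpha>') < k * real (wdot w \<alpha>)" using w(2) by simp
      then show ?thesis using convergent_of_summable_growth[OF w(1) assms(2,1,4,3) _ gr(1)] f by blast
    qed
  next
    fix f :: "('d, 'e) mfps" assume "f \<in> convergent_series"
    then show "f \<in> mono_summable \<alpha> k \<inter> mono_summable \<alpha>' k'"
      using assms(3,4) by (simp add: convergent_in_summable)
  qed
next
  assume "\<forall>j. k * real (\<alpha> $ j) = k' * real (\<alpha>' $ j)"
  then show "mono_summable \<alpha> k = (mono_summable \<alpha>' k' :: ('d, 'e) mfps set)"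
    by (rule mono_summable_proportional[OF assms])
qed

end
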